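(* Assume that for every universe \(\mathcal T\), the type \(\Omega_{\mathcal T}\) is \(\mathcal U_0\)-small. Then the following are equivalent for a poset \(X\) with carrier in a universe \(\mathcal U\): (i) \(X\) has suprema for all subsets (i.e. for all \(S:X\to\Omega_{\mathcal T}\), for every universe \(\mathcal T\)); (ii) \(X\) has suprema for all \(\mathcal U\)-covered subsets; (iii) \(X\) has suprema for all subsets whose total spaces are \(\mathcal U\)-small; (iv) \(X\) has suprema for all families \(I\to X\) with \(I:\mathcal U\).
   Context: Work in univalent foundations (intensional Martin-Löf type theory with universes, \(\mathcal U_0\) the first universe, function and propositional extensionality, propositional truncations). A type is \(\mathcal W\)-small if equivalent to a type in \(\mathcal W\). \(\Omega_{\mathcal T}\) is the type of propositions in \(\mathcal T\). A poset is a type with a proposition-valued reflexive, transitive, antisymmetric relation. A subset of \(X\) is a map \(S:X\to\Omega_{\mathcal T}\) for some universe \(\mathcal T\); its total space is \(\mathbb T(S):=\Sigma_{x:X}(x\in S)\); a supremum of \(S\) is a least upper bound of the elements in \(S\). \(S\) is \(\mathcal U\)-covered if there is a type \(I:\mathcal U\) with a surjection \(I\to\mathbb T(S)\). *)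

theory Defs
  imports Main
begin

section \<open>Intensional Martin-Loef type theory\<close>

text \<open>
  The mathematics takes place inside a type theory, which is not the logic of HOL, so the type
  theory is represented by its syntax and its derivable judgements.  Terms are raw de Bruijn
  terms; \<open>wk k\<close> weakens by \<open>k\<close> variables and \<open>inst\<close> instantiates the last one.  \<open>Pi\<close> and \<open>Sg\<close> bind one variable in their second argument, \<open>Wt\<close> likewise, and \<open>Lam\<close>
  binds one variable; no other constructor binds.  Abstractions and eliminators carry no type
  annotations: domains and motives occur in the typing rules only.
  The universe \<open>Univ n\<close> is the n-th universe, so \<open>Univ 0\<close> is the first one, the successor
  of \<open>Univ n\<close> is \<open>Univ (Suc n)\<close>, and least upper bounds are given by \<open>max\<close>.
\<close>

datatype tm =
    Var nat
  | Univ nat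
  | Pi tm tm | Lam tm | App tm tm
  | Sg tm tm | Pr tm tm | Split tm tm
  | Eq tm tm tm | Refl | J tm tm
  | Void nat | Absurd tm
  | One nat | Star | OneRec tm tm
  | Natt | Zr | Sc tm | NatRec tm tm tm
  | Coprod tm tm | InL tm | InR tm | Case tm tm tm
  | Wt tm tm | Tree tm tm | WRec tm tm
  | Trunc tm | TrIn tm | TrPath tm tm | TrRec tm tm tm
  | FunExt tm
  | PropExt tm tm
  | Ax tm

definition up_ren :: "(nat \<Rightarrow> nat) \<Rightarrow> nat \<Rightarrow> nat" where
  "up_ren r = case_nat 0 (\<lambda>i. Suc (r i))"

primrec ren :: "(nat \<Rightarrow> nat) \<Rightarrow> tm \<Rightarrow> tm" where
  "ren r (Var i) = Var (r i)"
| "ren r (Univ n) = Univ n"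
| "ren r (Pi A B) = Pi (ren r A) (ren (up_ren r) B)"
| "ren r (Lam b) = Lam (ren (up_ren r) b)"
| "ren r (App f a) = App (ren r f) (ren r a)"
| "ren r (Sg A B) = Sg (ren r A) (ren (up_ren r) B)"
| "ren r (Pr a b) = Pr (ren r a) (ren r b)"
| "ren r (Split d p) = Split (ren r d) (ren r p)"
| "ren r (Eq A a b) = Eq (ren r A) (ren r a) (ren r b)"
| "ren r Refl = Refl"
| "ren r (J d p) = J (ren r d) (ren r p)"
| "ren r (Void n) = Void n"
| "ren r (Absurd p) = Absurd (ren r p)"
| "ren r (One n) = One n"
| "ren r Star = Star"
| "ren r (OneRec d p) = OneRec (ren r d) (ren r p)"
| "ren r Natt = Natt"
| "ren r Zr = Zr"
| "ren r (Sc n) = Sc (ren r n)"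
| "ren r (NatRec z s n) = NatRec (ren r z) (ren r s) (ren r n)"
| "ren r (Coprod A B) = Coprod (ren r A) (ren r B)"
| "ren r (InL a) = InL (ren r a)"
| "ren r (InR b) = InR (ren r b)"
| "ren r (Case l m p) = Case (ren r l) (ren r m) (ren r p)"
| "ren r (Wt A B) = Wt (ren r A) (ren (up_ren r) B)"
| "ren r (Tree a f) = Tree (ren r a) (ren r f)"
| "ren r (WRec d p) = WRec (ren r d) (ren r p)"
| "ren r (Trunc A) = Trunc (ren r A)"
| "ren r (TrIn a) = TrIn (ren r a)"
| "ren r (TrPath a b) = TrPath (ren r a) (ren r b)"
| "ren r (TrRec h f p) = TrRec (ren r h) (ren r f) (ren r p)"
| "ren r (FunExt h) = FunExt (ren r h)"
| "ren r (PropExt u v) = PropExt (ren r u) (ren r v)"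
| "ren r (Ax A) = Ax A"

definition wk :: "nat \<Rightarrow> tm \<Rightarrow> tm" where
  "wk k = ren (\<lambda>i. i + k)"

definition up_sub :: "(nat \<Rightarrow> tm) \<Rightarrow> nat \<Rightarrow> tm" where
  "up_sub s = case_nat (Var 0) (\<lambda>i. wk 1 (s i))"

primrec sub :: "(nat \<Rightarrow> tm) \<Rightarrow> tm \<Rightarrow> tm" where
  "sub s (Var i) = s i"
| "sub s (Univ n) = Univ n"
| "sub s (Pi A B) = Pi (sub s A) (sub (up_sub s) B)"
| "sub s (Lam b) = Lam (sub (up_sub s) b)"
| "sub s (App f a) = App (sub s f) (sub s a)"
| "sub s (Sg A B) = Sg (sub s A) (sub (up_sub s) B)"
| "sub s (Pr a b) = Pr (sub s a) (sub s b)"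
| "sub s (Split d p) = Split (sub s d) (sub s p)"
| "sub s (Eq A a b) = Eq (sub s A) (sub s a) (sub s b)"
| "sub s Refl = Refl"
| "sub s (J d p) = J (sub s d) (sub s p)"
| "sub s (Void n) = Void n"
| "sub s (Absurd p) = Absurd (sub s p)"
| "sub s (One n) = One n"
| "sub s Star = Star"
| "sub s (OneRec d p) = OneRec (sub s d) (sub s p)"
| "sub s Natt = Natt"
| "sub s Zr = Zr"
| "sub s (Sc n) = Sc (sub s n)"
| "sub s (NatRec z t n) = NatRec (sub s z) (sub s t) (sub s n)"
| "sub s (Coprod A B) = Coprod (sub s A) (sub s B)"
| "sub s (InL a) = InL (sub s a)"
| "sub s (InR b) = InR (sub s b)"
| "sub s (Case l m p) = Case (sub s l) (sub s m) (sub s p)"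
| "sub s (Wt A B) = Wt (sub s A) (sub (up_sub s) B)"
| "sub s (Tree a f) = Tree (sub s a) (sub s f)"
| "sub s (WRec d p) = WRec (sub s d) (sub s p)"
| "sub s (Trunc A) = Trunc (sub s A)"
| "sub s (TrIn a) = TrIn (sub s a)"
| "sub s (TrPath a b) = TrPath (sub s a) (sub s b)"
| "sub s (TrRec h f p) = TrRec (sub s h) (sub s f) (sub s p)"
| "sub s (FunExt h) = FunExt (sub s h)"
| "sub s (PropExt u v) = PropExt (sub s u) (sub s v)"
| "sub s (Ax A) = Ax A"

definition inst :: "tm \<Rightarrow> tm \<Rightarrow> tm" where
  "inst B a = sub (case_nat a Var) B"

text \<open>
  In \<open>A \<rightharpoonup> B\<close> and \<open>A \<otimes> B\<close>, unlike in \<open>Pi A B\<close> and \<open>Sg A B\<close>, both arguments live in the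
  same context.
\<close>

definition arr :: "tm \<Rightarrow> tm \<Rightarrow> tm" (infixr "\<rightharpoonup>" 60) where
  "A \<rightharpoonup> B = Pi A (wk 1 B)"

definition prd :: "tm \<Rightarrow> tm \<Rightarrow> tm" (infixr "\<otimes>" 65) where
  "A \<otimes> B = Sg A (wk 1 B)"

definition Fst :: "tm \<Rightarrow> tm" where
  "Fst p = Split (Lam (Lam (Var 1))) p"

definition Snd :: "tm \<Rightarrow> tm" where
  "Snd p = Split (Lam (Lam (Var 0))) p"

definition is_prop :: "tm \<Rightarrow> tm" where
  "is_prop A = Pi A (Pi (wk 1 A) (Eq (wk 2 A) (Var 1) (Var 0)))"

text \<open>
  Definitional equality is convertibility of raw terms: the congruence generated by the
  computation rules and the uniqueness rule for functions.  Truncation, function extensionality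
  and propositional extensionality have no computation rules.
\<close>

inductive conv :: "tm \<Rightarrow> tm \<Rightarrow> bool" (infix "\<approx>" 50) where
  conv_refl: "t \<approx> t"
| conv_sym: "t \<approx> u \<Longrightarrow> u \<approx> t"
| conv_trans: "t \<approx> u \<Longrightarrow> u \<approx> v \<Longrightarrow> t \<approx> v"
| beta: "App (Lam b) a \<approx> inst b a"
| eta: "Lam (App (wk 1 f) (Var 0)) \<approx> f"
| split_pr: "Split d (Pr a b) \<approx> App (App d a) b"
| J_refl: "J d Refl \<approx> d"
| one_star: "OneRec d Star \<approx> d"
| nat_zr: "NatRec z s Zr \<approx> z"
| nat_sc: "NatRec z s (Sc n) \<approx> App (App s n) (NatRec z s n)"
| case_inl: "Case l m (InL a) \<approx> App l a"
| case_inr: "Case l m (InR b) \<approx> App m b"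
| w_tree: "WRec d (Tree a f) \<approx>
    App (App (App d a) f) (Lam (WRec (wk 1 d) (App (wk 1 f) (Var 0))))"
| c_pi: "A \<approx> A' \<Longrightarrow> B \<approx> B' \<Longrightarrow> Pi A B \<approx> Pi A' B'"
| c_lam: "b \<approx> b' \<Longrightarrow> Lam b \<approx> Lam b'"
| c_app: "f \<approx> f' \<Longrightarrow> a \<approx> a' \<Longrightarrow> App f a \<approx> App f' a'"
| c_sg: "A \<approx> A' \<Longrightarrow> B \<approx> B' \<Longrightarrow> Sg A B \<approx> Sg A' B'"
| c_pr: "a \<approx> a' \<Longrightarrow> b \<approx> b' \<Longrightarrow> Pr a b \<approx> Pr a' b'"
| c_split: "d \<approx> d' \<Longrightarrow> p \<approx> p' \<Longrightarrow> Split d p \<approx> Split d' p'"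
| c_eq: "A \<approx> A' \<Longrightarrow> a \<approx> a' \<Longrightarrow> b \<approx> b' \<Longrightarrow> Eq A a b \<approx> Eq A' a' b'"
| c_J: "d \<approx> d' \<Longrightarrow> p \<approx> p' \<Longrightarrow> J d p \<approx> J d' p'"
| c_absurd: "p \<approx> p' \<Longrightarrow> Absurd p \<approx> Absurd p'"
| c_onerec: "d \<approx> d' \<Longrightarrow> p \<approx> p' \<Longrightarrow> OneRec d p \<approx> OneRec d' p'"
| c_sc: "n \<approx> n' \<Longrightarrow> Sc n \<approx> Sc n'"
| c_natrec: "z \<approx> z' \<Longrightarrow> s \<approx> s' \<Longrightarrow> n \<approx> n' \<Longrightarrow> NatRec z s n \<approx> NatRec z' s' n'"
| c_coprod: "A \<approx> A' \<Longrightarrow> B \<approx> B' \<Longrightarrow> Coprod A B \<approx> Coprod A' B'"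
| c_inl: "a \<approx> a' \<Longrightarrow> InL a \<approx> InL a'"
| c_inr: "b \<approx> b' \<Longrightarrow> InR b \<approx> InR b'"
| c_case: "l \<approx> l' \<Longrightarrow> m \<approx> m' \<Longrightarrow> p \<approx> p' \<Longrightarrow> Case l m p \<approx> Case l' m' p'"
| c_wt: "A \<approx> A' \<Longrightarrow> B \<approx> B' \<Longrightarrow> Wt A B \<approx> Wt A' B'"
| c_tree: "a \<approx> a' \<Longrightarrow> f \<approx> f' \<Longrightarrow> Tree a f \<approx> Tree a' f'"
| c_wrec: "d \<approx> d' \<Longrightarrow> p \<approx> p' \<Longrightarrow> WRec d p \<approx> WRec d' p'"
| c_trunc: "A \<approx> A' \<Longrightarrow> Trunc A \<approx> Trunc A'"
| c_trin: "a \<approx> a' \<Longrightarrow> TrIn a \<approx> TrIn a'"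
| c_trpath: "a \<approx> a' \<Longrightarrow> b \<approx> b' \<Longrightarrow> TrPath a b \<approx> TrPath a' b'"
| c_trrec: "h \<approx> h' \<Longrightarrow> f \<approx> f' \<Longrightarrow> p \<approx> p' \<Longrightarrow> TrRec h f p \<approx> TrRec h' f' p'"
| c_funext: "h \<approx> h' \<Longrightarrow> FunExt h \<approx> FunExt h'"
| c_propext: "u \<approx> u' \<Longrightarrow> v \<approx> v' \<Longrightarrow> PropExt u v \<approx> PropExt u' v'"

text \<open>
  \<open>\<Theta> \<bar> \<Gamma> \<turnstile> t : A\<close>: in the type theory extended by the (possibly infinite) set \<open>\<Theta>\<close> of
  closed types as axioms, \<open>t\<close> has type \<open>A\<close> in context \<open>\<Gamma>\<close>.  The constant \<open>Ax A\<close> is the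
  postulated element of \<open>A \<in> \<Theta>\<close>.  The head of \<open>\<Gamma>\<close> is the type of \<open>Var 0\<close>.
  Universes are not cumulative.  The rule for \<open>J\<close> is based path induction.  Motives are
  functions into a universe.
\<close>

inductive typing :: "tm set \<Rightarrow> tm list \<Rightarrow> tm \<Rightarrow> tm \<Rightarrow> bool"
    ("_ \<bar> _ \<turnstile> _ : _" [51, 51, 51, 51] 50) for \<Theta> :: "tm set" where
  axiom: "\<lbrakk>A \<in> \<Theta>; \<Theta> \<bar> [] \<turnstile> A : Univ n\<rbrakk> \<Longrightarrow> \<Theta> \<bar> [] \<turnstile> Ax A : A"
| var: "\<Theta> \<bar> \<Gamma> \<turnstile> A : Univ n \<Longrightarrow> \<Theta> \<bar> A # \<Gamma> \<turnstile> Var 0 : wk 1 A"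
| weaken: "\<lbrakk>\<Theta> \<bar> \<Gamma> \<turnstile> t : B; \<Theta> \<bar> \<Gamma> \<turnstile> A : Univ n\<rbrakk> \<Longrightarrow> \<Theta> \<bar> A # \<Gamma> \<turnstile> wk 1 t : wk 1 B"
| convert: "\<lbrakk>\<Theta> \<bar> \<Gamma> \<turnstile> t : A; A \<approx> B; \<Theta> \<bar> \<Gamma> \<turnstile> B : Univ n\<rbrakk> \<Longrightarrow> \<Theta> \<bar> \<Gamma> \<turnstile> t : B"

| univ: "\<Theta> \<bar> [] \<turnstile> Univ n : Univ (Suc n)"

| pi: "\<lbrakk>\<Theta> \<bar> \<Gamma> \<turnstile> A : Univ m; \<Theta> \<bar> A # \<Gamma> \<turnstile> B : Univ n\<rbrakk> \<Longrightarrow>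
    \<Theta> \<bar> \<Gamma> \<turnstile> Pi A B : Univ (max m n)"
| lam: "\<lbrakk>\<Theta> \<bar> \<Gamma> \<turnstile> A : Univ m; \<Theta> \<bar> A # \<Gamma> \<turnstile> B : Univ n; \<Theta> \<bar> A # \<Gamma> \<turnstile> b : B\<rbrakk> \<Longrightarrow>
    \<Theta> \<bar> \<Gamma> \<turnstile> Lam b : Pi A B"
| app: "\<lbrakk>\<Theta> \<bar> \<Gamma> \<turnstile> f : Pi A B; \<Theta> \<bar> \<Gamma> \<turnstile> a : A\<rbrakk> \<Longrightarrow> \<Theta> \<bar> \<Gamma> \<turnstile> App f a : inst B a"

| sg: "\<lbrakk>\<Theta> \<bar> \<Gamma> \<turnstile> A : Univ m; \<Theta> \<bar> A # \<Gamma> \<turnstile> B : Univ n\<rbrakk> \<Longrightarrow>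
    \<Theta> \<bar> \<Gamma> \<turnstile> Sg A B : Univ (max m n)"
| pr: "\<lbrakk>\<Theta> \<bar> \<Gamma> \<turnstile> A : Univ m; \<Theta> \<bar> A # \<Gamma> \<turnstile> B : Univ n;
    \<Theta> \<bar> \<Gamma> \<turnstile> a : A; \<Theta> \<bar> \<Gamma> \<turnstile> b : inst B a\<rbrakk> \<Longrightarrow> \<Theta> \<bar> \<Gamma> \<turnstile> Pr a b : Sg A B"
| split: "\<lbrakk>\<Theta> \<bar> \<Gamma> \<turnstile> C : Sg A B \<rightharpoonup> Univ n;
    \<Theta> \<bar> \<Gamma> \<turnstile> d : Pi A (Pi B (App (wk 2 C) (Pr (Var 1) (Var 0))));
    \<Theta> \<bar> \<Gamma> \<turnstile> p : Sg A B\<rbrakk> \<Longrightarrow> \<Theta> \<bar> \<Gamma> \<turnstile> Split d p : App C p"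

| eq: "\<lbrakk>\<Theta> \<bar> \<Gamma> \<turnstile> A : Univ n; \<Theta> \<bar> \<Gamma> \<turnstile> a : A; \<Theta> \<bar> \<Gamma> \<turnstile> b : A\<rbrakk> \<Longrightarrow>
    \<Theta> \<bar> \<Gamma> \<turnstile> Eq A a b : Univ n"
| refl: "\<lbrakk>\<Theta> \<bar> \<Gamma> \<turnstile> A : Univ n; \<Theta> \<bar> \<Gamma> \<turnstile> a : A\<rbrakk> \<Longrightarrow> \<Theta> \<bar> \<Gamma> \<turnstile> Refl : Eq A a a"
| path_ind: "\<lbrakk>\<Theta> \<bar> \<Gamma> \<turnstile> C : Pi A (Eq (wk 1 A) (wk 1 a) (Var 0) \<rightharpoonup> Univ n);
    \<Theta> \<bar> \<Gamma> \<turnstile> d : App (App C a) Refl;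
    \<Theta> \<bar> \<Gamma> \<turnstile> a : A; \<Theta> \<bar> \<Gamma> \<turnstile> b : A; \<Theta> \<bar> \<Gamma> \<turnstile> p : Eq A a b\<rbrakk> \<Longrightarrow>
    \<Theta> \<bar> \<Gamma> \<turnstile> J d p : App (App C b) p"

| void: "\<Theta> \<bar> [] \<turnstile> Void n : Univ n"
| absurd: "\<lbrakk>\<Theta> \<bar> \<Gamma> \<turnstile> C : Void m \<rightharpoonup> Univ n; \<Theta> \<bar> \<Gamma> \<turnstile> p : Void m\<rbrakk> \<Longrightarrow>
    \<Theta> \<bar> \<Gamma> \<turnstile> Absurd p : App C p"

| one: "\<Theta> \<bar> [] \<turnstile> One n : Univ n"
| star: "\<Theta> \<bar> [] \<turnstile> Star : One n"
| one_ind: "\<lbrakk>\<Theta> \<bar> \<Gamma> \<turnstile> C : One m \<rightharpoonup> Univ n; \<Theta> \<bar> \<Gamma> \<turnstile> d : App C Star; \<Theta> \<bar> \<Gamma> \<turnstile> p : One m\<rbrakk> \<Longrightarrow>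
    \<Theta> \<bar> \<Gamma> \<turnstile> OneRec d p : App C p"

| natt: "\<Theta> \<bar> [] \<turnstile> Natt : Univ 0"
| zr: "\<Theta> \<bar> [] \<turnstile> Zr : Natt"
| sc: "\<Theta> \<bar> \<Gamma> \<turnstile> k : Natt \<Longrightarrow> \<Theta> \<bar> \<Gamma> \<turnstile> Sc k : Natt"
| nat_ind: "\<lbrakk>\<Theta> \<bar> \<Gamma> \<turnstile> C : Natt \<rightharpoonup> Univ n; \<Theta> \<bar> \<Gamma> \<turnstile> z : App C Zr;
    \<Theta> \<bar> \<Gamma> \<turnstile> s : Pi Natt (App (wk 1 C) (Var 0) \<rightharpoonup> App (wk 1 C) (Sc (Var 0)));
    \<Theta> \<bar> \<Gamma> \<turnstile> k : Natt\<rbrakk> \<Longrightarrow> \<Theta> \<bar> \<Gamma> \<turnstile> NatRec z s k : App C k"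

| coprod: "\<lbrakk>\<Theta> \<bar> \<Gamma> \<turnstile> A : Univ m; \<Theta> \<bar> \<Gamma> \<turnstile> B : Univ n\<rbrakk> \<Longrightarrow>
    \<Theta> \<bar> \<Gamma> \<turnstile> Coprod A B : Univ (max m n)"
| inl: "\<lbrakk>\<Theta> \<bar> \<Gamma> \<turnstile> Coprod A B : Univ n; \<Theta> \<bar> \<Gamma> \<turnstile> a : A\<rbrakk> \<Longrightarrow> \<Theta> \<bar> \<Gamma> \<turnstile> InL a : Coprod A B"
| inr: "\<lbrakk>\<Theta> \<bar> \<Gamma> \<turnstile> Coprod A B : Univ n; \<Theta> \<bar> \<Gamma> \<turnstile> b : B\<rbrakk> \<Longrightarrow> \<Theta> \<bar> \<Gamma> \<turnstile> InR b : Coprod A B"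
| coprod_ind: "\<lbrakk>\<Theta> \<bar> \<Gamma> \<turnstile> C : Coprod A B \<rightharpoonup> Univ n;
    \<Theta> \<bar> \<Gamma> \<turnstile> l : Pi A (App (wk 1 C) (InL (Var 0)));
    \<Theta> \<bar> \<Gamma> \<turnstile> m : Pi B (App (wk 1 C) (InR (Var 0)));
    \<Theta> \<bar> \<Gamma> \<turnstile> p : Coprod A B\<rbrakk> \<Longrightarrow> \<Theta> \<bar> \<Gamma> \<turnstile> Case l m p : App C p"

| wt: "\<lbrakk>\<Theta> \<bar> \<Gamma> \<turnstile> A : Univ m; \<Theta> \<bar> A # \<Gamma> \<turnstile> B : Univ n\<rbrakk> \<Longrightarrow>
    \<Theta> \<bar> \<Gamma> \<turnstile> Wt A B : Univ (max m n)"
| tree: "\<lbrakk>\<Theta> \<bar> \<Gamma> \<turnstile> Wt A B : Univ n; \<Theta> \<bar> \<Gamma> \<turnstile> a : A; \<Theta> \<bar> \<Gamma> \<turnstile> f : inst B a \<rightharpoonup> Wt A B\<rbrakk> \<Longrightarrow>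
    \<Theta> \<bar> \<Gamma> \<turnstile> Tree a f : Wt A B"
| w_ind: "\<lbrakk>\<Theta> \<bar> \<Gamma> \<turnstile> C : Wt A B \<rightharpoonup> Univ n;
    \<Theta> \<bar> \<Gamma> \<turnstile> d : Pi A (Pi (B \<rightharpoonup> wk 1 (Wt A B))
      (Pi (wk 1 B) (App (wk 3 C) (App (Var 1) (Var 0))) \<rightharpoonup>
       App (wk 2 C) (Tree (Var 1) (Var 0))));
    \<Theta> \<bar> \<Gamma> \<turnstile> p : Wt A B\<rbrakk> \<Longrightarrow> \<Theta> \<bar> \<Gamma> \<turnstile> WRec d p : App C p"

| trunc: "\<Theta> \<bar> \<Gamma> \<turnstile> A : Univ n \<Longrightarrow> \<Theta> \<bar> \<Gamma> \<turnstile> Trunc A : Univ n"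
| trin: "\<lbrakk>\<Theta> \<bar> \<Gamma> \<turnstile> A : Univ n; \<Theta> \<bar> \<Gamma> \<turnstile> a : A\<rbrakk> \<Longrightarrow> \<Theta> \<bar> \<Gamma> \<turnstile> TrIn a : Trunc A"
| trpath: "\<lbrakk>\<Theta> \<bar> \<Gamma> \<turnstile> A : Univ n; \<Theta> \<bar> \<Gamma> \<turnstile> p : Trunc A; \<Theta> \<bar> \<Gamma> \<turnstile> q : Trunc A\<rbrakk> \<Longrightarrow>
    \<Theta> \<bar> \<Gamma> \<turnstile> TrPath p q : Eq (Trunc A) p q"
| trrec: "\<lbrakk>\<Theta> \<bar> \<Gamma> \<turnstile> P : Univ n; \<Theta> \<bar> \<Gamma> \<turnstile> h : is_prop P;
    \<Theta> \<bar> \<Gamma> \<turnstile> f : A \<rightharpoonup> P; \<Theta> \<bar> \<Gamma> \<turnstile> p : Trunc A\<rbrakk> \<Longrightarrow> \<Theta> \<bar> \<Gamma> \<turnstile> TrRec h f p : P"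

| funext: "\<lbrakk>\<Theta> \<bar> \<Gamma> \<turnstile> Pi A B : Univ n; \<Theta> \<bar> \<Gamma> \<turnstile> f : Pi A B; \<Theta> \<bar> \<Gamma> \<turnstile> g : Pi A B;
    \<Theta> \<bar> \<Gamma> \<turnstile> h : Pi A (Eq B (App (wk 1 f) (Var 0)) (App (wk 1 g) (Var 0)))\<rbrakk> \<Longrightarrow>
    \<Theta> \<bar> \<Gamma> \<turnstile> FunExt h : Eq (Pi A B) f g"
| propext: "\<lbrakk>\<Theta> \<bar> \<Gamma> \<turnstile> P : Univ n; \<Theta> \<bar> \<Gamma> \<turnstile> Q : Univ n;
    \<Theta> \<bar> \<Gamma> \<turnstile> h : is_prop P; \<Theta> \<bar> \<Gamma> \<turnstile> k : is_prop Q;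
    \<Theta> \<bar> \<Gamma> \<turnstile> u : P \<rightharpoonup> Q; \<Theta> \<bar> \<Gamma> \<turnstile> v : Q \<rightharpoonup> P\<rbrakk> \<Longrightarrow>
    \<Theta> \<bar> \<Gamma> \<turnstile> PropExt u v : Eq (Univ n) P Q"

definition inhabited :: "tm set \<Rightarrow> tm list \<Rightarrow> tm \<Rightarrow> bool" where
  "inhabited \<Theta> \<Gamma> A \<longleftrightarrow> (\<exists>t. \<Theta> \<bar> \<Gamma> \<turnstile> t : A)"

text \<open>
  A condition that quantifies over all universes is not a single type but the set of its
  instances.  A type follows from such a set of hypotheses if it follows, inside the type
  theory, from finitely many of them.
\<close>

definition entails :: "tm set \<Rightarrow> tm list \<Rightarrow> tm set \<Rightarrow> tm \<Rightarrow> bool" where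
  "entails \<Theta> \<Gamma> \<Phi> B \<longleftrightarrow> (\<exists>As. set As \<subseteq> \<Phi> \<and> inhabited \<Theta> \<Gamma> (foldr arr As B))"

definition all_equivalent :: "tm set \<Rightarrow> tm list \<Rightarrow> tm set set \<Rightarrow> bool" where
  "all_equivalent \<Theta> \<Gamma> \<C> \<longleftrightarrow> (\<forall>\<Phi>\<in>\<C>. \<forall>\<Psi>\<in>\<C>. \<forall>B\<in>\<Psi>. entails \<Theta> \<Gamma> \<Phi> B)"


section \<open>Equivalences, smallness and subsets\<close>

text \<open>An equivalence is a map with a section and a retraction.\<close>

definition is_equiv :: "tm \<Rightarrow> tm \<Rightarrow> tm \<Rightarrow> tm" where
  "is_equiv A B f =
     Sg (B \<rightharpoonup> A) (Pi (wk 1 B) (Eq (wk 2 B) (App (wk 2 f) (App (Var 1) (Var 0))) (Var 0))) \<otimes>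
     Sg (B \<rightharpoonup> A) (Pi (wk 1 A) (Eq (wk 2 A) (App (Var 1) (App (wk 2 f) (Var 0))) (Var 0)))"

definition equiv :: "tm \<Rightarrow> tm \<Rightarrow> tm" where
  "equiv A B = Sg (A \<rightharpoonup> B) (is_equiv (wk 1 A) (wk 1 B) (Var 0))"

definition is_small :: "nat \<Rightarrow> tm \<Rightarrow> tm" where
  "is_small n A = Sg (Univ n) (equiv (Var 0) (wk 1 A))"

definition is_surjection :: "tm \<Rightarrow> tm \<Rightarrow> tm \<Rightarrow> tm" where
  "is_surjection A B f =
     Pi B (Trunc (Sg (wk 1 A) (Eq (wk 2 B) (App (wk 2 f) (Var 0)) (Var 1))))"

definition Omega :: "nat \<Rightarrow> tm" where
  "Omega n = Sg (Univ n) (is_prop (Var 0))"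

definition subset_type :: "nat \<Rightarrow> tm \<Rightarrow> tm" where
  "subset_type t X = (X \<rightharpoonup> Omega t)"

definition mem :: "tm \<Rightarrow> tm \<Rightarrow> tm" where
  "mem x S = Fst (App S x)"

definition total_space :: "tm \<Rightarrow> tm \<Rightarrow> tm" where
  "total_space X S = Sg X (mem (Var 0) (wk 1 S))"

text \<open>Being covered is a property: the covering type and the surjection merely exist.\<close>

definition is_covered :: "nat \<Rightarrow> tm \<Rightarrow> tm \<Rightarrow> tm" where
  "is_covered n X S =
     Trunc (Sg (Univ n) (Sg (Var 0 \<rightharpoonup> wk 1 (total_space X S))
       (is_surjection (Var 1) (wk 2 (total_space X S)) (Var 0))))"


section \<open>Posets and suprema\<close>

text \<open>The order \<open>R\<close> is a function from \<open>X\<close> to \<open>X \<rightharpoonup> Omega w\<close>.\<close>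

definition le :: "tm \<Rightarrow> tm \<Rightarrow> tm \<Rightarrow> tm" where
  "le R x y = Fst (App (App R x) y)"

definition is_poset :: "tm \<Rightarrow> tm \<Rightarrow> tm" where
  "is_poset X R =
     Pi X (le (wk 1 R) (Var 0) (Var 0)) \<otimes>
     Pi X (Pi (wk 1 X) (Pi (wk 2 X)
       (le (wk 3 R) (Var 2) (Var 1) \<rightharpoonup> le (wk 3 R) (Var 1) (Var 0) \<rightharpoonup>
        le (wk 3 R) (Var 2) (Var 0)))) \<otimes>
     Pi X (Pi (wk 1 X)
       (le (wk 2 R) (Var 1) (Var 0) \<rightharpoonup> le (wk 2 R) (Var 0) (Var 1) \<rightharpoonup>
        Eq (wk 2 X) (Var 1) (Var 0)))"

definition is_sup_of_subset :: "tm \<Rightarrow> tm \<Rightarrow> tm \<Rightarrow> tm \<Rightarrow> tm" where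
  "is_sup_of_subset X R S s =
     Pi X (mem (Var 0) (wk 1 S) \<rightharpoonup> le (wk 1 R) (Var 0) (wk 1 s)) \<otimes>
     Pi X (Pi (wk 1 X) (mem (Var 0) (wk 2 S) \<rightharpoonup> le (wk 2 R) (Var 0) (Var 1)) \<rightharpoonup>
       le (wk 1 R) (wk 1 s) (Var 0))"

text \<open>
  By antisymmetry a supremum is unique, so no truncation is needed to say that one exists.
\<close>

definition subset_has_sup :: "tm \<Rightarrow> tm \<Rightarrow> tm \<Rightarrow> tm" where
  "subset_has_sup X R S = Sg X (is_sup_of_subset (wk 1 X) (wk 1 R) (wk 1 S) (Var 0))"

definition is_sup_of_family :: "tm \<Rightarrow> tm \<Rightarrow> tm \<Rightarrow> tm \<Rightarrow> tm \<Rightarrow> tm" where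
  "is_sup_of_family X R I f s =
     Pi I (le (wk 1 R) (App (wk 1 f) (Var 0)) (wk 1 s)) \<otimes>
     Pi X (Pi (wk 1 I) (le (wk 2 R) (App (wk 2 f) (Var 0)) (Var 1)) \<rightharpoonup>
       le (wk 1 R) (wk 1 s) (Var 0))"

definition family_has_sup :: "tm \<Rightarrow> tm \<Rightarrow> tm \<Rightarrow> tm \<Rightarrow> tm" where
  "family_has_sup X R I f =
     Sg X (is_sup_of_family (wk 1 X) (wk 1 R) (wk 1 I) (wk 1 f) (Var 0))"

definition sups_of_subsets :: "nat \<Rightarrow> tm \<Rightarrow> tm \<Rightarrow> tm" where
  "sups_of_subsets t X R = Pi (subset_type t X) (subset_has_sup (wk 1 X) (wk 1 R) (Var 0))"

definition sups_of_covered_subsets :: "nat \<Rightarrow> nat \<Rightarrow> tm \<Rightarrow> tm \<Rightarrow> tm" where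
  "sups_of_covered_subsets t u X R =
     Pi (subset_type t X)
       (is_covered u (wk 1 X) (Var 0) \<rightharpoonup> subset_has_sup (wk 1 X) (wk 1 R) (Var 0))"

definition sups_of_small_subsets :: "nat \<Rightarrow> nat \<Rightarrow> tm \<Rightarrow> tm \<Rightarrow> tm" where
  "sups_of_small_subsets t u X R =
     Pi (subset_type t X)
       (is_small u (total_space (wk 1 X) (Var 0)) \<rightharpoonup>
        subset_has_sup (wk 1 X) (wk 1 R) (Var 0))"

definition sups_of_families :: "nat \<Rightarrow> tm \<Rightarrow> tm \<Rightarrow> tm" where
  "sups_of_families u X R =
     Pi (Univ u) (Pi (Var 0 \<rightharpoonup> wk 1 X)
       (family_has_sup (wk 2 X) (wk 2 R) (Var 1) (Var 0)))"

end

theory Submission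
  imports Defs
begin

text \<open>
  A family with the same elements as a subset has the same upper bounds, hence the same supremum;
  the truncation in "the same elements" is harmless because the order is proposition-valued.
  So it suffices to pass between families and subsets.  The image of a family over \<open>I\<close> in \<open>Univ u\<close>
  has its total space in \<open>Univ u\<close> again; that total space is small and covers itself by the identity.
  Conversely, let \<open>g\<close> map \<open>Omega t\<close> into a type in \<open>Univ 0\<close> with a left inverse.  By propositional
  extensionality \<open>P\<close> holds iff \<open>g P = g truth\<close>, which is a type in \<open>Univ 0\<close>; replacing membership
  by this identity type turns the total space of any subset into a family indexed in \<open>Univ u\<close>.
\<close>

section \<open>Substitution calculus\<close>

text \<open>\<open>inhabited\<close> is a statement about derivability: that one type is inhabited
  whenever another is does not give a term of the function type between them. An implication becomes
  internal once it is known in the context extended by its own premise, which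
  \<open>inhabited_arr\<close> then abstracts. For this reason contexts stay arbitrary throughout
  and hypotheses are bundled into predicates closed under weakening (\<open>enumerates\<close>,
  \<open>resizing\<close>, \<open>resized_order\<close>). Typing is never shown to be closed under
  substitution; only raw terms have a substitution calculus. Two devices replace it: premises saying
  that an instance of a family is a type, and families carried around as lambda abstractions, which
  can be weakened and applied. Universes are not cumulative, so levels must agree exactly. An image
  of a family in \<open>Univ u\<close> is a subset valued in \<open>Omega u\<close>, and this fixes
  the level at which a condition on subsets serves as a premise, while as a conclusion it is reached
  at every level.\<close>

text \<open>An opaque name for the renaming in \<open>wk\<close>, so that rewriting does not disturb it.\<close>

definition shift :: "nat \<Rightarrow> nat \<Rightarrow> nat" where
  "shift k = (\<lambda>i. i + k)"

lemma shift_apply [simp]: "shift k i = i + k"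
  by (simp add: shift_def)

lemma wk_eq_ren_shift: "wk k = ren (shift k)"
  by (simp add: wk_def shift_def)

lemma ren_shift [simp]: "ren (shift k) t = wk k t"
  by (simp add: wk_eq_ren_shift)

lemma up_ren_simps [simp]: "up_ren r 0 = 0" "up_ren r (Suc i) = Suc (r i)"
  by (simp_all add: up_ren_def)

lemma up_sub_simps [simp]: "up_sub s 0 = Var 0" "up_sub s (Suc i) = wk 1 (s i)"
  by (simp_all add: up_sub_def)

lemma wk_Var [simp]: "wk k (Var i) = Var (i + k)"
  by (simp add: wk_def)

lemma up_ren_id: "up_ren (\<lambda>i. i) = (\<lambda>i. i)"
  by (auto simp: up_ren_def split: nat.split)

lemma ren_id: "ren (\<lambda>i. i) t = t"
  by (induction t) (simp_all add: up_ren_id)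

lemma up_ren_comp: "up_ren r (up_ren q i) = up_ren (\<lambda>i. r (q i)) i"
  by (cases i) simp_all

lemma ren_ren: "ren r (ren q t) = ren (\<lambda>i. r (q i)) t"
  by (induction t arbitrary: r q) (simp_all add: up_ren_comp)

lemma up_sub_up_ren: "up_sub s (up_ren r i) = up_sub (\<lambda>i. s (r i)) i"
  by (cases i) simp_all

lemma sub_ren: "sub s (ren r t) = sub (\<lambda>i. s (r i)) t"
  by (induction t arbitrary: r s) (simp_all add: up_sub_up_ren)

lemma up_sub_Var: "up_sub Var = Var"
  by (auto simp: up_sub_def fun_eq_iff split: nat.split)

lemma sub_Var [simp]: "sub Var t = t"
  by (induction t) (simp_all add: up_sub_Var)

lemma ren_up_sub: "ren (up_ren r) (up_sub s i) = up_sub (\<lambda>i. ren r (s i)) i"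
  by (cases i) (simp_all add: wk_eq_ren_shift ren_ren del: ren_shift)

lemma ren_sub: "ren r (sub s t) = sub (\<lambda>i. ren r (s i)) t"
  by (induction t arbitrary: r s) (simp_all add: ren_up_sub)

lemma ren_eq_sub: "ren r t = sub (\<lambda>i. Var (r i)) t"
  using sub_ren[of Var r t] by simp

lemma sub_eqI: "(\<And>i. s i = s' i) \<Longrightarrow> sub s t = sub s' t"
  by (metis ext)

lemma wk_0 [simp]: "wk 0 t = t"
  by (simp add: wk_def ren_id)

lemma wk_wk [simp]: "wk j (wk k t) = wk (k + j) t"
  by (simp add: wk_def ren_ren add.assoc)

text \<open>A term weakened at least once does not mention the variable of the enclosing binder, so
  the operation passes under the binder and one weakening stays outside.\<close>

lemma ren_up_wk [simp]: "ren (up_ren r) (wk (Suc k) t) = wk 1 (ren r (wk k t))"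
  by (simp add: wk_def ren_ren)

lemma sub_up_wk [simp]: "sub (up_sub s) (wk (Suc k) t) = wk 1 (sub s (wk k t))"
  by (simp add: wk_def sub_ren ren_sub)

lemma sub_case_wk [simp]: "sub (case_nat a s) (wk (Suc k) t) = sub s (wk k t)"
  by (simp add: wk_def sub_ren)

lemma ren_up_shift [simp]:
  "ren (up_ren (shift j)) (ren (up_ren (shift k)) t) = ren (up_ren (shift (k + j))) t"
  "ren (up_ren (up_ren (shift j))) (ren (up_ren (up_ren (shift k))) t) =
    ren (up_ren (up_ren (shift (k + j)))) t"
  by (simp_all add: ren_ren up_ren_comp add.assoc shift_def)

lemma wk_simps [simp]:
  "wk k (Univ n) = Univ n"
  "wk k (Pi A B) = Pi (wk k A) (ren (up_ren (shift k)) B)"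
  "wk k (Lam b) = Lam (ren (up_ren (shift k)) b)"
  "wk k (App f a) = App (wk k f) (wk k a)"
  "wk k (Sg A B) = Sg (wk k A) (ren (up_ren (shift k)) B)"
  "wk k (Pr a b) = Pr (wk k a) (wk k b)"
  "wk k (Split d p) = Split (wk k d) (wk k p)"
  "wk k (Eq A a b) = Eq (wk k A) (wk k a) (wk k b)"
  "wk k Refl = Refl"
  "wk k (J d p) = J (wk k d) (wk k p)"
  "wk k (One n) = One n"
  "wk k Star = Star"
  "wk k (OneRec d p) = OneRec (wk k d) (wk k p)"
  "wk k (Trunc A) = Trunc (wk k A)"
  "wk k (TrIn a) = TrIn (wk k a)"
  "wk k (TrPath a b) = TrPath (wk k a) (wk k b)"
  by (simp_all add: wk_eq_ren_shift del: ren_shift)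

lemma inst_eq [simp]: "inst B a = sub (case_nat a Var) B"
  by (simp add: inst_def)

text \<open>The cancellation rules match weakenings of the form \<open>wk (Suc k)\<close>, so the
  amounts in \<open>wk 2\<close> and \<open>wk 3\<close> are turned into successors.\<close>

declare numeral_2_eq_2 [simp] numeral_3_eq_3 [simp]

lemma ren_defs [simp]:
  "ren r (A \<rightharpoonup> B) = ren r A \<rightharpoonup> ren r B"
  "ren r (A \<otimes> B) = ren r A \<otimes> ren r B"
  "ren r (Fst a) = Fst (ren r a)"
  "ren r (Snd a) = Snd (ren r a)"
  "ren r (is_prop A) = is_prop (ren r A)"
  "ren r (Omega n) = Omega n"
  "ren r (mem a S) = mem (ren r a) (ren r S)"
  "ren r (le R a b) = le (ren r R) (ren r a) (ren r b)"
  by (simp_all add: arr_def prd_def Fst_def Snd_def is_prop_def Omega_def mem_def le_def)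

lemma wk_defs [simp]:
  "wk k (A \<rightharpoonup> B) = wk k A \<rightharpoonup> wk k B"
  "wk k (A \<otimes> B) = wk k A \<otimes> wk k B"
  "wk k (Fst a) = Fst (wk k a)"
  "wk k (Snd a) = Snd (wk k a)"
  "wk k (is_prop A) = is_prop (wk k A)"
  "wk k (Omega n) = Omega n"
  "wk k (mem a S) = mem (wk k a) (wk k S)"
  "wk k (le R a b) = le (wk k R) (wk k a) (wk k b)"
  by (simp_all add: wk_eq_ren_shift del: ren_shift)

lemma sub_defs [simp]:
  "sub s (A \<rightharpoonup> B) = sub s A \<rightharpoonup> sub s B"
  "sub s (A \<otimes> B) = sub s A \<otimes> sub s B"
  "sub s (Fst a) = Fst (sub s a)"
  "sub s (Snd a) = Snd (sub s a)"
  "sub s (is_prop A) = is_prop (sub s A)"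
  "sub s (Omega n) = Omega n"
  "sub s (mem a S) = mem (sub s a) (sub s S)"
  "sub s (le R a b) = le (sub s R) (sub s a) (sub s b)"
  by (simp_all add: arr_def prd_def Fst_def Snd_def is_prop_def Omega_def mem_def le_def)


section \<open>Derived rules\<close>

text \<open>A derivable judgement certifies that its context is well formed: contexts grow only by
  variable introduction and weakening, and both supply a typing of the new entry. The closed
  constants, typed in the empty context, can therefore be weakened into
  \<open>\<Gamma>\<close>.\<close>

lemma typing_context:
  assumes "\<Theta> \<bar> \<Gamma> \<turnstile> t : A"
  shows "(\<Theta> \<bar> \<Gamma> \<turnstile> Univ n : Univ (Suc n)) \<and> (\<Theta> \<bar> \<Gamma> \<turnstile> One n : Univ n) \<and> (\<Theta> \<bar> \<Gamma> \<turnstile> Star : One n)"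
  using assms
proof (induction arbitrary: n)
  case (var \<Gamma> A m)
  then show ?case
    using typing.weaken[where A = A and \<Gamma> = \<Gamma> and n = m] by (metis wk_simps(1,11,12))
next
  case (weaken \<Gamma> t B A m)
  then show ?case
    using typing.weaken[where A = A and \<Gamma> = \<Gamma> and n = m] by (metis wk_simps(1,11,12))
qed (blast intro: typing.intros)+

text \<open>Formation and conversion accept any universe, so the level is forgotten here; it is
  tracked only where smallness is at stake.\<close>

definition is_type :: "tm set \<Rightarrow> tm list \<Rightarrow> tm \<Rightarrow> bool" where
  "is_type \<Theta> \<Gamma> A \<longleftrightarrow> (\<exists>n. \<Theta> \<bar> \<Gamma> \<turnstile> A : Univ n)"

lemma is_typeI: "\<Theta> \<bar> \<Gamma> \<turnstile> A : Univ n \<Longrightarrow> is_type \<Theta> \<Gamma> A"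
  by (auto simp: is_type_def)

lemma inhabitedI: "\<Theta> \<bar> \<Gamma> \<turnstile> t : A \<Longrightarrow> inhabited \<Theta> \<Gamma> A"
  by (auto simp: inhabited_def)

lemma typing_univ: "\<Theta> \<bar> \<Gamma> \<turnstile> t : A \<Longrightarrow> \<Theta> \<bar> \<Gamma> \<turnstile> Univ n : Univ (Suc n)"
  and typing_one: "\<Theta> \<bar> \<Gamma> \<turnstile> t : A \<Longrightarrow> \<Theta> \<bar> \<Gamma> \<turnstile> One n : Univ n"
  and typing_star: "\<Theta> \<bar> \<Gamma> \<turnstile> t : A \<Longrightarrow> \<Theta> \<bar> \<Gamma> \<turnstile> Star : One n"
  using typing_context by blast+

lemma typing_weaken:
  "\<Theta> \<bar> \<Gamma> \<turnstile> t : B \<Longrightarrow> is_type \<Theta> \<Gamma> A \<Longrightarrow> \<Theta> \<bar> A # \<Gamma> \<turnstile> wk (Suc 0) t : wk (Suc 0) B"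
  using typing.weaken by (auto simp: is_type_def)

lemma is_type_weaken:
  "is_type \<Theta> \<Gamma> B \<Longrightarrow> is_type \<Theta> \<Gamma> A \<Longrightarrow> is_type \<Theta> (A # \<Gamma>) (wk (Suc 0) B)"
  using typing_weaken[of \<Theta> \<Gamma> B "Univ _" A] by (auto simp: is_type_def)

lemma inhabited_weaken:
  "inhabited \<Theta> \<Gamma> B \<Longrightarrow> is_type \<Theta> \<Gamma> A \<Longrightarrow> inhabited \<Theta> (A # \<Gamma>) (wk (Suc 0) B)"
  unfolding inhabited_def using typing_weaken by blast

lemma typing_var: "is_type \<Theta> \<Gamma> A \<Longrightarrow> \<Theta> \<bar> A # \<Gamma> \<turnstile> Var 0 : wk (Suc 0) A"
  using typing.var by (auto simp: is_type_def)

lemma typing_conv: "\<Theta> \<bar> \<Gamma> \<turnstile> t : A \<Longrightarrow> A \<approx> B \<Longrightarrow> is_type \<Theta> \<Gamma> B \<Longrightarrow> \<Theta> \<bar> \<Gamma> \<turnstile> t : B"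
  unfolding is_type_def using typing.convert by blast

lemma inhabited_conv: "inhabited \<Theta> \<Gamma> A \<Longrightarrow> A \<approx> B \<Longrightarrow> is_type \<Theta> \<Gamma> B \<Longrightarrow> inhabited \<Theta> \<Gamma> B"
  unfolding inhabited_def using typing_conv by blast

section \<open>Formation, introduction and application rules up to inhabitation\<close>

lemma is_type_pi: "is_type \<Theta> \<Gamma> A \<Longrightarrow> is_type \<Theta> (A # \<Gamma>) B \<Longrightarrow> is_type \<Theta> \<Gamma> (Pi A B)"
  unfolding is_type_def using typing.pi by blast

lemma is_type_sg: "is_type \<Theta> \<Gamma> A \<Longrightarrow> is_type \<Theta> (A # \<Gamma>) B \<Longrightarrow> is_type \<Theta> \<Gamma> (Sg A B)"
  unfolding is_type_def using typing.sg by blast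

lemma typing_arr:
  "\<Theta> \<bar> \<Gamma> \<turnstile> A : Univ m \<Longrightarrow> \<Theta> \<bar> \<Gamma> \<turnstile> B : Univ n \<Longrightarrow> \<Theta> \<bar> \<Gamma> \<turnstile> A \<rightharpoonup> B : Univ (max m n)"
  using typing.pi typing_weaken[of \<Theta> \<Gamma> B "Univ n" A] by (simp add: arr_def is_typeI)

lemma is_type_arr: "is_type \<Theta> \<Gamma> A \<Longrightarrow> is_type \<Theta> \<Gamma> B \<Longrightarrow> is_type \<Theta> \<Gamma> (A \<rightharpoonup> B)"
  unfolding is_type_def using typing_arr by blast

lemma is_type_prd: "is_type \<Theta> \<Gamma> A \<Longrightarrow> is_type \<Theta> \<Gamma> B \<Longrightarrow> is_type \<Theta> \<Gamma> (A \<otimes> B)"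
  by (simp add: prd_def is_type_sg is_type_weaken)

lemma typing_lam:
  "is_type \<Theta> \<Gamma> A \<Longrightarrow> is_type \<Theta> (A # \<Gamma>) B \<Longrightarrow> \<Theta> \<bar> A # \<Gamma> \<turnstile> b : B \<Longrightarrow> \<Theta> \<bar> \<Gamma> \<turnstile> Lam b : Pi A B"
  unfolding is_type_def using typing.lam by blast

lemma typing_lam_arr:
  "is_type \<Theta> \<Gamma> A \<Longrightarrow> is_type \<Theta> \<Gamma> B \<Longrightarrow> \<Theta> \<bar> A # \<Gamma> \<turnstile> b : wk (Suc 0) B \<Longrightarrow>
    \<Theta> \<bar> \<Gamma> \<turnstile> Lam b : A \<rightharpoonup> B"
  by (simp add: arr_def typing_lam is_type_weaken)

lemma inhabited_pi:
  "is_type \<Theta> \<Gamma> A \<Longrightarrow> is_type \<Theta> (A # \<Gamma>) B \<Longrightarrow> inhabited \<Theta> (A # \<Gamma>) B \<Longrightarrow> inhabited \<Theta> \<Gamma> (Pi A B)"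
  unfolding inhabited_def using typing_lam by blast

lemma inhabited_arr:
  "is_type \<Theta> \<Gamma> A \<Longrightarrow> is_type \<Theta> \<Gamma> B \<Longrightarrow> inhabited \<Theta> (A # \<Gamma>) (wk (Suc 0) B) \<Longrightarrow>
    inhabited \<Theta> \<Gamma> (A \<rightharpoonup> B)"
  unfolding inhabited_def using typing_lam_arr by blast

lemma typing_app_arr: "\<Theta> \<bar> \<Gamma> \<turnstile> f : A \<rightharpoonup> B \<Longrightarrow> \<Theta> \<bar> \<Gamma> \<turnstile> a : A \<Longrightarrow> \<Theta> \<bar> \<Gamma> \<turnstile> App f a : B"
  using typing.app[of \<Theta> \<Gamma> f A "wk 1 B" a] by (simp add: arr_def)

lemma inhabited_app: "inhabited \<Theta> \<Gamma> (A \<rightharpoonup> B) \<Longrightarrow> inhabited \<Theta> \<Gamma> A \<Longrightarrow> inhabited \<Theta> \<Gamma> B"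
  unfolding inhabited_def using typing_app_arr by blast

lemma inhabited_spec:
  "inhabited \<Theta> \<Gamma> (Pi A B) \<Longrightarrow> \<Theta> \<bar> \<Gamma> \<turnstile> a : A \<Longrightarrow> inhabited \<Theta> \<Gamma> (inst B a)"
  using typing.app unfolding inhabited_def by blast

lemma typing_pr:
  "is_type \<Theta> \<Gamma> A \<Longrightarrow> is_type \<Theta> (A # \<Gamma>) B \<Longrightarrow> \<Theta> \<bar> \<Gamma> \<turnstile> a : A \<Longrightarrow> \<Theta> \<bar> \<Gamma> \<turnstile> b : inst B a \<Longrightarrow>
    \<Theta> \<bar> \<Gamma> \<turnstile> Pr a b : Sg A B"
  using typing.pr unfolding is_type_def by blast

lemma inhabited_sg:
  "is_type \<Theta> \<Gamma> A \<Longrightarrow> is_type \<Theta> (A # \<Gamma>) B \<Longrightarrow> \<Theta> \<bar> \<Gamma> \<turnstile> a : A \<Longrightarrow> inhabited \<Theta> \<Gamma> (inst B a) \<Longrightarrow>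
    inhabited \<Theta> \<Gamma> (Sg A B)"
  using typing_pr unfolding inhabited_def by blast

lemma inhabited_prd:
  "is_type \<Theta> \<Gamma> A \<Longrightarrow> is_type \<Theta> \<Gamma> B \<Longrightarrow> inhabited \<Theta> \<Gamma> A \<Longrightarrow> inhabited \<Theta> \<Gamma> B \<Longrightarrow>
    inhabited \<Theta> \<Gamma> (A \<otimes> B)"
  unfolding prd_def inhabited_def[of _ _ A]
  by (auto intro!: inhabited_sg is_type_weaken)

lemma beta_eq: "inst b a = c \<Longrightarrow> App (Lam b) a \<approx> c"
  using conv.beta by blast

text \<open>
  Weakening is available only at the end of the context, so a family \<open>B\<close> over \<open>A\<close> is moved
  past other variables in the form \<open>App (Lam B) a\<close>.
\<close>

lemma conv_family_var:
  "App (wk 2 (Lam B)) (Var 1) \<approx> wk 1 B"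
  "App (wk 3 (Lam B)) (Var 0) \<approx> ren (up_ren (shift 2)) B"
  "App (wk 2 (Lam B)) (Var 0) \<approx> ren (up_ren (shift 1)) B"
proof -
  have "inst (ren (up_ren (shift 2)) B) (Var 1) = wk 1 B"
    "inst (ren (up_ren (shift 3)) B) (Var 0) = ren (up_ren (shift 2)) B"
    "inst (ren (up_ren (shift 2)) B) (Var 0) = ren (up_ren (shift 1)) B"
    unfolding inst_eq sub_ren wk_eq_ren_shift
    by (subst ren_eq_sub, rule sub_eqI, simp split: nat.split add: up_ren_def)+
  from this[THEN beta_eq] show
    "App (wk 2 (Lam B)) (Var 1) \<approx> wk 1 B"
    "App (wk 3 (Lam B)) (Var 0) \<approx> ren (up_ren (shift 2)) B"
    "App (wk 2 (Lam B)) (Var 0) \<approx> ren (up_ren (shift 1)) B"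
    by simp_all
qed

section \<open>Dependent pairs and their projections\<close>

lemma typing_pr_vars:
  assumes A: "is_type \<Theta> \<Gamma> A" and B: "\<Theta> \<bar> A # \<Gamma> \<turnstile> B : Univ n"
  shows "\<Theta> \<bar> B # A # \<Gamma> \<turnstile> Pr (Var 1) (Var 0) : wk 2 (Sg A B)"
proof -
  let ?\<Delta> = "B # A # \<Gamma>"
  have tB: "is_type \<Theta> (A # \<Gamma>) B" using B by (rule is_typeI)
  have U: "is_type \<Theta> \<Gamma> (Univ n)" using A by (meson is_type_def typing_univ)
  \<comment> \<open>The family \<open>B\<close> is wanted over a context in which other variables
    separate it from \<open>\<Gamma>\<close>. Its abstraction is typed over \<open>\<Gamma>\<close>,
    so it can be weakened and applied to the new variable; beta then returns the renamed
    \<open>B\<close>.\<close>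
  have F: "\<Theta> \<bar> \<Gamma> \<turnstile> Lam B : A \<rightharpoonup> Univ n" using A U B by (simp add: typing_lam_arr)
  have F2: "\<Theta> \<bar> ?\<Delta> \<turnstile> wk 2 (Lam B) : wk 2 A \<rightharpoonup> Univ n"
    using typing_weaken[OF typing_weaken[OF F A] tB] by (simp del: wk_simps(3))
  have A2: "is_type \<Theta> ?\<Delta> (wk 2 A)"
    using is_type_weaken[OF is_type_weaken[OF A A] tB] by simp
  have F3: "\<Theta> \<bar> wk 2 A # ?\<Delta> \<turnstile> App (wk 3 (Lam B)) (Var 0) : Univ n"
    using typing_app_arr[OF typing_weaken[OF F2 A2, simplified] typing_var[OF A2, simplified]] by simp
  have v1: "\<Theta> \<bar> ?\<Delta> \<turnstile> Var 1 : wk 2 A"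
    using typing_weaken[OF typing_var[OF A] tB] by simp
  have v0: "\<Theta> \<bar> ?\<Delta> \<turnstile> Var 0 : wk 1 B" using typing_var[OF tB] by simp
  have "\<Theta> \<bar> ?\<Delta> \<turnstile> App (wk 2 (Lam B)) (Var 1) : Univ n"
    using typing_app_arr[OF F2 v1] .
  then have v0': "\<Theta> \<bar> ?\<Delta> \<turnstile> Var 0 : App (wk 2 (Lam B)) (Var 1)"
    using v0 conv_family_var(1) conv_sym typing_conv is_typeI by metis
  have "\<Theta> \<bar> ?\<Delta> \<turnstile> Pr (Var 1) (Var 0) : Sg (wk 2 A) (App (wk 3 (Lam B)) (Var 0))"
    by (rule typing_pr[OF A2 is_typeI[OF F3] v1]) (use v0' in \<open>simp del: wk_simps(3)\<close>)
  moreover have "Sg (wk 2 A) (App (wk 3 (Lam B)) (Var 0)) \<approx> wk 2 (Sg A B)"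
    using c_sg[OF conv_refl conv_family_var(2)] by simp
  moreover have "is_type \<Theta> ?\<Delta> (wk 2 (Sg A B))"
    using is_type_weaken[OF is_type_weaken[OF is_type_sg[OF A tB] A] tB] by (simp del: wk_simps)
  ultimately show ?thesis by (rule typing_conv)
qed

text \<open>Motives are functions into a universe, so the eliminator produces types that are beta
  redexes. \<open>D\<close> and \<open>E\<close> are the reduced forms in which the branch and the
  result are actually wanted.\<close>

lemma typing_split:
  assumes A: "is_type \<Theta> \<Gamma> A" and B: "is_type \<Theta> (A # \<Gamma>) B"
    and C: "\<Theta> \<bar> \<Gamma> \<turnstile> C : Sg A B \<rightharpoonup> Univ n"
    and d: "\<Theta> \<bar> B # A # \<Gamma> \<turnstile> d : D" and D: "D \<approx> App (wk 2 C) (Pr (Var 1) (Var 0))"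
    and p: "\<Theta> \<bar> \<Gamma> \<turnstile> p : Sg A B"
    and E: "App C p \<approx> E" "is_type \<Theta> \<Gamma> E"
  shows "\<Theta> \<bar> \<Gamma> \<turnstile> Split (Lam (Lam d)) p : E"
proof -
  let ?\<Delta> = "B # A # \<Gamma>"
  have "\<Theta> \<bar> ?\<Delta> \<turnstile> wk 2 C : wk 2 (Sg A B) \<rightharpoonup> Univ n"
    using typing_weaken[OF typing_weaken[OF C A] B] by simp
  then have "\<Theta> \<bar> ?\<Delta> \<turnstile> App (wk 2 C) (Pr (Var 1) (Var 0)) : Univ n"
    using typing_app_arr typing_pr_vars[OF A] B unfolding is_type_def by blast
  then have T: "is_type \<Theta> ?\<Delta> (App (wk 2 C) (Pr (Var 1) (Var 0)))"
    by (rule is_typeI)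
  have "\<Theta> \<bar> \<Gamma> \<turnstile> Lam (Lam d) : Pi A (Pi B (App (wk 2 C) (Pr (Var 1) (Var 0))))"
    by (intro typing_lam A B is_type_pi T typing_conv[OF d D])
  from typing.split[OF C this p] E show ?thesis using typing_conv by blast
qed

lemma typing_fst:
  assumes p: "\<Theta> \<bar> \<Gamma> \<turnstile> p : Sg A B" and A: "is_type \<Theta> \<Gamma> A" and B: "is_type \<Theta> (A # \<Gamma>) B"
  shows "\<Theta> \<bar> \<Gamma> \<turnstile> Fst p : A"
proof -
  obtain n where n: "\<Theta> \<bar> \<Gamma> \<turnstile> A : Univ n" using A by (auto simp: is_type_def)
  have S: "is_type \<Theta> \<Gamma> (Sg A B)" using A B by (rule is_type_sg)
  \<comment> \<open>A constant motive: the type of the first component does not depend on the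
    pair.\<close>
  have C: "\<Theta> \<bar> \<Gamma> \<turnstile> Lam (wk 1 A) : Sg A B \<rightharpoonup> Univ n"
    using S is_typeI[OF typing_univ[OF n]] typing_weaken[OF n S] by (intro typing_lam_arr) simp_all
  show ?thesis unfolding Fst_def
    by (rule typing_split[OF A B C typing_weaken[OF typing_var[OF A] B, simplified, folded One_nat_def] _ p])
      (auto intro!: conv_sym beta_eq A simp: conv_sym beta_eq)
qed

lemma conv_fst: "Fst (Pr a b) \<approx> a"
  unfolding Fst_def
  by (rule conv_trans[OF split_pr], rule conv_trans[OF c_app[OF beta conv_refl]]) (simp add: beta_eq)

lemma conv_Fst: "a \<approx> b \<Longrightarrow> Fst a \<approx> Fst b"
  unfolding Fst_def by (intro c_split conv_refl)

text \<open>Conversion to \<open>E\<close> demands that \<open>E\<close> be a type. Reading this off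
  from \<open>B\<close> would mean substituting \<open>Fst p\<close> into a typing derivation, so it
  is left as a premise.\<close>

lemma typing_snd:
  assumes p: "\<Theta> \<bar> \<Gamma> \<turnstile> p : Sg A B" and A: "is_type \<Theta> \<Gamma> A" and B: "is_type \<Theta> (A # \<Gamma>) B"
    and E: "inst B (Fst p) = E" "is_type \<Theta> \<Gamma> E"
  shows "\<Theta> \<bar> \<Gamma> \<turnstile> Snd p : E"
proof -
  obtain n where n: "\<Theta> \<bar> A # \<Gamma> \<turnstile> B : Univ n" using B by (auto simp: is_type_def)
  have U: "is_type \<Theta> \<Gamma> (Univ n)" using p typing_univ is_typeI by blast
  define F where "F = Lam B"
  let ?S = "Sg A B"
  \<comment> \<open>The motive sends a pair \<open>z\<close> to \<open>B\<close> at
    \<open>Fst z\<close>. Writing it as an application of \<open>F\<close> needs only a weakening of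
    \<open>F\<close>, not a typed substitution into \<open>B\<close>.\<close>
  let ?C = "Lam (App (wk 1 F) (Fst (Var 0)))"
  have S: "is_type \<Theta> \<Gamma> ?S" using A B by (rule is_type_sg)
  have F: "\<Theta> \<bar> \<Gamma> \<turnstile> F : A \<rightharpoonup> Univ n" unfolding F_def using A U n by (simp add: typing_lam_arr)
  have F1: "\<Theta> \<bar> ?S # \<Gamma> \<turnstile> wk 1 F : wk 1 A \<rightharpoonup> Univ n"
    using typing_weaken[OF F S] by simp
  have A1: "is_type \<Theta> (?S # \<Gamma>) (wk 1 A)" using is_type_weaken[OF A S] by simp
  have F2: "is_type \<Theta> (wk 1 A # ?S # \<Gamma>) (App (wk 2 F) (Var 0))"
    using typing_app_arr[OF typing_weaken[OF F1 A1, simplified] typing_var[OF A1, simplified]]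
    by (auto intro: is_typeI)
  have "\<Theta> \<bar> ?S # \<Gamma> \<turnstile> Var 0 : Sg (wk 1 A) (App (wk 2 F) (Var 0))"
    by (rule typing_conv[OF typing_var[OF S] _ is_type_sg[OF A1 F2]])
      (use c_sg[OF conv_refl conv_sym[OF conv_family_var(3)[of B, folded F_def]]] in simp)
  then have "\<Theta> \<bar> ?S # \<Gamma> \<turnstile> App (wk 1 F) (Fst (Var 0)) : Univ n"
    using typing_app_arr[OF F1] typing_fst A1 F2 by blast
  then have C: "\<Theta> \<bar> \<Gamma> \<turnstile> ?C : ?S \<rightharpoonup> Univ n" using S U by (simp add: typing_lam_arr)
  have "App (wk 2 ?C) (Pr (Var 1) (Var 0)) \<approx> App (wk 2 F) (Fst (Pr (Var 1) (Var 0)))"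
    by (simp add: beta_eq)
  moreover have "\<dots> \<approx> App (wk 2 F) (Var 1)" by (intro c_app conv_refl conv_fst)
  moreover note conv_family_var(1)[of B, folded F_def]
  ultimately have D: "wk 1 B \<approx> App (wk 2 ?C) (Pr (Var 1) (Var 0))"
    using conv_sym conv_trans by blast
  have "App ?C p \<approx> App F (Fst p)" 
    by (rule beta_eq) simp
  moreover have "\<dots> \<approx> E" unfolding F_def using E(1) by (rule beta_eq)
  ultimately have "App ?C p \<approx> E" by (rule conv_trans)
  then show ?thesis unfolding Snd_def
    using typing_split[OF A B C typing_var[OF B] _ p] D E(2) by simp
qed

section \<open>Identity types\<close>

lemma typing_path_ind:
  assumes A: "\<Theta> \<bar> \<Gamma> \<turnstile> A : Univ m" and a: "\<Theta> \<bar> \<Gamma> \<turnstile> a : A" and b: "\<Theta> \<bar> \<Gamma> \<turnstile> b : A"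
    and p: "\<Theta> \<bar> \<Gamma> \<turnstile> p : Eq A a b"
    and D: "\<Theta> \<bar> Eq (wk 1 A) (wk 1 a) (Var 0) # A # \<Gamma> \<turnstile> D : Univ n"
    and d: "\<Theta> \<bar> \<Gamma> \<turnstile> d : inst (sub (up_sub (case_nat a Var)) D) Refl"
    and E: "inst (sub (up_sub (case_nat b Var)) D) p = E" "is_type \<Theta> \<Gamma> E"
  shows "\<Theta> \<bar> \<Gamma> \<turnstile> J d p : E"
proof -
  \<comment> \<open>The motive is given as an open term \<open>D\<close> in two variables. Its
    double abstraction applied to an endpoint and a path reduces to the two nested instantiations
    that occur in the statement.\<close>
  have beta2: "App (App (Lam (Lam D)) x) y \<approx> inst (sub (up_sub (case_nat x Var)) D) y" for x y
    by (rule conv_trans[OF c_app[OF beta conv_refl]]) (simp add: beta_eq)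
  let ?P = "Eq (wk 1 A) (wk 1 a) (Var 0)"
  let ?C = "Lam (Lam D)"
  have tA: "is_type \<Theta> \<Gamma> A" using A by (rule is_typeI)
  have P: "is_type \<Theta> (A # \<Gamma>) ?P"
    using typing_weaken[OF A tA] typing_weaken[OF a tA] typing_var[OF tA]
    by (intro is_typeI[OF typing.eq]) simp_all
  have U: "is_type \<Theta> (A # \<Gamma>) (Univ n)"
    using typing_univ[OF typing_var[OF tA]] by (rule is_typeI)
  have C: "\<Theta> \<bar> \<Gamma> \<turnstile> ?C : Pi A (?P \<rightharpoonup> Univ n)"
    using P U D by (intro typing_lam typing_lam_arr tA is_type_arr) simp_all
  have "\<Theta> \<bar> \<Gamma> \<turnstile> App ?C a : Eq A a a \<rightharpoonup> Univ n"
    using typing.app[OF C a] by simp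
  then have "is_type \<Theta> \<Gamma> (App (App ?C a) Refl)"
    using typing_app_arr typing.refl[OF A a] is_typeI by blast
  then have "\<Theta> \<bar> \<Gamma> \<turnstile> d : App (App ?C a) Refl"
    using typing_conv[OF d] beta2 conv_sym by blast
  from typing.path_ind[OF C this a b p] show ?thesis
    using typing_conv beta2 E by blast
qed

text \<open>Path induction with a motive that ignores the path; this is why \<open>B\<close> is
  weakened once more.\<close>

lemma inhabited_transport:
  assumes A: "\<Theta> \<bar> \<Gamma> \<turnstile> A : Univ m" and a: "\<Theta> \<bar> \<Gamma> \<turnstile> a : A" and b: "\<Theta> \<bar> \<Gamma> \<turnstile> b : A"
    and p: "inhabited \<Theta> \<Gamma> (Eq A a b)"
    and B: "\<Theta> \<bar> A # \<Gamma> \<turnstile> B : Univ n" and d: "inhabited \<Theta> \<Gamma> (inst B a)"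
    and E: "inst B b = E" "is_type \<Theta> \<Gamma> E"
  shows "inhabited \<Theta> \<Gamma> E"
proof -
  obtain q t where q: "\<Theta> \<bar> \<Gamma> \<turnstile> q : Eq A a b" and t: "\<Theta> \<bar> \<Gamma> \<turnstile> t : inst B a"
    using p d by (auto simp: inhabited_def)
  have tA: "is_type \<Theta> \<Gamma> A" using A by (rule is_typeI)
  have P: "is_type \<Theta> (A # \<Gamma>) (Eq (wk 1 A) (wk 1 a) (Var 0))"
    using typing_weaken[OF A tA] typing_weaken[OF a tA] typing_var[OF tA]
    by (intro is_typeI[OF typing.eq]) simp_all
  have "\<Theta> \<bar> \<Gamma> \<turnstile> J t q : E"
    using typing_path_ind[OF A a b q, of "wk 1 B" n t E] typing_weaken[OF B P] t E by simp
  then show ?thesis by (rule inhabitedI)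
qed

text \<open>Reflexivity at \<open>a\<close> is transported in the family of identities whose left
  endpoint varies and whose right endpoint is \<open>a\<close>.\<close>

lemma inhabited_sym:
  assumes A: "\<Theta> \<bar> \<Gamma> \<turnstile> A : Univ m" and a: "\<Theta> \<bar> \<Gamma> \<turnstile> a : A" and b: "\<Theta> \<bar> \<Gamma> \<turnstile> b : A"
    and p: "inhabited \<Theta> \<Gamma> (Eq A a b)"
  shows "inhabited \<Theta> \<Gamma> (Eq A b a)"
proof -
  have tA: "is_type \<Theta> \<Gamma> A" using A by (rule is_typeI)
  have "\<Theta> \<bar> A # \<Gamma> \<turnstile> Eq (wk 1 A) (Var 0) (wk 1 a) : Univ m"
    using typing_weaken[OF A tA] typing_weaken[OF a tA] typing_var[OF tA]
    by (intro typing.eq) simp_all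
  from inhabited_transport[OF A a b p this] show ?thesis
    using inhabitedI[OF typing.refl[OF A a]] is_typeI[OF typing.eq[OF A b a]] by simp
qed

section \<open>The unit type as a proposition\<close>

lemma typing_one_ind:
  assumes p: "\<Theta> \<bar> \<Gamma> \<turnstile> p : One m" and B: "\<Theta> \<bar> One m # \<Gamma> \<turnstile> B : Univ n"
    and d: "\<Theta> \<bar> \<Gamma> \<turnstile> d : D" and D: "inst B Star \<approx> D" and E: "inst B p = E" "is_type \<Theta> \<Gamma> E"
  shows "\<Theta> \<bar> \<Gamma> \<turnstile> OneRec d p : E"
proof -
  have one: "is_type \<Theta> \<Gamma> (One m)" and U: "is_type \<Theta> \<Gamma> (Univ n)"
    using p typing_one typing_univ is_typeI by blast+
  have C: "\<Theta> \<bar> \<Gamma> \<turnstile> Lam B : One m \<rightharpoonup> Univ n" using one U B by (simp add: typing_lam_arr)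
  have "is_type \<Theta> \<Gamma> (App (Lam B) Star)"
    using typing_app_arr[OF C] typing_star[OF p] is_typeI by blast
  then have "\<Theta> \<bar> \<Gamma> \<turnstile> d : App (Lam B) Star"
    using typing_conv[OF d] D conv.beta conv_sym conv_trans by metis
  from typing.one_ind[OF C this p] show ?thesis
    using typing_conv beta_eq E by blast
qed

lemma typing_is_prop:
  assumes A: "\<Theta> \<bar> \<Gamma> \<turnstile> A : Univ n"
  shows "\<Theta> \<bar> \<Gamma> \<turnstile> is_prop A : Univ n"
proof -
  have A1: "\<Theta> \<bar> A # \<Gamma> \<turnstile> wk 1 A : Univ n" using typing_weaken[OF A] A by (simp add: is_typeI)
  have A2: "\<Theta> \<bar> wk 1 A # A # \<Gamma> \<turnstile> wk 2 A : Univ n" using typing_weaken[OF A1] A1 by (simp add: is_typeI)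
  have "\<Theta> \<bar> wk 1 A # A # \<Gamma> \<turnstile> Eq (wk 2 A) (Var 1) (Var 0) : Univ n"
    using typing_weaken[OF typing_var is_typeI[OF A1]] typing_var[OF is_typeI[OF A1]] A A2
    by (intro typing.eq) (simp_all add: is_typeI)
  from typing.pi[OF A typing.pi[OF A1 this]] show ?thesis by (simp add: is_prop_def)
qed

lemma typing_Omega:
  assumes "\<Theta> \<bar> \<Gamma> \<turnstile> t : A"
  shows "\<Theta> \<bar> \<Gamma> \<turnstile> Omega n : Univ (Suc n)"
proof -
  have U: "\<Theta> \<bar> \<Gamma> \<turnstile> Univ n : Univ (Suc n)" using assms by (rule typing_univ)
  have "\<Theta> \<bar> Univ n # \<Gamma> \<turnstile> is_prop (Var 0) : Univ n"
    using typing_is_prop typing_var[OF is_typeI[OF U]] by simp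
  from typing.sg[OF U this] show ?thesis by (simp add: Omega_def)
qed

text \<open>Both arguments are eliminated, so that this proof reduces to \<open>Refl\<close> at
  \<open>Star\<close> and \<open>Star\<close>; \<open>one_is_set\<close> rests on that computation.
  The term is closed, hence unaffected by weakening and substitution.\<close>

definition one_prop :: tm where
  "one_prop = Lam (Lam (OneRec (OneRec Refl (Var 0)) (Var 1)))"

lemma one_prop_closed [simp]: "ren r one_prop = one_prop" "wk k one_prop = one_prop" "sub s one_prop = one_prop"
  by (simp_all add: one_prop_def)

lemma typing_one_prop:
  assumes "\<Theta> \<bar> \<Gamma> \<turnstile> t : A"
  shows "\<Theta> \<bar> \<Gamma> \<turnstile> one_prop : is_prop (One n)"
proof -
  let ?\<Delta> = "One n # One n # \<Gamma>"
  have o: "is_type \<Theta> \<Gamma> (One n)" using assms typing_one is_typeI by blast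
  have o1: "is_type \<Theta> (One n # \<Gamma>) (One n)" using is_type_weaken[OF o o] by simp
  have v0: "\<Theta> \<bar> ?\<Delta> \<turnstile> Var 0 : One n" using typing_var[OF o1] by simp
  have v1: "\<Theta> \<bar> ?\<Delta> \<turnstile> Var 1 : One n" using typing_weaken[OF typing_var[OF o] o1] by simp
  note O = typing_one[OF v0, of n]
  have o2: "is_type \<Theta> ?\<Delta> (One n)" using O by (rule is_typeI)
  have w0: "\<Theta> \<bar> One n # ?\<Delta> \<turnstile> Var 0 : One n" using typing_var[OF o2] by simp
  have w1: "\<Theta> \<bar> One n # ?\<Delta> \<turnstile> Var 1 : One n" using typing_weaken[OF v0 o2] by simp
  have s: "\<Theta> \<bar> ?\<Delta> \<turnstile> Star : One n" using v0 by (rule typing_star)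
  have s': "\<Theta> \<bar> One n # ?\<Delta> \<turnstile> Star : One n" using w0 by (rule typing_star)
  note O' = typing_one[OF w0, of n]
  have "\<Theta> \<bar> ?\<Delta> \<turnstile> OneRec Refl (Var 0) : Eq (One n) Star (Var 0)"
    by (rule typing_one_ind[OF v0 typing.eq[OF O' s' w0] typing.refl[OF O s]])
      (use typing.eq[OF O s v0] in \<open>simp_all add: conv_refl is_typeI\<close>)
  then have "\<Theta> \<bar> ?\<Delta> \<turnstile> OneRec (OneRec Refl (Var 0)) (Var 1) : Eq (One n) (Var 1) (Var 0)"
    by (rule typing_one_ind[OF v1 typing.eq[OF O' w0 w1]])
      (use typing.eq[OF O v1 v0] in \<open>simp_all add: conv_refl is_typeI\<close>)
  then show ?thesis unfolding one_prop_def is_prop_def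
    using typing.eq[OF O v1 v0] o o1 by (auto intro!: typing_lam is_type_pi intro: is_typeI)
qed

lemma typing_app_is_prop:
  assumes h: "\<Theta> \<bar> \<Gamma> \<turnstile> h : is_prop A" and x: "\<Theta> \<bar> \<Gamma> \<turnstile> x : A" and y: "\<Theta> \<bar> \<Gamma> \<turnstile> y : A"
  shows "\<Theta> \<bar> \<Gamma> \<turnstile> App (App h x) y : Eq A x y"
proof -
  have "\<Theta> \<bar> \<Gamma> \<turnstile> App h x : Pi A (Eq (wk 1 A) (wk 1 x) (Var 0))"
    using typing.app[OF h[unfolded is_prop_def] x] by simp
  from typing.app[OF this y] show ?thesis by simp
qed

text \<open>
  A proof that \<open>One\<close> is a proposition has to be unique so that propositional extensionality lifts
  to an identity in \<open>Omega\<close>.  The general fact that \<open>is_prop\<close> is a proposition is avoided: path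
  induction first identifies an inhabited proposition with \<open>One\<close>.
\<close>

lemma one_is_set:
  assumes x: "\<Theta> \<bar> \<Gamma> \<turnstile> x : One n" and y: "\<Theta> \<bar> \<Gamma> \<turnstile> y : One n" and p: "\<Theta> \<bar> \<Gamma> \<turnstile> p : Eq (One n) x y"
  shows "inhabited \<Theta> \<Gamma> (Eq (Eq (One n) x y) p (App (App one_prop x) y))"
proof -
  have goal: "\<Theta> \<bar> \<Delta> \<turnstile> Eq (Eq (One n) a b) q (App (App one_prop a) b) : Univ n"
    if "\<Theta> \<bar> \<Delta> \<turnstile> a : One n" "\<Theta> \<bar> \<Delta> \<turnstile> b : One n" "\<Theta> \<bar> \<Delta> \<turnstile> q : Eq (One n) a b" for \<Delta> a b q
    using that by (intro typing.eq typing_app_is_prop typing_one_prop typing_one)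
  have o: "is_type \<Theta> \<Gamma> (One n)" using x typing_one is_typeI by blast
  have v: "\<Theta> \<bar> One n # \<Gamma> \<turnstile> Var 0 : One n" using typing_var[OF o] by simp
  have s: "\<Theta> \<bar> \<Gamma> \<turnstile> Star : One n" using x by (rule typing_star)
  have rf: "\<Theta> \<bar> \<Delta> \<turnstile> Refl : Eq (One n) a a" if "\<Theta> \<bar> \<Delta> \<turnstile> a : One n" for \<Delta> a
    using that by (blast intro: typing.refl typing_one)
  have "App (App one_prop Star) Star \<approx> App (Lam (OneRec (OneRec Refl (Var 0)) Star)) Star"
    unfolding one_prop_def by (intro c_app conv_refl beta_eq) simp
  moreover have "\<dots> \<approx> OneRec (OneRec Refl Star) Star" by (rule beta_eq) simp
  moreover have "\<dots> \<approx> Refl" by (rule conv_trans[OF one_star one_star])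
  ultimately have "App (App one_prop Star) Star \<approx> Refl" using conv_trans by blast
  then have e: "Eq (Eq (One n) Star Star) Refl (App (App one_prop Star) Star) \<approx>
      Eq (Eq (One n) Star Star) Refl Refl"
    by (intro c_eq conv_refl)
  \<comment> \<open>The base case of the path induction, by induction on \<open>x\<close>: at
    \<open>Star\<close> the chosen proof computes to \<open>Refl\<close>, so reflexivity has the
    required type up to conversion.\<close>
  have d: "\<Theta> \<bar> \<Gamma> \<turnstile> OneRec Refl x : Eq (Eq (One n) x x) Refl (App (App one_prop x) x)"
    by (rule typing_one_ind[OF x goal[OF v v rf[OF v]] typing.refl[OF typing.eq[OF typing_one[OF s] s s] rf[OF s]]])
      (use e goal[OF x x rf[OF x]] in \<open>simp_all add: is_typeI\<close>)
  let ?P = "Eq (One n) (wk 1 x) (Var 0)"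
  have x1: "\<Theta> \<bar> One n # \<Gamma> \<turnstile> wk 1 x : One n" using typing_weaken[OF x o] by simp
  have P: "is_type \<Theta> (One n # \<Gamma>) ?P" using typing.eq[OF typing_one[OF v] x1 v] by (rule is_typeI)
  \<comment> \<open>The endpoint \<open>y\<close> and the path \<open>p\<close> become the variables
    1 and 0. Path induction then contracts them to \<open>x\<close> and \<open>Refl\<close>, which
    is the case \<open>d\<close>.\<close>
  let ?D = "Eq (Eq (One n) (wk 2 x) (Var 1)) (Var 0) (App (App one_prop (wk 2 x)) (Var 1))"
  have D: "\<Theta> \<bar> ?P # One n # \<Gamma> \<turnstile> ?D : Univ n"
    using typing_weaken[OF x1 P] typing_weaken[OF v P] typing_var[OF P] by (intro goal) simp_all
  have "\<Theta> \<bar> \<Gamma> \<turnstile> J (OneRec Refl x) p : Eq (Eq (One n) x y) p (App (App one_prop x) y)"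
    by (rule typing_path_ind[OF typing_one[OF x] x y p, where D = ?D])
      (use D d goal[OF x y p] in \<open>simp_all add: is_typeI\<close>)
  then show ?thesis by (rule inhabitedI)
qed

text \<open>The values of \<open>h\<close> are paths in \<open>One n\<close>, and
  \<open>one_is_set\<close> identifies each of them with the corresponding value of
  \<open>one_prop\<close>. Function extensionality is applied once for each of the two
  arguments.\<close>

lemma is_prop_one_unique:
  assumes h: "\<Theta> \<bar> \<Gamma> \<turnstile> h : is_prop (One n)"
  shows "inhabited \<Theta> \<Gamma> (Eq (is_prop (One n)) h one_prop)"
proof -
  have o: "is_type \<Theta> \<Gamma> (One n)" using h typing_one is_typeI by blast
  have v: "\<Theta> \<bar> One n # \<Gamma> \<turnstile> Var 0 : One n" using typing_var[OF o] by simp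
  have o1: "is_type \<Theta> (One n # \<Gamma>) (One n)" using is_type_weaken[OF o o] by simp
  let ?\<Delta> = "One n # One n # \<Gamma>"
  have w0: "\<Theta> \<bar> ?\<Delta> \<turnstile> Var 0 : One n" using typing_var[OF o1] by simp
  have w1: "\<Theta> \<bar> ?\<Delta> \<turnstile> Var (Suc 0) : One n" using typing_weaken[OF v o1] by simp
  have h1: "\<Theta> \<bar> One n # \<Gamma> \<turnstile> wk 1 h : is_prop (One n)" using typing_weaken[OF h o] by simp
  have h2: "\<Theta> \<bar> ?\<Delta> \<turnstile> wk 2 h : is_prop (One n)" using typing_weaken[OF h1 o1] by simp
  have E: "\<Theta> \<bar> ?\<Delta> \<turnstile> Eq (One n) (Var (Suc 0)) (Var 0) : Univ n"
    using typing.eq[OF typing_one[OF w0] w1 w0] .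
  let ?B = "Eq (One n) (Var (Suc 0)) (Var 0)"
  have P: "\<Theta> \<bar> One n # \<Gamma> \<turnstile> Pi (One n) ?B : Univ n"
    using typing.pi[OF typing_one[OF v] E] by simp
  obtain t where "\<Theta> \<bar> ?\<Delta> \<turnstile> t : Eq ?B (App (App (wk 2 h) (Var (Suc 0))) (Var 0)) (App (App one_prop (Var (Suc 0))) (Var 0))"
    using one_is_set[OF w1 w0 typing_app_is_prop[OF h2 w1 w0]] by (auto simp: inhabited_def)
  moreover have "is_type \<Theta> ?\<Delta> (Eq ?B (App (App (wk 2 h) (Var (Suc 0))) (Var 0)) (App (App one_prop (Var (Suc 0))) (Var 0)))"
    using E typing_app_is_prop[OF h2 w1 w0] typing_app_is_prop[OF typing_one_prop[OF w0] w1 w0]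
    by (intro is_typeI[OF typing.eq])
  ultimately have t: "\<Theta> \<bar> One n # \<Gamma> \<turnstile> Lam t : Pi (One n) (Eq ?B (App (wk 1 (App (wk 1 h) (Var 0))) (Var 0))
      (App (wk 1 (App one_prop (Var 0))) (Var 0)))"
    using o1 by (intro typing_lam) simp_all
  have a: "\<Theta> \<bar> One n # \<Gamma> \<turnstile> App g (Var 0) : Pi (One n) ?B"
    if "\<Theta> \<bar> One n # \<Gamma> \<turnstile> g : is_prop (One n)" for g
    using typing.app[OF that[unfolded is_prop_def] v] by simp
  note f = typing.funext[OF P a[OF h1] a[OF typing_one_prop[OF v]] t]
  have "is_type \<Theta> (One n # \<Gamma>) (Eq (Pi (One n) ?B) (App (wk 1 h) (Var 0)) (App (wk 1 one_prop) (Var 0)))"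
    using typing.eq[OF P a[OF h1] a[OF typing_one_prop[OF v]]] by (simp add: is_typeI)
  then have "\<Theta> \<bar> \<Gamma> \<turnstile> Lam (FunExt (Lam t)) : Pi (One n) (Eq (Pi (One n) ?B) (App (wk 1 h) (Var 0)) (App (wk 1 one_prop) (Var 0)))"
    using o f by (intro typing_lam) simp_all
  note t' = this
  have e: "is_prop (One n) = Pi (One n) (Pi (One n) ?B)" by (simp add: is_prop_def)
  from typing.funext[OF typing_is_prop[OF typing_one[OF h, of n], unfolded e] h[unfolded e]
      typing_one_prop[OF h, of n, unfolded e] t']
  show ?thesis unfolding e by (rule inhabitedI)
qed

section \<open>Truth values, propositional extensionality and resizing\<close>

definition truth :: "nat \<Rightarrow> tm" where
  "truth n = Pr (One n) one_prop"

lemma truth_closed [simp]: "ren r (truth n) = truth n" "wk k (truth n) = truth n" "sub s (truth n) = truth n"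
  by (simp_all add: truth_def)

lemma typing_pr_Omega:
  assumes A: "\<Theta> \<bar> \<Gamma> \<turnstile> A : Univ n" and h: "\<Theta> \<bar> \<Gamma> \<turnstile> h : is_prop A"
  shows "\<Theta> \<bar> \<Gamma> \<turnstile> Pr A h : Omega n"
proof -
  have U: "is_type \<Theta> \<Gamma> (Univ n)" using typing_univ[OF A] by (rule is_typeI)
  have "is_type \<Theta> (Univ n # \<Gamma>) (is_prop (Var 0))"
    using typing_is_prop typing_var[OF U] is_typeI by fastforce
  then show ?thesis unfolding Omega_def using U A h by (intro typing_pr) simp_all
qed

lemma typing_truth: "\<Theta> \<bar> \<Gamma> \<turnstile> t : A \<Longrightarrow> \<Theta> \<bar> \<Gamma> \<turnstile> truth n : Omega n"
  unfolding truth_def by (intro typing_pr_Omega typing_one typing_one_prop)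

lemma typing_weaken2:
  assumes "\<Theta> \<bar> \<Gamma> \<turnstile> t : C" "is_type \<Theta> \<Gamma> A" "is_type \<Theta> (A # \<Gamma>) B"
  shows "\<Theta> \<bar> B # A # \<Gamma> \<turnstile> wk (Suc (Suc 0)) t : wk (Suc (Suc 0)) C"
  using typing_weaken[OF typing_weaken[OF assms(1,2)] assms(3)] by simp

lemma inhabited_weaken2:
  assumes "inhabited \<Theta> \<Gamma> C" "is_type \<Theta> \<Gamma> A" "is_type \<Theta> (A # \<Gamma>) B"
  shows "inhabited \<Theta> (B # A # \<Gamma>) (wk (Suc (Suc 0)) C)"
  using inhabited_weaken[OF inhabited_weaken[OF assms(1,2)] assms(3)] by simp

lemma typing_var1:
  assumes "is_type \<Theta> \<Gamma> A" "is_type \<Theta> (A # \<Gamma>) B"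
  shows "\<Theta> \<bar> B # A # \<Gamma> \<turnstile> Var (Suc 0) : wk (Suc (Suc 0)) A"
  using typing_weaken[OF typing_var[OF assms(1)] assms(2)] by simp

lemma c_arr: "A \<approx> B \<Longrightarrow> A \<rightharpoonup> C \<approx> B \<rightharpoonup> C"
  unfolding arr_def by (intro c_pi conv_refl)

lemma is_type_Omega: "\<Theta> \<bar> \<Gamma> \<turnstile> t : A \<Longrightarrow> is_type \<Theta> \<Gamma> (Omega n)"
  using typing_Omega is_typeI by blast

lemma is_type_Omega_fam: "is_type \<Theta> \<Gamma> (Univ n) \<Longrightarrow> is_type \<Theta> (Univ n # \<Gamma>) (is_prop (Var 0))"
  using typing_is_prop typing_var is_typeI by fastforce

lemma typing_fst_Omega:
  assumes "\<Theta> \<bar> \<Gamma> \<turnstile> P : Omega n"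
  shows "\<Theta> \<bar> \<Gamma> \<turnstile> Fst P : Univ n"
proof -
  have U: "is_type \<Theta> \<Gamma> (Univ n)" using typing_univ[OF assms] by (rule is_typeI)
  from typing_fst[OF assms[unfolded Omega_def] U is_type_Omega_fam[OF U]] show ?thesis .
qed

lemma typing_snd_Omega:
  assumes P: "\<Theta> \<bar> \<Gamma> \<turnstile> P : Omega n"
  shows "\<Theta> \<bar> \<Gamma> \<turnstile> Snd P : is_prop (Fst P)"
proof -
  have U: "is_type \<Theta> \<Gamma> (Univ n)" using typing_univ[OF P] by (rule is_typeI)
  show ?thesis
    using typing_snd[OF P[unfolded Omega_def] U is_type_Omega_fam[OF U]]
      typing_is_prop[OF typing_fst_Omega[OF P]] is_typeI by simp
qed

text \<open>The family of claims indexed by the proof component holds by reflexivity at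
  \<open>one_prop\<close>; it is transported to \<open>h\<close> along the inverse of the path from
  \<open>is_prop_one_unique\<close>.\<close>

lemma pr_one_eq_truth:
  assumes h: "\<Theta> \<bar> \<Gamma> \<turnstile> h : is_prop (One n)"
  shows "inhabited \<Theta> \<Gamma> (Eq (Omega n) (Pr (One n) h) (truth n))"
proof -
  note P = typing_is_prop[OF typing_one[OF h, of n]]
  have v: "\<Theta> \<bar> is_prop (One n) # \<Gamma> \<turnstile> Var 0 : is_prop (One n)"
    using typing_var[OF is_typeI[OF P]] by simp
  note E = typing.eq[OF typing_Omega typing_pr_Omega[OF typing_one] typing_truth]
  note T = E[OF v v v v] and T' = E[OF h h h h]
  show ?thesis
    by (rule inhabited_transport[OF P typing_one_prop[OF h] h
          inhabited_sym[OF P h typing_one_prop[OF h] is_prop_one_unique[OF h]] T])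
      (use typing.refl[OF typing_Omega[OF h] typing_truth[OF h]] T' in
        \<open>auto simp: truth_def[symmetric] intro: inhabitedI is_typeI\<close>)
qed

text \<open>Propositional extensionality identifies \<open>One n\<close> with \<open>A\<close>, but
  the type of \<open>h\<close> depends on \<open>A\<close>. The transported family therefore
  quantifies over all proofs of \<open>is_prop\<close>; its value at \<open>One n\<close> comes from
  \<open>pr_one_eq_truth\<close>, and its value at \<open>A\<close> is specialised to
  \<open>h\<close>.\<close>

lemma pr_eq_truth:
  assumes A: "\<Theta> \<bar> \<Gamma> \<turnstile> A : Univ n" and h: "\<Theta> \<bar> \<Gamma> \<turnstile> h : is_prop A" and a: "inhabited \<Theta> \<Gamma> A"
  shows "inhabited \<Theta> \<Gamma> (Eq (Omega n) (Pr A h) (truth n))"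
proof -
  obtain a where a: "\<Theta> \<bar> \<Gamma> \<turnstile> a : A" using a by (auto simp: inhabited_def)
  have tA: "is_type \<Theta> \<Gamma> A" using A by (rule is_typeI)
  note O = typing_one[OF A, of n] and U = typing_univ[OF A, of n]
  have tO: "is_type \<Theta> \<Gamma> (One n)" and tU: "is_type \<Theta> \<Gamma> (Univ n)" using O U is_typeI by blast+
  have u: "\<Theta> \<bar> \<Gamma> \<turnstile> Lam (wk (Suc 0) a) : One n \<rightharpoonup> A"
    using typing_weaken[OF a tO] by (intro typing_lam_arr tA tO)
  have v: "\<Theta> \<bar> \<Gamma> \<turnstile> Lam Star : A \<rightharpoonup> One n"
    using typing_star[OF typing_var[OF tA]] by (intro typing_lam_arr tA tO) simp
  have e: "inhabited \<Theta> \<Gamma> (Eq (Univ n) (One n) A)"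
    using typing.propext[OF O A typing_one_prop[OF A] h u v] by (rule inhabitedI)
  have goal: "\<Theta> \<bar> \<Delta> \<turnstile> Pi (is_prop B) (Eq (Omega n) (Pr (wk 1 B) (Var 0)) (truth n)) : Univ (Suc n)"
    if B: "\<Theta> \<bar> \<Delta> \<turnstile> B : Univ n" for \<Delta> B
  proof -
    have i: "is_type \<Theta> \<Delta> (is_prop B)" using typing_is_prop[OF B] by (rule is_typeI)
    have "\<Theta> \<bar> is_prop B # \<Delta> \<turnstile> Eq (Omega n) (Pr (wk 1 B) (Var 0)) (truth n) : Univ (Suc n)"
      using typing_weaken[OF B i] typing_var[OF i]
      by (intro typing.eq typing_pr_Omega) (auto intro: typing_Omega typing_truth)
    from typing.pi[OF typing_is_prop[OF B] this] show ?thesis by simp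
  qed
  have "inhabited \<Theta> (is_prop (One n) # \<Gamma>) (Eq (Omega n) (Pr (One n) (Var 0)) (truth n))"
    using pr_one_eq_truth typing_var[OF is_typeI[OF typing_is_prop[OF O]]] by simp
  moreover from this have "is_type \<Theta> (is_prop (One n) # \<Gamma>) (Eq (Omega n) (Pr (One n) (Var 0)) (truth n))"
    using typing_var[OF is_typeI[OF typing_is_prop[OF O]]]
    by (auto intro!: is_typeI[OF typing.eq] typing_pr_Omega intro: typing_Omega typing_truth typing_one)
  ultimately have base: "inhabited \<Theta> \<Gamma> (Pi (is_prop (One n)) (Eq (Omega n) (Pr (One n) (Var 0)) (truth n)))"
    using typing_is_prop[OF O] by (auto intro: inhabited_pi is_typeI)
  have "inhabited \<Theta> \<Gamma> (Pi (is_prop A) (Eq (Omega n) (Pr (wk 1 A) (Var 0)) (truth n)))"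
    by (rule inhabited_transport[OF U O A e goal[OF typing_var[OF tU, simplified]]])
      (use base is_typeI[OF goal[OF A]] in simp_all)
  from inhabited_spec[OF this h] show ?thesis by simp
qed

text \<open>Pairs have no uniqueness rule in \<open>conv\<close>, so \<open>P\<close> need not be
  convertible to a pair and has to be eliminated. The motive contains the premise
  \<open>Fst Q\<close>, so that inhabitation of \<open>P\<close> turns into inhabitation of the
  generic first component, as \<open>pr_eq_truth\<close> requires.\<close>

lemma eq_truth:
  assumes P: "\<Theta> \<bar> \<Gamma> \<turnstile> P : Omega n" and p: "inhabited \<Theta> \<Gamma> (Fst P)"
  shows "inhabited \<Theta> \<Gamma> (Eq (Omega n) P (truth n))"
proof -
  let ?\<Delta> = "is_prop (Var 0) # Univ n # \<Gamma>"
  let ?C = "Lam (Fst (Var 0) \<rightharpoonup> Eq (Omega n) (Var 0) (truth n))"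
  let ?D = "Var (Suc 0) \<rightharpoonup> Eq (Omega n) (Pr (Var (Suc 0)) (Var 0)) (truth n)"
  have goal: "\<Theta> \<bar> \<Delta> \<turnstile> Fst Q \<rightharpoonup> Eq (Omega n) Q (truth n) : Univ (Suc n)"
    if "\<Theta> \<bar> \<Delta> \<turnstile> Q : Omega n" for \<Delta> Q
    using typing_arr[OF typing_fst_Omega[OF that] typing.eq[OF typing_Omega[OF that] that typing_truth[OF that]]] by simp
  have U: "is_type \<Theta> \<Gamma> (Univ n)" using typing_univ[OF P] by (rule is_typeI)
  note U1 = is_type_Omega_fam[OF U]
  have U': "is_type \<Theta> \<Gamma> (Univ (Suc n))" using typing_univ[OF P] by (rule is_typeI)
  have A: "\<Theta> \<bar> ?\<Delta> \<turnstile> Var (Suc 0) : Univ n" using typing_var1[OF U U1] by simp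
  have h: "\<Theta> \<bar> ?\<Delta> \<turnstile> Var 0 : is_prop (Var (Suc 0))" using typing_var[OF U1] by simp
  note tA = is_typeI[OF A]
  have A': "\<Theta> \<bar> Var (Suc 0) # ?\<Delta> \<turnstile> Var (Suc (Suc 0)) : Univ n" using typing_weaken[OF A tA] by simp
  have h': "\<Theta> \<bar> Var (Suc 0) # ?\<Delta> \<turnstile> Var (Suc 0) : is_prop (Var (Suc (Suc 0)))" using typing_weaken[OF h tA] by simp
  have "inhabited \<Theta> (Var (Suc 0) # ?\<Delta>) (Eq (Omega n) (Pr (Var (Suc (Suc 0))) (Var (Suc 0))) (truth n))"
    using typing_var[OF tA] by (intro pr_eq_truth A' h') (auto intro: inhabitedI)
  moreover have "is_type \<Theta> ?\<Delta> (Eq (Omega n) (Pr (Var (Suc 0)) (Var 0)) (truth n))"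
    using typing.eq[OF typing_Omega[OF A] typing_pr_Omega[OF A h] typing_truth[OF A]] by (rule is_typeI)
  ultimately have "inhabited \<Theta> ?\<Delta> ?D"
    using tA by (intro inhabited_arr) simp_all
  then obtain d where d: "\<Theta> \<bar> ?\<Delta> \<turnstile> d : ?D" by (auto simp: inhabited_def)
  have Om: "is_type \<Theta> \<Gamma> (Omega n)" using P by (rule is_type_Omega)
  have C: "\<Theta> \<bar> \<Gamma> \<turnstile> ?C : Sg (Univ n) (is_prop (Var 0)) \<rightharpoonup> Univ (Suc n)"
    unfolding Omega_def[of n, symmetric] using goal[OF typing_var[OF Om, simplified]] by (intro typing_lam_arr Om U') simp
  have "App (wk 2 ?C) (Pr (Var 1) (Var 0)) \<approx>
      Fst (Pr (Var 1) (Var 0)) \<rightharpoonup> Eq (Omega n) (Pr (Var 1) (Var 0)) (truth n)"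
    by (simp add: beta_eq)
  moreover have "\<dots> \<approx> ?D" using c_arr[OF conv_fst] by simp
  ultimately have D: "?D \<approx> App (wk 2 ?C) (Pr (Var 1) (Var 0))"
    using conv_sym conv_trans by blast
  have "\<Theta> \<bar> \<Gamma> \<turnstile> Split (Lam (Lam d)) P : Fst P \<rightharpoonup> Eq (Omega n) P (truth n)"
    by (rule typing_split[OF U U1 C d D])
      (use P goal[OF P] in \<open>auto simp: Omega_def[symmetric] intro: beta_eq is_typeI\<close>)
  then show ?thesis using p inhabitedI inhabited_app by blast
qed

lemma inhabited_fst_truth:
  assumes "\<Theta> \<bar> \<Gamma> \<turnstile> t : A"
  shows "inhabited \<Theta> \<Gamma> (Fst (truth n))"
proof -
  have "Fst (truth n) \<approx> One n" unfolding truth_def by (rule conv_fst)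
  then show ?thesis
    using typing_conv[OF typing_star[OF assms] conv_sym] typing_fst_Omega[OF typing_truth[OF assms]]
    by (blast intro: is_typeI inhabitedI)
qed

text \<open>Since \<open>f\<close> undoes \<open>g\<close>, comparison with \<open>truth n\<close>
  can be carried out among codes in \<open>Y\<close>. The gain is the universe: the type of the
  comparison lies in \<open>Univ k\<close>, independently of \<open>n\<close>.\<close>

lemma inhabited_resize_iff:
  assumes Y: "\<Theta> \<bar> \<Gamma> \<turnstile> Y : Univ k" and f: "\<Theta> \<bar> \<Gamma> \<turnstile> f : Y \<rightharpoonup> Omega n" and g: "\<Theta> \<bar> \<Gamma> \<turnstile> g : Omega n \<rightharpoonup> Y"
    and sec: "inhabited \<Theta> \<Gamma> (Pi (Omega n) (Eq (Omega n) (App (wk 1 f) (App (wk 1 g) (Var 0))) (Var 0)))"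
    and P: "\<Theta> \<bar> \<Gamma> \<turnstile> P : Omega n"
  shows "inhabited \<Theta> \<Gamma> (Fst P) \<longleftrightarrow> inhabited \<Theta> \<Gamma> (Eq Y (App g P) (App g (truth n)))"
proof
  note T = typing_truth[OF P, of n] and Om = typing_Omega[OF P, of n]
  note tOm = is_typeI[OF Om] and tY = is_typeI[OF Y]
  have gP: "\<Theta> \<bar> \<Gamma> \<turnstile> App g P : Y" and gT: "\<Theta> \<bar> \<Gamma> \<turnstile> App g (truth n) : Y"
    using g P T typing_app_arr by blast+
  have fgP: "\<Theta> \<bar> \<Gamma> \<turnstile> App f (App g P) : Omega n" and fgT: "\<Theta> \<bar> \<Gamma> \<turnstile> App f (App g (truth n)) : Omega n"
    using f gP gT typing_app_arr by blast+
  have sec': "inhabited \<Theta> \<Gamma> (Eq (Omega n) (App f (App g Q)) Q)" if "\<Theta> \<bar> \<Gamma> \<turnstile> Q : Omega n" for Q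
    using inhabited_spec[OF sec that] by simp
  have F: "\<Theta> \<bar> Omega n # \<Gamma> \<turnstile> Fst (Var 0) : Univ n"
    using typing_fst_Omega typing_var[OF tOm] by simp
  {
    assume "inhabited \<Theta> \<Gamma> (Fst P)"
    then have e: "inhabited \<Theta> \<Gamma> (Eq (Omega n) P (truth n))" using P eq_truth by blast
    have g': "\<Theta> \<bar> Omega n # \<Gamma> \<turnstile> wk 1 g : Omega n \<rightharpoonup> wk 1 Y" using typing_weaken[OF g tOm] by simp
    have "\<Theta> \<bar> Omega n # \<Gamma> \<turnstile> Eq (wk 1 Y) (wk 1 (App g P)) (App (wk 1 g) (Var 0)) : Univ k"
      using typing_weaken[OF Y tOm] typing_weaken[OF gP tOm] typing_app_arr[OF g'] typing_var[OF tOm]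
      by (intro typing.eq) simp_all
    then show "inhabited \<Theta> \<Gamma> (Eq Y (App g P) (App g (truth n)))"
      by (rule inhabited_transport[OF Om P T e])
        (use typing.refl[OF Y gP] typing.eq[OF Y gP gT] in \<open>auto intro: inhabitedI is_typeI\<close>)
  next
    assume q: "inhabited \<Theta> \<Gamma> (Eq Y (App g P) (App g (truth n)))"
    \<comment> \<open>The way back carries an inhabitant from \<open>truth\<close> to
      \<open>f (g truth)\<close> by the section identity, to \<open>f (g P)\<close> by the assumed
      equality of codes, and to \<open>P\<close> by the section identity again.\<close>
    have 1: "inhabited \<Theta> \<Gamma> (Fst (App f (App g (truth n))))"
      by (rule inhabited_transport[OF Om T fgT inhabited_sym[OF Om fgT T sec'[OF T]] F])
        (use inhabited_fst_truth[OF P] typing_fst_Omega[OF fgT] in \<open>auto intro: is_typeI\<close>)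
    have f': "\<Theta> \<bar> Y # \<Gamma> \<turnstile> wk 1 f : wk 1 Y \<rightharpoonup> Omega n" using typing_weaken[OF f tY] by simp
    have "\<Theta> \<bar> Y # \<Gamma> \<turnstile> Fst (App (wk 1 f) (Var 0)) : Univ n"
      using typing_fst_Omega[OF typing_app_arr[OF f']] typing_var[OF tY] by simp
    then have 2: "inhabited \<Theta> \<Gamma> (Fst (App f (App g P)))"
      by (rule inhabited_transport[OF Y gT gP inhabited_sym[OF Y gP gT q]])
        (use 1 typing_fst_Omega[OF fgP] in \<open>auto intro: is_typeI\<close>)
    show "inhabited \<Theta> \<Gamma> (Fst P)"
      by (rule inhabited_transport[OF Om fgP P sec'[OF P] F])
        (use 2 typing_fst_Omega[OF P] in \<open>auto intro: is_typeI\<close>)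
  }
qed

lemma typing_mem:
  "\<Theta> \<bar> \<Gamma> \<turnstile> S : X \<rightharpoonup> Omega n \<Longrightarrow> \<Theta> \<bar> \<Gamma> \<turnstile> x : X \<Longrightarrow> \<Theta> \<bar> \<Gamma> \<turnstile> mem x S : Univ n"
  unfolding mem_def by (intro typing_fst_Omega typing_app_arr)

lemma typing_le:
  "\<Theta> \<bar> \<Gamma> \<turnstile> R : X \<rightharpoonup> X \<rightharpoonup> Omega n \<Longrightarrow> \<Theta> \<bar> \<Gamma> \<turnstile> x : X \<Longrightarrow> \<Theta> \<bar> \<Gamma> \<turnstile> y : X \<Longrightarrow>
    \<Theta> \<bar> \<Gamma> \<turnstile> le R x y : Univ n"
  unfolding le_def by (meson typing_fst_Omega typing_app_arr)

lemma inhabited_is_prop_le: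
  "\<Theta> \<bar> \<Gamma> \<turnstile> R : X \<rightharpoonup> X \<rightharpoonup> Omega n \<Longrightarrow> \<Theta> \<bar> \<Gamma> \<turnstile> x : X \<Longrightarrow> \<Theta> \<bar> \<Gamma> \<turnstile> y : X \<Longrightarrow>
    inhabited \<Theta> \<Gamma> (is_prop (le R x y))"
  unfolding le_def by (meson inhabitedI typing_snd_Omega typing_app_arr)


section \<open>Smallness and covers\<close>

text \<open>Weakening a family past its own parameter and then specialising it to that parameter
  cancel. This happens whenever a quantified statement is weakened by its domain and used at the new
  variable.\<close>

lemma sub_ren_up_shift [simp]: "sub (case_nat (Var 0) Var) (ren (up_ren (shift (Suc 0))) t) = t"
proof -
  have "sub (case_nat (Var 0) Var) (ren (up_ren (shift (Suc 0))) t) = sub Var t"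
    unfolding sub_ren by (rule sub_eqI) (simp add: up_ren_def split: nat.split)
  then show ?thesis by simp
qed

lemma inhabited_prdD:
  assumes "inhabited \<Theta> \<Gamma> (A \<otimes> B)" "is_type \<Theta> \<Gamma> A" "is_type \<Theta> \<Gamma> B"
  shows "inhabited \<Theta> \<Gamma> A" "inhabited \<Theta> \<Gamma> B"
proof -
  obtain p where p: "\<Theta> \<bar> \<Gamma> \<turnstile> p : Sg A (wk 1 B)" using assms by (auto simp: inhabited_def prd_def)
  have B: "is_type \<Theta> (A # \<Gamma>) (wk 1 B)" using is_type_weaken assms by simp
  show "inhabited \<Theta> \<Gamma> A" using typing_fst[OF p assms(2) B] by (rule inhabitedI)
  show "inhabited \<Theta> \<Gamma> B" using typing_snd[OF p assms(2) B _ assms(3)] by (auto intro: inhabitedI)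
qed

text \<open>The two projections of an inhabitant supply the witness and its property. That instances
  of \<open>B\<close> are types is a premise, in place of closure of typing under
  substitution.\<close>

lemma inhabited_sgD:
  assumes p: "inhabited \<Theta> \<Gamma> (Sg A B)" and "is_type \<Theta> \<Gamma> A" "is_type \<Theta> (A # \<Gamma>) B"
    and E: "\<And>a. \<Theta> \<bar> \<Gamma> \<turnstile> a : A \<Longrightarrow> is_type \<Theta> \<Gamma> (inst B a)"
  shows "\<exists>a. (\<Theta> \<bar> \<Gamma> \<turnstile> a : A) \<and> inhabited \<Theta> \<Gamma> (inst B a)"
proof -
  obtain p where p: "\<Theta> \<bar> \<Gamma> \<turnstile> p : Sg A B" using p by (auto simp: inhabited_def)
  have a: "\<Theta> \<bar> \<Gamma> \<turnstile> Fst p : A" using typing_fst p assms by blast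
  have "\<Theta> \<bar> \<Gamma> \<turnstile> Snd p : inst B (Fst p)" using typing_snd p assms E[OF a] by blast
  with a show ?thesis by (blast intro: inhabitedI)
qed

text \<open>Reflexivity at \<open>a\<close> acquires this type by converting one endpoint.\<close>

lemma inhabited_eq_conv:
  assumes A: "\<Theta> \<bar> \<Gamma> \<turnstile> A : Univ n" and a: "\<Theta> \<bar> \<Gamma> \<turnstile> a : A" and b: "\<Theta> \<bar> \<Gamma> \<turnstile> b : A" and e: "a \<approx> b"
  shows "inhabited \<Theta> \<Gamma> (Eq A a b)"
  using typing_conv[OF typing.refl[OF A a] c_eq[OF conv_refl conv_refl e]] typing.eq[OF A a b]
  by (blast intro: is_typeI inhabitedI)

section \<open>Equivalences and smallness\<close>

definition section_of :: "tm \<Rightarrow> tm \<Rightarrow> tm \<Rightarrow> tm" where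
  "section_of B f g = Pi B (Eq (wk 1 B) (App (wk 1 f) (App (wk 1 g) (Var 0))) (Var 0))"

lemma section_of_simps [simp]:
  "ren r (section_of B f g) = section_of (ren r B) (ren r f) (ren r g)"
  "sub s (section_of B f g) = section_of (sub s B) (sub s f) (sub s g)"
  by (simp_all add: section_of_def)

text \<open>Both halves are the same section condition with the roles of the two maps exchanged, so
  one typing lemma serves for both.\<close>

lemma is_equiv_eq:
  "is_equiv A B f = Sg (B \<rightharpoonup> A) (section_of (wk 1 B) (wk 1 f) (Var 0)) \<otimes>
    Sg (B \<rightharpoonup> A) (section_of (wk 1 A) (Var 0) (wk 1 f))"
  by (simp add: is_equiv_def section_of_def)

lemma equiv_simps [simp]:
  "ren r (is_equiv A B f) = is_equiv (ren r A) (ren r B) (ren r f)"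
  "sub s (is_equiv A B f) = is_equiv (sub s A) (sub s B) (sub s f)"
  "ren r (equiv A B) = equiv (ren r A) (ren r B)"
  "sub s (equiv A B) = equiv (sub s A) (sub s B)"
  "ren r (is_small n A) = is_small n (ren r A)"
  "sub s (is_small n A) = is_small n (sub s A)"
  by (simp_all add: is_equiv_eq equiv_def is_small_def)

lemma is_type_section_of:
  assumes B: "\<Theta> \<bar> \<Gamma> \<turnstile> B : Univ n" and f: "\<Theta> \<bar> \<Gamma> \<turnstile> f : A \<rightharpoonup> B" and g: "\<Theta> \<bar> \<Gamma> \<turnstile> g : B \<rightharpoonup> A"
  shows "is_type \<Theta> \<Gamma> (section_of B f g)"
proof -
  have tB: "is_type \<Theta> \<Gamma> B" using B by (rule is_typeI)
  have v: "\<Theta> \<bar> B # \<Gamma> \<turnstile> Var 0 : wk 1 B" using typing_var[OF tB] by simp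
  have f': "\<Theta> \<bar> B # \<Gamma> \<turnstile> wk 1 f : wk 1 A \<rightharpoonup> wk 1 B" using typing_weaken[OF f tB] by simp
  have g': "\<Theta> \<bar> B # \<Gamma> \<turnstile> wk 1 g : wk 1 B \<rightharpoonup> wk 1 A" using typing_weaken[OF g tB] by simp
  have "is_type \<Theta> (B # \<Gamma>) (Eq (wk 1 B) (App (wk 1 f) (App (wk 1 g) (Var 0))) (Var 0))"
    using typing_weaken[OF B tB] typing_app_arr[OF f' typing_app_arr[OF g' v]] v
    by (intro is_typeI[OF typing.eq]) simp_all
  with tB show ?thesis unfolding section_of_def by (rule is_type_pi)
qed

lemma is_type_equiv_parts:
  assumes A: "\<Theta> \<bar> \<Gamma> \<turnstile> A : Univ m" and B: "\<Theta> \<bar> \<Gamma> \<turnstile> B : Univ n" and f: "\<Theta> \<bar> \<Gamma> \<turnstile> f : A \<rightharpoonup> B"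
  shows "is_type \<Theta> ((B \<rightharpoonup> A) # \<Gamma>) (section_of (wk 1 B) (wk 1 f) (Var 0))"
    and "is_type \<Theta> ((B \<rightharpoonup> A) # \<Gamma>) (section_of (wk 1 A) (Var 0) (wk 1 f))"
proof -
  have t: "is_type \<Theta> \<Gamma> (B \<rightharpoonup> A)" using typing_arr[OF B A] by (rule is_typeI)
  note wks = typing_weaken[OF A t] typing_weaken[OF B t] typing_weaken[OF f t] typing_var[OF t]
  show "is_type \<Theta> ((B \<rightharpoonup> A) # \<Gamma>) (section_of (wk 1 B) (wk 1 f) (Var 0))"
    by (rule is_type_section_of) (use wks in simp_all)
  show "is_type \<Theta> ((B \<rightharpoonup> A) # \<Gamma>) (section_of (wk 1 A) (Var 0) (wk 1 f))"
    by (rule is_type_section_of) (use wks in simp_all)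
qed

lemma is_type_is_equiv:
  assumes A: "\<Theta> \<bar> \<Gamma> \<turnstile> A : Univ m" and B: "\<Theta> \<bar> \<Gamma> \<turnstile> B : Univ n" and f: "\<Theta> \<bar> \<Gamma> \<turnstile> f : A \<rightharpoonup> B"
  shows "is_type \<Theta> \<Gamma> (is_equiv A B f)"
  unfolding is_equiv_eq using is_type_equiv_parts[OF assms] typing_arr[OF B A]
  by (intro is_type_prd is_type_sg) (auto intro: is_typeI)

lemma is_type_equiv_family:
  assumes A: "\<Theta> \<bar> \<Gamma> \<turnstile> A : Univ m" and B: "\<Theta> \<bar> \<Gamma> \<turnstile> B : Univ n"
  shows "is_type \<Theta> ((A \<rightharpoonup> B) # \<Gamma>) (is_equiv (wk 1 A) (wk 1 B) (Var 0))"
proof -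
  have t: "is_type \<Theta> \<Gamma> (A \<rightharpoonup> B)" using typing_arr[OF A B] by (rule is_typeI)
  show ?thesis
    by (rule is_type_is_equiv) (use typing_weaken[OF A t] typing_weaken[OF B t] typing_var[OF t] in simp_all)
qed

lemma is_type_equiv:
  assumes A: "\<Theta> \<bar> \<Gamma> \<turnstile> A : Univ m" and B: "\<Theta> \<bar> \<Gamma> \<turnstile> B : Univ n"
  shows "is_type \<Theta> \<Gamma> (equiv A B)"
  unfolding equiv_def using is_type_equiv_family[OF assms] typing_arr[OF assms]
  by (intro is_type_sg) (auto intro: is_typeI)

lemma is_type_small_family:
  assumes A: "\<Theta> \<bar> \<Gamma> \<turnstile> A : Univ n"
  shows "is_type \<Theta> (Univ k # \<Gamma>) (equiv (Var 0) (wk 1 A))"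
proof -
  have U: "is_type \<Theta> \<Gamma> (Univ k)" using typing_univ[OF A] by (rule is_typeI)
  show ?thesis
    by (rule is_type_equiv) (use typing_weaken[OF A U] typing_var[OF U] in simp_all)
qed

lemma is_type_is_small: "\<Theta> \<bar> \<Gamma> \<turnstile> A : Univ n \<Longrightarrow> is_type \<Theta> \<Gamma> (is_small k A)"
  unfolding is_small_def by (intro is_type_sg is_type_small_family) (auto intro: is_typeI typing_univ)

text \<open>The equivalence in \<open>is_small\<close> points from the small type to
  \<open>A\<close>. A right inverse of it is a map \<open>g\<close> encoding \<open>A\<close> in the
  small type, with \<open>f\<close> as decoding; for \<open>A = Omega t\<close> these are the codes
  of propositions.\<close>

lemma is_small_section:
  assumes A: "\<Theta> \<bar> \<Gamma> \<turnstile> A : Univ n" and s: "inhabited \<Theta> \<Gamma> (is_small k A)"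
  shows "\<exists>Y f g. (\<Theta> \<bar> \<Gamma> \<turnstile> Y : Univ k) \<and> (\<Theta> \<bar> \<Gamma> \<turnstile> f : Y \<rightharpoonup> A) \<and> (\<Theta> \<bar> \<Gamma> \<turnstile> g : A \<rightharpoonup> Y) \<and>
    inhabited \<Theta> \<Gamma> (section_of A f g)"
proof -
  have U: "is_type \<Theta> \<Gamma> (Univ k)" using typing_univ[OF A] by (rule is_typeI)
  obtain Y where Y: "\<Theta> \<bar> \<Gamma> \<turnstile> Y : Univ k" and e: "inhabited \<Theta> \<Gamma> (equiv Y A)"
    using inhabited_sgD[OF s[unfolded is_small_def] U is_type_small_family[OF A]] is_type_equiv[OF _ A]
    by auto
  have t: "is_type \<Theta> \<Gamma> (Y \<rightharpoonup> A)" and t': "is_type \<Theta> \<Gamma> (A \<rightharpoonup> Y)"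
    using typing_arr[OF Y A] typing_arr[OF A Y] by (auto intro: is_typeI)
  obtain f where f: "\<Theta> \<bar> \<Gamma> \<turnstile> f : Y \<rightharpoonup> A" and e: "inhabited \<Theta> \<Gamma> (is_equiv Y A f)"
    using inhabited_sgD[OF e[unfolded equiv_def] t is_type_equiv_family[OF Y A]] is_type_is_equiv[OF Y A]
    by auto
  note parts = is_type_equiv_parts[OF Y A f]
  have "inhabited \<Theta> \<Gamma> (Sg (A \<rightharpoonup> Y) (section_of (wk 1 A) (wk 1 f) (Var 0)))"
    using inhabited_prdD(1)[OF e[unfolded is_equiv_eq]] is_type_sg[OF t'] parts by blast
  from inhabited_sgD[OF this t' parts(1)] show ?thesis
    using Y f is_type_section_of[OF A f] by auto
qed

lemma typing_id: "is_type \<Theta> \<Gamma> A \<Longrightarrow> \<Theta> \<bar> \<Gamma> \<turnstile> Lam (Var 0) : A \<rightharpoonup> A"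
  by (auto intro: typing_lam_arr typing_var)

lemma inhabited_equiv_id:
  assumes A: "\<Theta> \<bar> \<Gamma> \<turnstile> A : Univ n"
  shows "inhabited \<Theta> \<Gamma> (equiv A A)"
proof -
  let ?i = "Lam (Var 0)"
  have tA: "is_type \<Theta> \<Gamma> A" using A by (rule is_typeI)
  have i: "\<Theta> \<bar> \<Gamma> \<turnstile> ?i : A \<rightharpoonup> A" using tA by (rule typing_id)
  have tAA: "is_type \<Theta> \<Gamma> (A \<rightharpoonup> A)" using typing_arr[OF A A] by (rule is_typeI)
  have v: "\<Theta> \<bar> A # \<Gamma> \<turnstile> Var 0 : wk 1 A" using typing_var[OF tA] by simp
  have A1: "\<Theta> \<bar> A # \<Gamma> \<turnstile> wk 1 A : Univ n" using typing_weaken[OF A tA] by simp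
  note i1 = typing_id[OF is_typeI[OF A1]]
  have beta: "App ?i t \<approx> t" for t by (rule beta_eq) simp
  have "inhabited \<Theta> (A # \<Gamma>) (Eq (wk 1 A) (App ?i (App ?i (Var 0))) (Var 0))"
    by (intro inhabited_eq_conv[OF A1] typing_app_arr[OF i1] v conv_trans[OF beta] beta)
  then have s: "inhabited \<Theta> \<Gamma> (section_of A ?i ?i)"
    unfolding section_of_def using tA is_typeI[OF typing.eq[OF A1 typing_app_arr[OF i1 typing_app_arr[OF i1 v]] v]]
    by (intro inhabited_pi) simp_all
  note parts = is_type_equiv_parts[OF A A i]
  have "inhabited \<Theta> \<Gamma> (is_equiv A A ?i)"
    unfolding is_equiv_eq using s i
    by (intro inhabited_prd inhabited_sg is_type_sg parts tAA) simp_all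
  then show ?thesis unfolding equiv_def
    by (intro inhabited_sg[OF tAA is_type_equiv_family[OF A A] i]) simp
qed

lemma inhabited_is_small:
  assumes A: "\<Theta> \<bar> \<Gamma> \<turnstile> A : Univ n"
  shows "inhabited \<Theta> \<Gamma> (is_small n A)"
  unfolding is_small_def using inhabited_equiv_id[OF A]
  by (intro inhabited_sg[OF is_typeI[OF typing_univ[OF A]] is_type_small_family[OF A] A]) simp

section \<open>Fibres, surjections and covers\<close>

definition fiber :: "tm \<Rightarrow> tm \<Rightarrow> tm \<Rightarrow> tm \<Rightarrow> tm" where
  "fiber A B f b = Sg A (Eq (wk 1 B) (App (wk 1 f) (Var 0)) (wk 1 b))"

lemma fiber_simps [simp]:
  "ren r (fiber A B f b) = fiber (ren r A) (ren r B) (ren r f) (ren r b)"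
  "wk k (fiber A B f b) = fiber (wk k A) (wk k B) (wk k f) (wk k b)"
  "sub s (fiber A B f b) = fiber (sub s A) (sub s B) (sub s f) (sub s b)"
proof -
  show r: "ren r (fiber A B f b) = fiber (ren r A) (ren r B) (ren r f) (ren r b)" for r
    by (simp add: fiber_def)
  show "wk k (fiber A B f b) = fiber (wk k A) (wk k B) (wk k f) (wk k b)"
    unfolding wk_eq_ren_shift by (rule r)
  show "sub s (fiber A B f b) = fiber (sub s A) (sub s B) (sub s f) (sub s b)"
    by (simp add: fiber_def)
qed

lemma typing_fiber_family:
  assumes A: "\<Theta> \<bar> \<Gamma> \<turnstile> A : Univ m" and B: "\<Theta> \<bar> \<Gamma> \<turnstile> B : Univ n" and f: "\<Theta> \<bar> \<Gamma> \<turnstile> f : A \<rightharpoonup> B"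
    and b: "\<Theta> \<bar> \<Gamma> \<turnstile> b : B"
  shows "\<Theta> \<bar> A # \<Gamma> \<turnstile> Eq (wk 1 B) (App (wk 1 f) (Var 0)) (wk 1 b) : Univ n"
proof -
  have t: "is_type \<Theta> \<Gamma> A" using A by (rule is_typeI)
  have f': "\<Theta> \<bar> A # \<Gamma> \<turnstile> wk 1 f : wk 1 A \<rightharpoonup> wk 1 B" using typing_weaken[OF f t] by simp
  show ?thesis
    using typing_weaken[OF B t] typing_weaken[OF b t] typing_app_arr[OF f'] typing_var[OF t]
    by (intro typing.eq) simp_all
qed

lemma typing_fiber:
  assumes "\<Theta> \<bar> \<Gamma> \<turnstile> A : Univ m" "\<Theta> \<bar> \<Gamma> \<turnstile> B : Univ n" "\<Theta> \<bar> \<Gamma> \<turnstile> f : A \<rightharpoonup> B" "\<Theta> \<bar> \<Gamma> \<turnstile> b : B"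
  shows "\<Theta> \<bar> \<Gamma> \<turnstile> fiber A B f b : Univ (max m n)"
  unfolding fiber_def using assms by (intro typing.sg typing_fiber_family)

lemma inhabited_fiber:
  assumes A: "\<Theta> \<bar> \<Gamma> \<turnstile> A : Univ m" and B: "\<Theta> \<bar> \<Gamma> \<turnstile> B : Univ n" and f: "\<Theta> \<bar> \<Gamma> \<turnstile> f : A \<rightharpoonup> B"
    and b: "\<Theta> \<bar> \<Gamma> \<turnstile> b : B" and a: "\<Theta> \<bar> \<Gamma> \<turnstile> a : A" and e: "inhabited \<Theta> \<Gamma> (Eq B (App f a) b)"
  shows "inhabited \<Theta> \<Gamma> (fiber A B f b)"
  unfolding fiber_def using e
  by (intro inhabited_sg[OF is_typeI[OF A] is_typeI[OF typing_fiber_family[OF A B f b]] a]) simp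

lemma inhabited_trunc:
  "\<Theta> \<bar> \<Gamma> \<turnstile> A : Univ n \<Longrightarrow> inhabited \<Theta> \<Gamma> A \<Longrightarrow> inhabited \<Theta> \<Gamma> (Trunc A)"
  unfolding inhabited_def using typing.trin by blast

lemma is_surjection_eq:
  "is_surjection A B f = Pi B (Trunc (fiber (wk 1 A) (wk 1 B) (wk 1 f) (Var 0)))"
  by (simp add: is_surjection_def fiber_def)

lemma is_surjection_simps [simp]:
  "ren r (is_surjection A B f) = is_surjection (ren r A) (ren r B) (ren r f)"
  "sub s (is_surjection A B f) = is_surjection (sub s A) (sub s B) (sub s f)"
  by (simp_all add: is_surjection_eq)

lemma typing_surjection_family:
  assumes A: "\<Theta> \<bar> \<Gamma> \<turnstile> A : Univ m" and B: "\<Theta> \<bar> \<Gamma> \<turnstile> B : Univ n" and f: "\<Theta> \<bar> \<Gamma> \<turnstile> f : A \<rightharpoonup> B"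
  shows "\<Theta> \<bar> B # \<Gamma> \<turnstile> fiber (wk 1 A) (wk 1 B) (wk 1 f) (Var 0) : Univ (max m n)"
proof -
  have t: "is_type \<Theta> \<Gamma> B" using B by (rule is_typeI)
  show ?thesis
    by (rule typing_fiber)
      (use typing_weaken[OF A t] typing_weaken[OF B t] typing_weaken[OF f t] typing_var[OF t] in simp_all)
qed

lemma is_type_is_surjection:
  assumes "\<Theta> \<bar> \<Gamma> \<turnstile> A : Univ m" "\<Theta> \<bar> \<Gamma> \<turnstile> B : Univ n" "\<Theta> \<bar> \<Gamma> \<turnstile> f : A \<rightharpoonup> B"
  shows "is_type \<Theta> \<Gamma> (is_surjection A B f)"
  unfolding is_surjection_eq using typing_surjection_family[OF assms] assms(2)
  by (blast intro: is_type_pi is_typeI typing.trunc)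

lemma inhabited_surjection_id:
  assumes A: "\<Theta> \<bar> \<Gamma> \<turnstile> A : Univ n"
  shows "inhabited \<Theta> \<Gamma> (is_surjection A A (Lam (Var 0)))"
proof -
  have t: "is_type \<Theta> \<Gamma> A" using A by (rule is_typeI)
  note F = typing_surjection_family[OF A A typing_id[OF t]]
  have v: "\<Theta> \<bar> A # \<Gamma> \<turnstile> Var 0 : wk 1 A" using typing_var[OF t] by simp
  have A1: "\<Theta> \<bar> A # \<Gamma> \<turnstile> wk 1 A : Univ n" using typing_weaken[OF A t] by simp
  note i = typing_id[OF is_typeI[OF A1]]
  have "inhabited \<Theta> (A # \<Gamma>) (fiber (wk 1 A) (wk 1 A) (Lam (Var 0)) (Var 0))"
    by (rule inhabited_fiber[OF A1 A1 i v v inhabited_eq_conv[OF A1 typing_app_arr[OF i v] v]])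
      (simp add: beta_eq)
  then have "inhabited \<Theta> (A # \<Gamma>) (fiber (wk 1 A) (wk 1 A) (wk 1 (Lam (Var 0))) (Var 0))"
    by simp
  then show ?thesis unfolding is_surjection_eq
    using F t by (blast intro: inhabited_pi is_typeI typing.trunc inhabited_trunc)
qed

definition covering :: "nat \<Rightarrow> tm \<Rightarrow> tm" where
  "covering n T = Sg (Univ n) (Sg (Var 0 \<rightharpoonup> wk 1 T) (is_surjection (Var 1) (wk 2 T) (Var 0)))"

lemma is_covered_eq: "is_covered n X S = Trunc (covering n (total_space X S))"
  by (simp add: is_covered_def covering_def)

lemma is_type_cover_family:
  assumes A: "\<Theta> \<bar> \<Gamma> \<turnstile> A : Univ m" and T: "\<Theta> \<bar> \<Gamma> \<turnstile> T : Univ n"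
  shows "is_type \<Theta> ((A \<rightharpoonup> T) # \<Gamma>) (is_surjection (wk 1 A) (wk 1 T) (Var 0))"
proof -
  have t: "is_type \<Theta> \<Gamma> (A \<rightharpoonup> T)" using typing_arr[OF A T] by (rule is_typeI)
  show ?thesis
    by (rule is_type_is_surjection)
      (use typing_weaken[OF A t] typing_weaken[OF T t] typing_var[OF t] in simp_all)
qed

lemma is_type_covering_family:
  assumes T: "\<Theta> \<bar> \<Gamma> \<turnstile> T : Univ n"
  shows "is_type \<Theta> (Univ k # \<Gamma>) (Sg (Var 0 \<rightharpoonup> wk 1 T) (is_surjection (Var 1) (wk 2 T) (Var 0)))"
proof -
  have U: "is_type \<Theta> \<Gamma> (Univ k)" using typing_univ[OF T] by (rule is_typeI)
  have T1: "\<Theta> \<bar> Univ k # \<Gamma> \<turnstile> wk 1 T : Univ n" using typing_weaken[OF T U] by simp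
  have v: "\<Theta> \<bar> Univ k # \<Gamma> \<turnstile> Var 0 : Univ k" using typing_var[OF U] by simp
  show ?thesis
    using is_type_cover_family[OF v T1] typing_arr[OF v T1] by (intro is_type_sg) (auto intro: is_typeI)
qed

lemma is_type_covering: "\<Theta> \<bar> \<Gamma> \<turnstile> T : Univ n \<Longrightarrow> is_type \<Theta> \<Gamma> (covering k T)"
  unfolding covering_def by (intro is_type_sg is_type_covering_family) (auto intro: is_typeI typing_univ)

lemma is_type_is_covered: "\<Theta> \<bar> \<Gamma> \<turnstile> total_space X S : Univ n \<Longrightarrow> is_type \<Theta> \<Gamma> (is_covered k X S)"
  using is_type_covering typing.trunc unfolding is_covered_eq is_type_def by blast

lemma inhabited_is_covered:
  assumes T: "\<Theta> \<bar> \<Gamma> \<turnstile> total_space X S : Univ n"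
  shows "inhabited \<Theta> \<Gamma> (is_covered n X S)"
proof -
  let ?T = "total_space X S"
  have t: "is_type \<Theta> \<Gamma> (?T \<rightharpoonup> ?T)" using typing_arr[OF T T] by (rule is_typeI)
  have "inhabited \<Theta> \<Gamma> (Sg (?T \<rightharpoonup> ?T) (is_surjection (wk 1 ?T) (wk 1 ?T) (Var 0)))"
    using inhabited_surjection_id[OF T]
    by (intro inhabited_sg[OF t is_type_cover_family[OF T T] typing_id[OF is_typeI[OF T]]]) simp
  then have "inhabited \<Theta> \<Gamma> (covering n ?T)" unfolding covering_def
    by (intro inhabited_sg[OF is_typeI[OF typing_univ[OF T]] is_type_covering_family[OF T] T]) simp
  then show ?thesis unfolding is_covered_eq
    using is_type_covering[OF T] inhabited_trunc is_type_def by blast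
qed

section \<open>Images of maps\<close>

lemma typing_is_prop_trunc:
  assumes A: "\<Theta> \<bar> \<Gamma> \<turnstile> A : Univ n"
  shows "\<Theta> \<bar> \<Gamma> \<turnstile> Lam (Lam (TrPath (Var 1) (Var 0))) : is_prop (Trunc A)"
proof -
  have t: "is_type \<Theta> \<Gamma> (Trunc A)" using typing.trunc[OF A] by (rule is_typeI)
  have t1: "is_type \<Theta> (Trunc A # \<Gamma>) (Trunc (wk 1 A))" using is_type_weaken[OF t t] by simp
  have A2: "\<Theta> \<bar> Trunc (wk 1 A) # Trunc A # \<Gamma> \<turnstile> wk 2 A : Univ n"
    using typing_weaken2[OF A t t1] by simp
  have v0: "\<Theta> \<bar> Trunc (wk 1 A) # Trunc A # \<Gamma> \<turnstile> Var 0 : Trunc (wk 2 A)" using typing_var[OF t1] by simp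
  have v1: "\<Theta> \<bar> Trunc (wk 1 A) # Trunc A # \<Gamma> \<turnstile> Var 1 : Trunc (wk 2 A)" using typing_var1[OF t t1] by simp
  show ?thesis unfolding is_prop_def
    using typing.trpath[OF A2 v1 v0] typing.eq[OF typing.trunc[OF A2] v1 v0] t t1
    by (auto intro!: typing_lam is_type_pi intro: is_typeI)
qed

definition image :: "tm \<Rightarrow> tm \<Rightarrow> tm \<Rightarrow> tm" where
  "image A B f = Lam (Pr (Trunc (fiber (wk 1 A) (wk 1 B) (wk 1 f) (Var 0))) (Lam (Lam (TrPath (Var 1) (Var 0)))))"

text \<open>The level is that of the fibres. If \<open>m\<close> and \<open>n\<close> are both
  \<open>u\<close>, the image is valued in \<open>Omega u\<close> and its total space remains in
  \<open>Univ u\<close>.\<close>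

lemma typing_image:
  assumes A: "\<Theta> \<bar> \<Gamma> \<turnstile> A : Univ m" and B: "\<Theta> \<bar> \<Gamma> \<turnstile> B : Univ n" and f: "\<Theta> \<bar> \<Gamma> \<turnstile> f : A \<rightharpoonup> B"
  shows "\<Theta> \<bar> \<Gamma> \<turnstile> image A B f : B \<rightharpoonup> Omega (max m n)"
  unfolding image_def
  using typing_surjection_family[OF assms] is_typeI[OF B] is_type_Omega[OF B]
  by (auto intro!: typing_lam_arr typing_pr_Omega typing.trunc typing_is_prop_trunc[unfolded One_nat_def])

text \<open>Beta and the first projection compute membership, so passing between it and the
  truncated fibre is a conversion and not a transport.\<close>

lemma conv_mem_image: "mem x (image A B f) \<approx> Trunc (fiber A B f x)"
  unfolding mem_def image_def
  by (rule conv_trans[OF conv_Fst[OF beta]]) (simp add: conv_fst)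


section \<open>Families and their images\<close>

definition ub_of_family :: "tm \<Rightarrow> tm \<Rightarrow> tm \<Rightarrow> tm \<Rightarrow> tm" where
  "ub_of_family R I f z = Pi I (le (wk 1 R) (App (wk 1 f) (Var 0)) (wk 1 z))"

definition ub_of_subset :: "tm \<Rightarrow> tm \<Rightarrow> tm \<Rightarrow> tm \<Rightarrow> tm" where
  "ub_of_subset X R S z = Pi X (mem (Var 0) (wk 1 S) \<rightharpoonup> le (wk 1 R) (Var 0) (wk 1 z))"

text \<open>\<open>U\<close> is a type over the context extended by a candidate bound, which it sees
  as \<open>Var 0\<close>. With \<open>U\<close> as a parameter, suprema of families and of subsets
  differ only in the predicate of being an upper bound.\<close>

definition least_with :: "tm \<Rightarrow> tm \<Rightarrow> tm \<Rightarrow> tm \<Rightarrow> tm" where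
  "least_with X R U s = Pi X (U \<rightharpoonup> le (wk 1 R) (wk 1 s) (Var 0))"

lemma ub_simps [simp]:
  "ren r (ub_of_family R I f z) = ub_of_family (ren r R) (ren r I) (ren r f) (ren r z)"
  "sub s (ub_of_family R I f z) = ub_of_family (sub s R) (sub s I) (sub s f) (sub s z)"
  "ren r (ub_of_subset X R S z) = ub_of_subset (ren r X) (ren r R) (ren r S) (ren r z)"
  "sub s (ub_of_subset X R S z) = ub_of_subset (sub s X) (sub s R) (sub s S) (sub s z)"
  "ren r (least_with X R U z) = least_with (ren r X) (ren r R) (ren (up_ren r) U) (ren r z)"
  "sub s (least_with X R U z) = least_with (sub s X) (sub s R) (sub (up_sub s) U) (sub s z)"
  by (simp_all add: ub_of_family_def ub_of_subset_def least_with_def)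

lemma wk_ub_simps [simp]:
  "wk k (ub_of_family R I f z) = ub_of_family (wk k R) (wk k I) (wk k f) (wk k z)"
  "wk k (ub_of_subset X R S z) = ub_of_subset (wk k X) (wk k R) (wk k S) (wk k z)"
  by (simp_all add: wk_eq_ren_shift del: ren_shift)

lemma is_sup_of_family_eq:
  "is_sup_of_family X R I f s = ub_of_family R I f s \<otimes>
    least_with X R (ub_of_family (wk 1 R) (wk 1 I) (wk 1 f) (Var 0)) s"
  by (simp add: is_sup_of_family_def ub_of_family_def least_with_def)

lemma is_sup_of_subset_eq:
  "is_sup_of_subset X R S s = ub_of_subset X R S s \<otimes>
    least_with X R (ub_of_subset (wk 1 X) (wk 1 R) (wk 1 S) (Var 0)) s"
  by (simp add: is_sup_of_subset_def ub_of_subset_def least_with_def)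

lemma sup_simps [simp]:
  "ren r (is_sup_of_family X R I f z) = is_sup_of_family (ren r X) (ren r R) (ren r I) (ren r f) (ren r z)"
  "sub s (is_sup_of_family X R I f z) = is_sup_of_family (sub s X) (sub s R) (sub s I) (sub s f) (sub s z)"
  "ren r (is_sup_of_subset X R S z) = is_sup_of_subset (ren r X) (ren r R) (ren r S) (ren r z)"
  "sub s (is_sup_of_subset X R S z) = is_sup_of_subset (sub s X) (sub s R) (sub s S) (sub s z)"
  by (simp_all add: is_sup_of_family_eq is_sup_of_subset_eq)

lemma has_sup_simps [simp]:
  "ren r (family_has_sup X R I f) = family_has_sup (ren r X) (ren r R) (ren r I) (ren r f)"
  "sub s (family_has_sup X R I f) = family_has_sup (sub s X) (sub s R) (sub s I) (sub s f)"
  "ren r (subset_has_sup X R S) = subset_has_sup (ren r X) (ren r R) (ren r S)"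
  "sub s (subset_has_sup X R S) = subset_has_sup (sub s X) (sub s R) (sub s S)"
  by (simp_all add: family_has_sup_def subset_has_sup_def)

lemma is_type_ub_of_family:
  assumes R: "\<Theta> \<bar> \<Gamma> \<turnstile> R : X \<rightharpoonup> X \<rightharpoonup> Omega w" and I: "\<Theta> \<bar> \<Gamma> \<turnstile> I : Univ v"
    and f: "\<Theta> \<bar> \<Gamma> \<turnstile> f : I \<rightharpoonup> X" and z: "\<Theta> \<bar> \<Gamma> \<turnstile> z : X"
  shows "is_type \<Theta> (I # \<Gamma>) (le (wk 1 R) (App (wk 1 f) (Var 0)) (wk 1 z))"
    and "is_type \<Theta> \<Gamma> (ub_of_family R I f z)"
proof -
  have t: "is_type \<Theta> \<Gamma> I" using I by (rule is_typeI)
  have f': "\<Theta> \<bar> I # \<Gamma> \<turnstile> wk 1 f : wk 1 I \<rightharpoonup> wk 1 X" using typing_weaken[OF f t] by simp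
  show "is_type \<Theta> (I # \<Gamma>) (le (wk 1 R) (App (wk 1 f) (Var 0)) (wk 1 z))"
    by (rule is_typeI, rule typing_le)
      (use typing_weaken[OF R t] typing_weaken[OF z t] typing_app_arr[OF f'] typing_var[OF t] in simp_all)
  with t show "is_type \<Theta> \<Gamma> (ub_of_family R I f z)"
    unfolding ub_of_family_def by (rule is_type_pi)
qed

lemma is_type_ub_of_subset:
  assumes X: "\<Theta> \<bar> \<Gamma> \<turnstile> X : Univ u" and R: "\<Theta> \<bar> \<Gamma> \<turnstile> R : X \<rightharpoonup> X \<rightharpoonup> Omega w"
    and S: "\<Theta> \<bar> \<Gamma> \<turnstile> S : X \<rightharpoonup> Omega t" and z: "\<Theta> \<bar> \<Gamma> \<turnstile> z : X"
  shows "is_type \<Theta> (X # \<Gamma>) (mem (Var 0) (wk 1 S))"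
    and "is_type \<Theta> (X # \<Gamma>) (le (wk 1 R) (Var 0) (wk 1 z))"
    and "is_type \<Theta> \<Gamma> (ub_of_subset X R S z)"
proof -
  have t: "is_type \<Theta> \<Gamma> X" using X by (rule is_typeI)
  have v: "\<Theta> \<bar> X # \<Gamma> \<turnstile> Var 0 : wk 1 X" using typing_var[OF t] by simp
  show m: "is_type \<Theta> (X # \<Gamma>) (mem (Var 0) (wk 1 S))"
    by (rule is_typeI, rule typing_mem[OF _ v]) (use typing_weaken[OF S t] in simp)
  show l: "is_type \<Theta> (X # \<Gamma>) (le (wk 1 R) (Var 0) (wk 1 z))"
    by (rule is_typeI, rule typing_le[OF _ v])
      (use typing_weaken[OF R t] typing_weaken[OF z t] in simp_all)
  show "is_type \<Theta> \<Gamma> (ub_of_subset X R S z)"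
    unfolding ub_of_subset_def by (intro is_type_pi t is_type_arr m l)
qed

lemma is_type_least_with:
  assumes X: "\<Theta> \<bar> \<Gamma> \<turnstile> X : Univ u" and R: "\<Theta> \<bar> \<Gamma> \<turnstile> R : X \<rightharpoonup> X \<rightharpoonup> Omega w"
    and U: "is_type \<Theta> (X # \<Gamma>) U" and z: "\<Theta> \<bar> \<Gamma> \<turnstile> z : X"
  shows "is_type \<Theta> (X # \<Gamma>) (le (wk 1 R) (wk 1 z) (Var 0))"
    and "is_type \<Theta> \<Gamma> (least_with X R U z)"
proof -
  have t: "is_type \<Theta> \<Gamma> X" using X by (rule is_typeI)
  have v: "\<Theta> \<bar> X # \<Gamma> \<turnstile> Var 0 : wk 1 X" using typing_var[OF t] by simp
  show l: "is_type \<Theta> (X # \<Gamma>) (le (wk 1 R) (wk 1 z) (Var 0))"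
    by (rule is_typeI, rule typing_le[OF _ _ v])
      (use typing_weaken[OF R t] typing_weaken[OF z t] in simp_all)
  show "is_type \<Theta> \<Gamma> (least_with X R U z)"
    unfolding least_with_def by (intro is_type_pi t is_type_arr U l)
qed

text \<open>Leastness is contravariant in the predicate: a bound in the sense of \<open>V\<close> is
  one in the sense of \<open>U\<close>, so an element below all of the latter lies below all of the
  former.\<close>

lemma inhabited_least_with_mono:
  assumes X: "\<Theta> \<bar> \<Gamma> \<turnstile> X : Univ u" and R: "\<Theta> \<bar> \<Gamma> \<turnstile> R : X \<rightharpoonup> X \<rightharpoonup> Omega w"
    and U: "is_type \<Theta> (X # \<Gamma>) U" and V: "is_type \<Theta> (X # \<Gamma>) V" and z: "\<Theta> \<bar> \<Gamma> \<turnstile> z : X"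
    and VU: "inhabited \<Theta> (X # \<Gamma>) (V \<rightharpoonup> U)" and l: "inhabited \<Theta> \<Gamma> (least_with X R U z)"
  shows "inhabited \<Theta> \<Gamma> (least_with X R V z)"
proof -
  have t: "is_type \<Theta> \<Gamma> X" using X by (rule is_typeI)
  have v: "\<Theta> \<bar> X # \<Gamma> \<turnstile> Var 0 : wk (Suc 0) X" using typing_var[OF t] by simp
  note L = is_type_least_with(1)[OF X R U z]
  have UL: "inhabited \<Theta> (X # \<Gamma>) (U \<rightharpoonup> le (wk 1 R) (wk 1 z) (Var 0))"
    using inhabited_spec[OF inhabited_weaken[OF l[unfolded least_with_def] t, simplified] v] by simp
  have "inhabited \<Theta> (V # X # \<Gamma>) (wk (Suc 0) (le (wk 1 R) (wk 1 z) (Var 0)))"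
    using inhabited_weaken[OF UL V] inhabited_weaken[OF VU V] inhabitedI[OF typing_var[OF V]]
    by (auto dest!: inhabited_app)
  then show ?thesis
    unfolding least_with_def by (intro inhabited_pi t inhabited_arr is_type_arr V L)
qed

text \<open>The internal dependent pair is traded for an external witness \<open>s\<close>, so that
  the bound and its leastness can be treated separately.\<close>

lemma inhabited_family_has_sup_iff:
  assumes X: "\<Theta> \<bar> \<Gamma> \<turnstile> X : Univ u" and R: "\<Theta> \<bar> \<Gamma> \<turnstile> R : X \<rightharpoonup> X \<rightharpoonup> Omega w"
    and I: "\<Theta> \<bar> \<Gamma> \<turnstile> I : Univ v" and f: "\<Theta> \<bar> \<Gamma> \<turnstile> f : I \<rightharpoonup> X"
  shows "is_type \<Theta> \<Gamma> (family_has_sup X R I f)"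
    and "inhabited \<Theta> \<Gamma> (family_has_sup X R I f) \<longleftrightarrow>
      (\<exists>s. (\<Theta> \<bar> \<Gamma> \<turnstile> s : X) \<and> inhabited \<Theta> \<Gamma> (ub_of_family R I f s) \<and>
        inhabited \<Theta> \<Gamma> (least_with X R (ub_of_family (wk 1 R) (wk 1 I) (wk 1 f) (Var 0)) s))"
proof -
  \<comment> \<open>Stated for arbitrary contexts and terms because it is needed both over
    \<open>\<Gamma>\<close> and over the context with a generic candidate in
    \<open>X\<close>.\<close>
  have T: "is_type \<Theta> \<Delta> (ub_of_family R I f s)"
      "is_type \<Theta> \<Delta> (least_with X R (ub_of_family (wk 1 R) (wk 1 I) (wk 1 f) (Var 0)) s)"
    if X: "\<Theta> \<bar> \<Delta> \<turnstile> X : Univ u" and R: "\<Theta> \<bar> \<Delta> \<turnstile> R : X \<rightharpoonup> X \<rightharpoonup> Omega w"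
      and I: "\<Theta> \<bar> \<Delta> \<turnstile> I : Univ v" and f: "\<Theta> \<bar> \<Delta> \<turnstile> f : I \<rightharpoonup> X" and s: "\<Theta> \<bar> \<Delta> \<turnstile> s : X"
    for \<Delta> X R I f s
  proof -
    have t: "is_type \<Theta> \<Delta> X" using X by (rule is_typeI)
    show "is_type \<Theta> \<Delta> (ub_of_family R I f s)" using that is_type_ub_of_family(2) by blast
    have "is_type \<Theta> (X # \<Delta>) (ub_of_family (wk 1 R) (wk 1 I) (wk 1 f) (Var 0))"
      by (rule is_type_ub_of_family)
        (use typing_weaken[OF R t] typing_weaken[OF I t] typing_weaken[OF f t] typing_var[OF t] in simp_all)
    then show "is_type \<Theta> \<Delta> (least_with X R (ub_of_family (wk 1 R) (wk 1 I) (wk 1 f) (Var 0)) s)"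
      using that is_type_least_with by blast
  qed
  have t: "is_type \<Theta> \<Gamma> X" using X by (rule is_typeI)
  have F: "is_type \<Theta> (X # \<Gamma>) (is_sup_of_family (wk 1 X) (wk 1 R) (wk 1 I) (wk 1 f) (Var 0))"
    unfolding is_sup_of_family_eq
    by (intro is_type_prd T)
      (use typing_weaken[OF X t] typing_weaken[OF R t] typing_weaken[OF I t] typing_weaken[OF f t] typing_var[OF t] in simp_all)
  show "is_type \<Theta> \<Gamma> (family_has_sup X R I f)"
    unfolding family_has_sup_def using t F by (rule is_type_sg)
  show "inhabited \<Theta> \<Gamma> (family_has_sup X R I f) \<longleftrightarrow>
      (\<exists>s. (\<Theta> \<bar> \<Gamma> \<turnstile> s : X) \<and> inhabited \<Theta> \<Gamma> (ub_of_family R I f s) \<and>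
        inhabited \<Theta> \<Gamma> (least_with X R (ub_of_family (wk 1 R) (wk 1 I) (wk 1 f) (Var 0)) s))"
  proof
    assume "inhabited \<Theta> \<Gamma> (family_has_sup X R I f)"
    from inhabited_sgD[OF this[unfolded family_has_sup_def] t F]
    obtain s where s: "\<Theta> \<bar> \<Gamma> \<turnstile> s : X" and "inhabited \<Theta> \<Gamma> (is_sup_of_family X R I f s)"
      using is_type_prd[OF T[OF X R I f]] by (auto simp: is_sup_of_family_eq)
    from inhabited_prdD[OF this(2)[unfolded is_sup_of_family_eq] T[OF X R I f s]] s
    show "\<exists>s. (\<Theta> \<bar> \<Gamma> \<turnstile> s : X) \<and> inhabited \<Theta> \<Gamma> (ub_of_family R I f s) \<and>
        inhabited \<Theta> \<Gamma> (least_with X R (ub_of_family (wk 1 R) (wk 1 I) (wk 1 f) (Var 0)) s)" by blast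
  next
    assume "\<exists>s. (\<Theta> \<bar> \<Gamma> \<turnstile> s : X) \<and> inhabited \<Theta> \<Gamma> (ub_of_family R I f s) \<and>
        inhabited \<Theta> \<Gamma> (least_with X R (ub_of_family (wk 1 R) (wk 1 I) (wk 1 f) (Var 0)) s)"
    then obtain s where s: "\<Theta> \<bar> \<Gamma> \<turnstile> s : X" "inhabited \<Theta> \<Gamma> (is_sup_of_family X R I f s)"
      using inhabited_prd[OF T[OF X R I f]] unfolding is_sup_of_family_eq by blast
    then show "inhabited \<Theta> \<Gamma> (family_has_sup X R I f)"
      unfolding family_has_sup_def by (intro inhabited_sg[OF t F]) simp_all
  qed
qed

lemma inhabited_subset_has_sup_iff:
  assumes X: "\<Theta> \<bar> \<Gamma> \<turnstile> X : Univ u" and R: "\<Theta> \<bar> \<Gamma> \<turnstile> R : X \<rightharpoonup> X \<rightharpoonup> Omega w"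
    and S: "\<Theta> \<bar> \<Gamma> \<turnstile> S : X \<rightharpoonup> Omega t"
  shows "is_type \<Theta> \<Gamma> (subset_has_sup X R S)"
    and "inhabited \<Theta> \<Gamma> (subset_has_sup X R S) \<longleftrightarrow>
      (\<exists>s. (\<Theta> \<bar> \<Gamma> \<turnstile> s : X) \<and> inhabited \<Theta> \<Gamma> (ub_of_subset X R S s) \<and>
        inhabited \<Theta> \<Gamma> (least_with X R (ub_of_subset (wk 1 X) (wk 1 R) (wk 1 S) (Var 0)) s))"
proof -
  have T: "is_type \<Theta> \<Delta> (ub_of_subset X R S s)"
      "is_type \<Theta> \<Delta> (least_with X R (ub_of_subset (wk 1 X) (wk 1 R) (wk 1 S) (Var 0)) s)"
    if X: "\<Theta> \<bar> \<Delta> \<turnstile> X : Univ u" and R: "\<Theta> \<bar> \<Delta> \<turnstile> R : X \<rightharpoonup> X \<rightharpoonup> Omega w"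
      and S: "\<Theta> \<bar> \<Delta> \<turnstile> S : X \<rightharpoonup> Omega t" and s: "\<Theta> \<bar> \<Delta> \<turnstile> s : X"
    for \<Delta> X R S s
  proof -
    have t: "is_type \<Theta> \<Delta> X" using X by (rule is_typeI)
    show "is_type \<Theta> \<Delta> (ub_of_subset X R S s)" using that is_type_ub_of_subset(3) by blast
    have "is_type \<Theta> (X # \<Delta>) (ub_of_subset (wk 1 X) (wk 1 R) (wk 1 S) (Var 0))"
      by (rule is_type_ub_of_subset)
        (use typing_weaken[OF X t] typing_weaken[OF R t] typing_weaken[OF S t] typing_var[OF t] in simp_all)
    then show "is_type \<Theta> \<Delta> (least_with X R (ub_of_subset (wk 1 X) (wk 1 R) (wk 1 S) (Var 0)) s)"
      using that is_type_least_with by blast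
  qed
  have t: "is_type \<Theta> \<Gamma> X" using X by (rule is_typeI)
  have F: "is_type \<Theta> (X # \<Gamma>) (is_sup_of_subset (wk 1 X) (wk 1 R) (wk 1 S) (Var 0))"
    unfolding is_sup_of_subset_eq
    by (intro is_type_prd T)
      (use typing_weaken[OF X t] typing_weaken[OF R t] typing_weaken[OF S t] typing_var[OF t] in simp_all)
  show "is_type \<Theta> \<Gamma> (subset_has_sup X R S)"
    unfolding subset_has_sup_def using t F by (rule is_type_sg)
  show "inhabited \<Theta> \<Gamma> (subset_has_sup X R S) \<longleftrightarrow>
      (\<exists>s. (\<Theta> \<bar> \<Gamma> \<turnstile> s : X) \<and> inhabited \<Theta> \<Gamma> (ub_of_subset X R S s) \<and>
        inhabited \<Theta> \<Gamma> (least_with X R (ub_of_subset (wk 1 X) (wk 1 R) (wk 1 S) (Var 0)) s))"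
  proof
    assume "inhabited \<Theta> \<Gamma> (subset_has_sup X R S)"
    from inhabited_sgD[OF this[unfolded subset_has_sup_def] t F]
    obtain s where s: "\<Theta> \<bar> \<Gamma> \<turnstile> s : X" and "inhabited \<Theta> \<Gamma> (is_sup_of_subset X R S s)"
      using is_type_prd[OF T[OF X R S]] by (auto simp: is_sup_of_subset_eq)
    from inhabited_prdD[OF this(2)[unfolded is_sup_of_subset_eq] T[OF X R S s]] s
    show "\<exists>s. (\<Theta> \<bar> \<Gamma> \<turnstile> s : X) \<and> inhabited \<Theta> \<Gamma> (ub_of_subset X R S s) \<and>
        inhabited \<Theta> \<Gamma> (least_with X R (ub_of_subset (wk 1 X) (wk 1 R) (wk 1 S) (Var 0)) s)" by blast
  next
    assume "\<exists>s. (\<Theta> \<bar> \<Gamma> \<turnstile> s : X) \<and> inhabited \<Theta> \<Gamma> (ub_of_subset X R S s) \<and>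
        inhabited \<Theta> \<Gamma> (least_with X R (ub_of_subset (wk 1 X) (wk 1 R) (wk 1 S) (Var 0)) s)"
    then obtain s where s: "\<Theta> \<bar> \<Gamma> \<turnstile> s : X" "inhabited \<Theta> \<Gamma> (is_sup_of_subset X R S s)"
      using inhabited_prd[OF T[OF X R S]] unfolding is_sup_of_subset_eq by blast
    then show "inhabited \<Theta> \<Gamma> (subset_has_sup X R S)"
      unfolding subset_has_sup_def by (intro inhabited_sg[OF t F]) simp_all
  qed
qed

text \<open>\<open>S\<close> has the same elements as the image of \<open>f\<close>.\<close>

definition enumerates ::
  "tm set \<Rightarrow> tm list \<Rightarrow> nat \<Rightarrow> nat \<Rightarrow> nat \<Rightarrow> nat \<Rightarrow> tm \<Rightarrow> tm \<Rightarrow> tm \<Rightarrow> tm \<Rightarrow> tm \<Rightarrow> bool" where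
  "enumerates \<Theta> \<Gamma> u v w t X R I f S \<longleftrightarrow>
    (\<Theta> \<bar> \<Gamma> \<turnstile> X : Univ u) \<and> (\<Theta> \<bar> \<Gamma> \<turnstile> R : X \<rightharpoonup> X \<rightharpoonup> Omega w) \<and>
    (\<Theta> \<bar> \<Gamma> \<turnstile> I : Univ v) \<and> (\<Theta> \<bar> \<Gamma> \<turnstile> f : I \<rightharpoonup> X) \<and> (\<Theta> \<bar> \<Gamma> \<turnstile> S : X \<rightharpoonup> Omega t) \<and>
    inhabited \<Theta> \<Gamma> (Pi I (mem (App (wk 1 f) (Var 0)) (wk 1 S))) \<and>
    inhabited \<Theta> \<Gamma> (Pi X (mem (Var 0) (wk 1 S) \<rightharpoonup> Trunc (fiber (wk 1 I) (wk 1 X) (wk 1 f) (Var 0))))"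

text \<open>This makes the relation available under binders, where generic elements, membership
  proofs and bounds have joined the context.\<close>

lemma enumerates_weaken:
  assumes "enumerates \<Theta> \<Gamma> u v w t X R I f S" and A: "is_type \<Theta> \<Gamma> A"
  shows "enumerates \<Theta> (A # \<Gamma>) u v w t (wk 1 X) (wk 1 R) (wk 1 I) (wk 1 f) (wk 1 S)"
  using assms(1) unfolding enumerates_def
  by (auto dest!: typing_weaken[OF _ A] inhabited_weaken[OF _ A])

text \<open>A point of the fibre is some \<open>i\<close> with \<open>f i = x\<close>. The bound at
  \<open>f i\<close> is transported along this identity in the family of elements below
  \<open>z\<close>.\<close>

lemma inhabited_le_of_fiber:
  assumes e: "enumerates \<Theta> \<Gamma> u v w t X R I f S" and z: "\<Theta> \<bar> \<Gamma> \<turnstile> z : X" and x: "\<Theta> \<bar> \<Gamma> \<turnstile> x : X"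
    and ub: "inhabited \<Theta> \<Gamma> (ub_of_family R I f z)" and q: "inhabited \<Theta> \<Gamma> (fiber I X f x)"
  shows "inhabited \<Theta> \<Gamma> (le R x z)"
proof -
  have X: "\<Theta> \<bar> \<Gamma> \<turnstile> X : Univ u" and R: "\<Theta> \<bar> \<Gamma> \<turnstile> R : X \<rightharpoonup> X \<rightharpoonup> Omega w"
    and I: "\<Theta> \<bar> \<Gamma> \<turnstile> I : Univ v" and f: "\<Theta> \<bar> \<Gamma> \<turnstile> f : I \<rightharpoonup> X"
    using e by (auto simp: enumerates_def)
  have "\<And>a. \<Theta> \<bar> \<Gamma> \<turnstile> a : I \<Longrightarrow> is_type \<Theta> \<Gamma> (Eq X (App f a) x)"
    using typing.eq[OF X typing_app_arr[OF f] x] by (rule is_typeI)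
  then obtain i where i: "\<Theta> \<bar> \<Gamma> \<turnstile> i : I" and p: "inhabited \<Theta> \<Gamma> (Eq X (App f i) x)"
    using inhabited_sgD[OF q[unfolded fiber_def] is_typeI[OF I] is_typeI[OF typing_fiber_family[OF I X f x]]]
    by auto
  have tX: "is_type \<Theta> \<Gamma> X" using X by (rule is_typeI)
  have "\<Theta> \<bar> X # \<Gamma> \<turnstile> le (wk 1 R) (Var 0) (wk 1 z) : Univ w"
    by (rule typing_le) (use typing_weaken[OF R tX] typing_weaken[OF z tX] typing_var[OF tX] in simp_all)
  moreover have "inhabited \<Theta> \<Gamma> (le R (App f i) z)"
    using inhabited_spec[OF ub[unfolded ub_of_family_def] i] by simp
  ultimately show ?thesis
    using inhabited_transport[OF X typing_app_arr[OF f i] x p] typing_le[OF R x z] is_typeI by simp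
qed

lemma inhabited_le_of_mem:
  assumes e: "enumerates \<Theta> \<Gamma> u v w t X R I f S" and z: "\<Theta> \<bar> \<Gamma> \<turnstile> z : X" and x: "\<Theta> \<bar> \<Gamma> \<turnstile> x : X"
    and ub: "inhabited \<Theta> \<Gamma> (ub_of_family R I f z)" and m: "inhabited \<Theta> \<Gamma> (mem x S)"
  shows "inhabited \<Theta> \<Gamma> (le R x z)"
proof -
  have X: "\<Theta> \<bar> \<Gamma> \<turnstile> X : Univ u" and R: "\<Theta> \<bar> \<Gamma> \<turnstile> R : X \<rightharpoonup> X \<rightharpoonup> Omega w"
    and I: "\<Theta> \<bar> \<Gamma> \<turnstile> I : Univ v" and f: "\<Theta> \<bar> \<Gamma> \<turnstile> f : I \<rightharpoonup> X"
    and b: "inhabited \<Theta> \<Gamma> (Pi X (mem (Var 0) (wk 1 S) \<rightharpoonup> Trunc (fiber (wk 1 I) (wk 1 X) (wk 1 f) (Var 0))))"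
    using e by (auto simp: enumerates_def)
  have F: "is_type \<Theta> \<Gamma> (fiber I X f x)" using typing_fiber[OF I X f x] by (rule is_typeI)
  note le = typing_le[OF R x z]
  have "inhabited \<Theta> \<Gamma> (mem x S \<rightharpoonup> Trunc (fiber I X f x))"
    using inhabited_spec[OF b x] by simp
  then obtain p where p: "\<Theta> \<bar> \<Gamma> \<turnstile> p : Trunc (fiber I X f x)"
    using m inhabited_app unfolding inhabited_def by blast
  \<comment> \<open>Eliminating the truncation takes a function out of the fibre. The argument for
    an untruncated fibre is therefore run with a generic point of it in the context and then
    abstracted.\<close>
  have "inhabited \<Theta> (fiber I X f x # \<Gamma>) (le (wk 1 R) (wk 1 x) (wk 1 z))"
    by (rule inhabited_le_of_fiber[OF enumerates_weaken[OF e F]])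
      (use typing_weaken[OF x F] typing_weaken[OF z F] inhabited_weaken[OF ub F] inhabitedI[OF typing_var[OF F]]
        in simp_all)
  then obtain g where g: "\<Theta> \<bar> \<Gamma> \<turnstile> g : fiber I X f x \<rightharpoonup> le R x z"
    using inhabited_arr[OF F is_typeI[OF le]] by (auto simp: inhabited_def)
  obtain h where "\<Theta> \<bar> \<Gamma> \<turnstile> h : is_prop (le R x z)"
    using inhabited_is_prop_le[OF R x z] by (auto simp: inhabited_def)
  from typing.trrec[OF le this g p] show ?thesis by (rule inhabitedI)
qed

lemma inhabited_ub_iff:
  assumes e: "enumerates \<Theta> \<Gamma> u v w t X R I f S" and z: "\<Theta> \<bar> \<Gamma> \<turnstile> z : X"
  shows "inhabited \<Theta> \<Gamma> (ub_of_family R I f z) \<longleftrightarrow> inhabited \<Theta> \<Gamma> (ub_of_subset X R S z)"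
proof
  have X: "\<Theta> \<bar> \<Gamma> \<turnstile> X : Univ u" and R: "\<Theta> \<bar> \<Gamma> \<turnstile> R : X \<rightharpoonup> X \<rightharpoonup> Omega w"
    and I: "\<Theta> \<bar> \<Gamma> \<turnstile> I : Univ v" and f: "\<Theta> \<bar> \<Gamma> \<turnstile> f : I \<rightharpoonup> X"
    and S: "\<Theta> \<bar> \<Gamma> \<turnstile> S : X \<rightharpoonup> Omega t"
    and a: "inhabited \<Theta> \<Gamma> (Pi I (mem (App (wk 1 f) (Var 0)) (wk 1 S)))"
    using e by (auto simp: enumerates_def)
  note T = is_type_ub_of_subset[OF X R S z]
  have tX: "is_type \<Theta> \<Gamma> X" and tI: "is_type \<Theta> \<Gamma> I" using X I by (auto intro: is_typeI)
  {
    assume ub: "inhabited \<Theta> \<Gamma> (ub_of_family R I f z)"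
    let ?M = "mem (Var 0) (wk 1 S)"
    \<comment> \<open>\<open>Var 1\<close> is a generic element of \<open>X\<close> and
      \<open>Var 0\<close> a proof that it belongs to \<open>S\<close>.\<close>
    have "inhabited \<Theta> (?M # X # \<Gamma>) (le (wk 1 (wk 1 R)) (Var (Suc 0)) (wk 1 (wk 1 z)))"
      by (rule inhabited_le_of_mem[OF enumerates_weaken[OF enumerates_weaken[OF e tX] T(1)]])
        (use typing_weaken2[OF z tX T(1)] typing_var1[OF tX T(1)] inhabited_weaken2[OF ub tX T(1)]
          inhabitedI[OF typing_var[OF T(1)]] in simp_all)
    then show "inhabited \<Theta> \<Gamma> (ub_of_subset X R S z)"
      unfolding ub_of_subset_def by (intro inhabited_pi inhabited_arr is_type_arr tX T) simp
  next
    assume ub: "inhabited \<Theta> \<Gamma> (ub_of_subset X R S z)"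
    have f': "\<Theta> \<bar> I # \<Gamma> \<turnstile> wk 1 f : wk 1 I \<rightharpoonup> wk 1 X" using typing_weaken[OF f tI] by simp
    have fi: "\<Theta> \<bar> I # \<Gamma> \<turnstile> App (wk (Suc 0) f) (Var 0) : wk (Suc 0) X"
      using typing_app_arr[OF f'] typing_var[OF tI] by simp
    have "inhabited \<Theta> (I # \<Gamma>) (mem (App (wk 1 f) (Var 0)) (wk 1 S))"
      using inhabited_spec[OF inhabited_weaken[OF a tI, simplified] typing_var[OF tI]] by simp
    moreover have "inhabited \<Theta> (I # \<Gamma>)
        (mem (App (wk 1 f) (Var 0)) (wk 1 S) \<rightharpoonup> le (wk 1 R) (App (wk 1 f) (Var 0)) (wk 1 z))"
      using inhabited_spec[OF inhabited_weaken[OF ub[unfolded ub_of_subset_def] tI, simplified] fi] by simp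
    ultimately have "inhabited \<Theta> (I # \<Gamma>) (le (wk 1 R) (App (wk 1 f) (Var 0)) (wk 1 z))"
      using inhabited_app by blast
    then show "inhabited \<Theta> \<Gamma> (ub_of_family R I f z)"
      unfolding ub_of_family_def by (rule inhabited_pi[OF tI is_type_ub_of_family(1)[OF R I f z]])
  }
qed

lemma inhabited_has_sup_iff:
  assumes e: "enumerates \<Theta> \<Gamma> u v w t X R I f S"
  shows "inhabited \<Theta> \<Gamma> (family_has_sup X R I f) \<longleftrightarrow> inhabited \<Theta> \<Gamma> (subset_has_sup X R S)"
proof -
  have X: "\<Theta> \<bar> \<Gamma> \<turnstile> X : Univ u" and R: "\<Theta> \<bar> \<Gamma> \<turnstile> R : X \<rightharpoonup> X \<rightharpoonup> Omega w"
    and I: "\<Theta> \<bar> \<Gamma> \<turnstile> I : Univ v" and f: "\<Theta> \<bar> \<Gamma> \<turnstile> f : I \<rightharpoonup> X"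
    and S: "\<Theta> \<bar> \<Gamma> \<turnstile> S : X \<rightharpoonup> Omega t"
    using e by (auto simp: enumerates_def)
  have tX: "is_type \<Theta> \<Gamma> X" using X by (rule is_typeI)
  have v: "\<Theta> \<bar> X # \<Gamma> \<turnstile> Var 0 : wk 1 X" using typing_var[OF tX] by simp
  let ?U = "ub_of_family (wk 1 R) (wk 1 I) (wk 1 f) (Var 0)"
  let ?V = "ub_of_subset (wk 1 X) (wk 1 R) (wk 1 S) (Var 0)"
  note e1 = enumerates_weaken[OF e tX]
  have U: "is_type \<Theta> (X # \<Gamma>) ?U" and V: "is_type \<Theta> (X # \<Gamma>) ?V"
    using e1 v is_type_ub_of_family(2) is_type_ub_of_subset(3) unfolding enumerates_def by blast+
  \<comment> \<open>The equivalence of the two kinds of bound is external. Using it where a proof of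
    \<open>?U\<close> is itself in the context makes it a term of the function type to
    \<open>?V\<close>, as \<open>inhabited_least_with_mono\<close> requires; the converse is
    obtained in the same way.\<close>
  have "inhabited \<Theta> (?U # X # \<Gamma>) (wk (Suc 0) ?V)"
    using inhabited_ub_iff[OF enumerates_weaken[OF e1 U], of "Var (Suc 0)"] typing_var1[OF tX U]
      inhabitedI[OF typing_var[OF U]] by simp
  then have UV: "inhabited \<Theta> (X # \<Gamma>) (?U \<rightharpoonup> ?V)" using U V by (intro inhabited_arr)
  have "inhabited \<Theta> (?V # X # \<Gamma>) (wk (Suc 0) ?U)"
    using inhabited_ub_iff[OF enumerates_weaken[OF e1 V], of "Var (Suc 0)"] typing_var1[OF tX V]
      inhabitedI[OF typing_var[OF V]] by simp
  then have VU: "inhabited \<Theta> (X # \<Gamma>) (?V \<rightharpoonup> ?U)" using U V by (intro inhabited_arr)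
  show ?thesis
    unfolding inhabited_family_has_sup_iff(2)[OF X R I f] inhabited_subset_has_sup_iff(2)[OF X R S]
    using inhabited_ub_iff[OF e] inhabited_least_with_mono[OF X R U V _ VU]
      inhabited_least_with_mono[OF X R V U _ UV] by blast
qed

section \<open>Subsets as families indexed in the universe of the carrier\<close>

definition resizing :: "tm set \<Rightarrow> tm list \<Rightarrow> nat \<Rightarrow> tm \<Rightarrow> tm \<Rightarrow> tm \<Rightarrow> bool" where
  "resizing \<Theta> \<Gamma> t Y f g \<longleftrightarrow> (\<Theta> \<bar> \<Gamma> \<turnstile> Y : Univ 0) \<and> (\<Theta> \<bar> \<Gamma> \<turnstile> f : Y \<rightharpoonup> Omega t) \<and>
    (\<Theta> \<bar> \<Gamma> \<turnstile> g : Omega t \<rightharpoonup> Y) \<and> inhabited \<Theta> \<Gamma> (section_of (Omega t) f g)"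

lemma resizing_weaken:
  assumes "resizing \<Theta> \<Gamma> t Y f g" and A: "is_type \<Theta> \<Gamma> A"
  shows "resizing \<Theta> (A # \<Gamma>) t (wk 1 Y) (wk 1 f) (wk 1 g)"
  using assms(1) unfolding resizing_def section_of_def
  by (auto dest!: typing_weaken[OF _ A] inhabited_weaken[OF _ A])

definition resized_total :: "tm \<Rightarrow> tm \<Rightarrow> tm \<Rightarrow> tm \<Rightarrow> nat \<Rightarrow> tm" where
  "resized_total X S Y g t =
    Sg X (Eq (wk 1 Y) (App (wk 1 g) (App (wk 1 S) (Var 0))) (App (wk 1 g) (truth t)))"

lemma wk_resized_total [simp]:
  "wk k (resized_total X S Y g t) = resized_total (wk k X) (wk k S) (wk k Y) (wk k g) t"
  by (simp add: resized_total_def)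

lemma typing_resized_total:
  assumes X: "\<Theta> \<bar> \<Gamma> \<turnstile> X : Univ u" and S: "\<Theta> \<bar> \<Gamma> \<turnstile> S : X \<rightharpoonup> Omega t" and r: "resizing \<Theta> \<Gamma> t Y f g"
  shows "is_type \<Theta> (X # \<Gamma>) (Eq (wk 1 Y) (App (wk 1 g) (App (wk 1 S) (Var 0))) (App (wk 1 g) (truth t)))"
    and "\<Theta> \<bar> \<Gamma> \<turnstile> resized_total X S Y g t : Univ u"
proof -
  have Y: "\<Theta> \<bar> \<Gamma> \<turnstile> Y : Univ 0" and g: "\<Theta> \<bar> \<Gamma> \<turnstile> g : Omega t \<rightharpoonup> Y" using r by (auto simp: resizing_def)
  have tX: "is_type \<Theta> \<Gamma> X" using X by (rule is_typeI)
  have v: "\<Theta> \<bar> X # \<Gamma> \<turnstile> Var 0 : wk 1 X" using typing_var[OF tX] by simp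
  have S': "\<Theta> \<bar> X # \<Gamma> \<turnstile> wk 1 S : wk 1 X \<rightharpoonup> Omega t" using typing_weaken[OF S tX] by simp
  have g': "\<Theta> \<bar> X # \<Gamma> \<turnstile> wk 1 g : Omega t \<rightharpoonup> wk 1 Y" using typing_weaken[OF g tX] by simp
  have Y': "\<Theta> \<bar> X # \<Gamma> \<turnstile> wk 1 Y : Univ 0" using typing_weaken[OF Y tX] by simp
  note E = typing.eq[OF Y' typing_app_arr[OF g' typing_app_arr[OF S' v]] typing_app_arr[OF g' typing_truth[OF v]]]
  show "is_type \<Theta> (X # \<Gamma>) (Eq (wk 1 Y) (App (wk 1 g) (App (wk 1 S) (Var 0))) (App (wk 1 g) (truth t)))"
    using E by (rule is_typeI)
  \<comment> \<open>The identity type of codes lies in \<open>Univ 0\<close>, and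
    \<open>max u 0 = u\<close>. The index type thus has exactly the level of the carrier, whatever
    \<open>t\<close> is.\<close>
  show "\<Theta> \<bar> \<Gamma> \<turnstile> resized_total X S Y g t : Univ u"
    using typing.sg[OF X E] by (simp add: resized_total_def)
qed

lemma typing_fst_resized:
  assumes X: "\<Theta> \<bar> \<Gamma> \<turnstile> X : Univ u" and S: "\<Theta> \<bar> \<Gamma> \<turnstile> S : X \<rightharpoonup> Omega t" and r: "resizing \<Theta> \<Gamma> t Y f g"
    and q: "\<Theta> \<bar> \<Gamma> \<turnstile> q : resized_total X S Y g t"
  shows "\<Theta> \<bar> \<Gamma> \<turnstile> Fst q : X" and "inhabited \<Theta> \<Gamma> (mem (Fst q) S)"
proof -
  have r': "\<Theta> \<bar> \<Gamma> \<turnstile> Y : Univ 0" "\<Theta> \<bar> \<Gamma> \<turnstile> f : Y \<rightharpoonup> Omega t" "\<Theta> \<bar> \<Gamma> \<turnstile> g : Omega t \<rightharpoonup> Y"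
    "inhabited \<Theta> \<Gamma> (section_of (Omega t) f g)" using r by (auto simp: resizing_def)
  note E = typing_resized_total(1)[OF X S r]
  show x: "\<Theta> \<bar> \<Gamma> \<turnstile> Fst q : X"
    using typing_fst[OF q[unfolded resized_total_def] is_typeI[OF X] E] .
  have Sx: "\<Theta> \<bar> \<Gamma> \<turnstile> App S (Fst q) : Omega t" using S x by (rule typing_app_arr)
  have "is_type \<Theta> \<Gamma> (Eq Y (App g (App S (Fst q))) (App g (truth t)))"
    using typing.eq[OF r'(1) typing_app_arr[OF r'(3) Sx] typing_app_arr[OF r'(3) typing_truth[OF x]]]
    by (rule is_typeI)
  then have "inhabited \<Theta> \<Gamma> (Eq Y (App g (App S (Fst q))) (App g (truth t)))"
    using typing_snd[OF q[unfolded resized_total_def] is_typeI[OF X] E] by (auto intro: inhabitedI)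
  then show "inhabited \<Theta> \<Gamma> (mem (Fst q) S)"
    using inhabited_resize_iff[OF r'(1,2,3) _ Sx] r'(4) by (simp add: section_of_def mem_def)
qed

lemma typing_fst_fun:
  assumes X: "\<Theta> \<bar> \<Gamma> \<turnstile> X : Univ u" and S: "\<Theta> \<bar> \<Gamma> \<turnstile> S : X \<rightharpoonup> Omega t" and r: "resizing \<Theta> \<Gamma> t Y f g"
  shows "\<Theta> \<bar> \<Gamma> \<turnstile> Lam (Fst (Var 0)) : resized_total X S Y g t \<rightharpoonup> X"
proof -
  have tI: "is_type \<Theta> \<Gamma> (resized_total X S Y g t)" using typing_resized_total(2)[OF assms] by (rule is_typeI)
  have "\<Theta> \<bar> resized_total X S Y g t # \<Gamma> \<turnstile> Fst (Var 0) : wk (Suc 0) X"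
    by (rule typing_fst_resized(1)[OF _ _ resizing_weaken[OF r tI]])
      (use typing_weaken[OF X tI] typing_weaken[OF S tI] typing_var[OF tI] in simp_all)
  then show ?thesis by (rule typing_lam_arr[OF tI is_typeI[OF X]])
qed

text \<open>Encoding the membership gives an equality of codes \<open>c\<close>. The index
  \<open>Pr x c\<close> lies over \<open>x\<close>, because its first projection computes to
  \<open>x\<close>.\<close>

lemma inhabited_fiber_resized:
  assumes X: "\<Theta> \<bar> \<Gamma> \<turnstile> X : Univ u" and S: "\<Theta> \<bar> \<Gamma> \<turnstile> S : X \<rightharpoonup> Omega t" and r: "resizing \<Theta> \<Gamma> t Y f g"
    and x: "\<Theta> \<bar> \<Gamma> \<turnstile> x : X" and m: "inhabited \<Theta> \<Gamma> (mem x S)"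
  shows "inhabited \<Theta> \<Gamma> (fiber (resized_total X S Y g t) X (Lam (Fst (Var 0))) x)"
proof -
  have r': "\<Theta> \<bar> \<Gamma> \<turnstile> Y : Univ 0" "\<Theta> \<bar> \<Gamma> \<turnstile> f : Y \<rightharpoonup> Omega t" "\<Theta> \<bar> \<Gamma> \<turnstile> g : Omega t \<rightharpoonup> Y"
    "inhabited \<Theta> \<Gamma> (section_of (Omega t) f g)" using r by (auto simp: resizing_def)
  have Sx: "\<Theta> \<bar> \<Gamma> \<turnstile> App S x : Omega t" using S x by (rule typing_app_arr)
  obtain c where c: "\<Theta> \<bar> \<Gamma> \<turnstile> c : Eq Y (App g (App S x)) (App g (truth t))"
    using inhabited_resize_iff[OF r'(1,2,3) _ Sx] r'(4) m by (auto simp: section_of_def mem_def inhabited_def)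
  have q: "\<Theta> \<bar> \<Gamma> \<turnstile> Pr x c : resized_total X S Y g t"
    unfolding resized_total_def
    by (rule typing_pr[OF is_typeI[OF X] typing_resized_total(1)[OF X S r] x]) (use c in simp)
  note p = typing_fst_fun[OF X S r]
  have "App (Lam (Fst (Var 0))) (Pr x c) \<approx> Fst (Pr x c)" by (rule beta_eq) simp
  then have "App (Lam (Fst (Var 0))) (Pr x c) \<approx> x" using conv_fst conv_trans by blast
  then show ?thesis
    by (intro inhabited_fiber[OF typing_resized_total(2)[OF X S r] X p x q] inhabited_eq_conv[OF X typing_app_arr[OF p q] x])
qed

lemma conv_mem: "x \<approx> y \<Longrightarrow> mem x S \<approx> mem y S"
  unfolding mem_def by (intro conv_Fst c_app conv_refl)

text \<open>Decoding the second component of an index shows that its first component belongs to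
  \<open>S\<close>. Conversely a member has an actual index over it, from which the truncated fibre
  follows.\<close>

lemma enumerates_resized_total:
  assumes X: "\<Theta> \<bar> \<Gamma> \<turnstile> X : Univ u" and R: "\<Theta> \<bar> \<Gamma> \<turnstile> R : X \<rightharpoonup> X \<rightharpoonup> Omega w"
    and S: "\<Theta> \<bar> \<Gamma> \<turnstile> S : X \<rightharpoonup> Omega t" and r: "resizing \<Theta> \<Gamma> t Y f g"
  shows "enumerates \<Theta> \<Gamma> u u w t X R (resized_total X S Y g t) (Lam (Fst (Var 0))) S"
proof -
  let ?I = "resized_total X S Y g t" and ?p = "Lam (Fst (Var 0))"
  note I = typing_resized_total(2)[OF X S r] and p = typing_fst_fun[OF X S r]
  have tI: "is_type \<Theta> \<Gamma> ?I" and tX: "is_type \<Theta> \<Gamma> X" using I X by (auto intro: is_typeI)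
  have v: "\<Theta> \<bar> ?I # \<Gamma> \<turnstile> Var 0 : resized_total (wk 1 X) (wk 1 S) (wk 1 Y) (wk 1 g) t"
    using typing_var[OF tI] by simp
  have X1: "\<Theta> \<bar> ?I # \<Gamma> \<turnstile> wk 1 X : Univ u" using typing_weaken[OF X tI] by simp
  have S1: "\<Theta> \<bar> ?I # \<Gamma> \<turnstile> wk 1 S : wk 1 X \<rightharpoonup> Omega t" using typing_weaken[OF S tI] by simp
  note r1 = resizing_weaken[OF r tI]
  have M: "is_type \<Theta> (?I # \<Gamma>) (mem (App ?p (Var 0)) (wk 1 S))"
    using typing_mem[OF S1 typing_app_arr[OF typing_fst_fun[OF X1 S1 r1] v]] by (rule is_typeI)
  have "Fst (Var 0) \<approx> App ?p (Var 0)" by (rule conv_sym, rule beta_eq) simp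
  then have "inhabited \<Theta> (?I # \<Gamma>) (mem (App ?p (Var 0)) (wk 1 S))"
    using inhabited_conv[OF typing_fst_resized(2)[OF X1 S1 r1 v] conv_mem M] by blast
  then have a: "inhabited \<Theta> \<Gamma> (Pi ?I (mem (App (wk 1 ?p) (Var 0)) (wk 1 S)))"
    using M by (intro inhabited_pi tI) simp_all
  let ?M = "mem (Var 0) (wk 1 S)" and ?F = "fiber (wk 1 ?I) (wk 1 X) (wk 1 ?p) (Var 0)"
  have M: "is_type \<Theta> (X # \<Gamma>) ?M"
    by (rule is_typeI, rule typing_mem) (use typing_weaken[OF S tX] typing_var[OF tX] in simp_all)
  have F: "\<Theta> \<bar> X # \<Gamma> \<turnstile> Trunc ?F : Univ (max u u)"
    by (rule typing.trunc, rule typing_surjection_family[OF I X p])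
  have "inhabited \<Theta> (?M # X # \<Gamma>) (fiber (resized_total (wk 1 (wk 1 X)) (wk 1 (wk 1 S)) (wk 1 (wk 1 Y)) (wk 1 (wk 1 g)) t)
      (wk 1 (wk 1 X)) ?p (Var 1))"
    by (rule inhabited_fiber_resized[OF _ _ resizing_weaken[OF resizing_weaken[OF r tX] M]])
      (use typing_weaken2[OF X tX M] typing_weaken2[OF S tX M] typing_var1[OF tX M]
        inhabitedI[OF typing_var[OF M]] in simp_all)
  then have "inhabited \<Theta> (?M # X # \<Gamma>) (wk (Suc 0) ?F)" by simp
  moreover have "\<Theta> \<bar> ?M # X # \<Gamma> \<turnstile> wk (Suc 0) ?F : Univ (max u u)"
    using typing_weaken[OF typing_surjection_family[OF I X p] M] by simp
  ultimately have "inhabited \<Theta> (?M # X # \<Gamma>) (wk (Suc 0) (Trunc ?F))"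
    using inhabited_trunc by simp
  then have "inhabited \<Theta> \<Gamma> (Pi X (?M \<rightharpoonup> Trunc ?F))"
    by (intro inhabited_pi inhabited_arr is_type_arr tX M is_typeI[OF F])
  with a show ?thesis unfolding enumerates_def using X R I p S by blast
qed

section \<open>Families as subsets\<close>

lemma image_simps [simp]:
  "ren r (image A B f) = image (ren r A) (ren r B) (ren r f)"
  "wk k (image A B f) = image (wk k A) (wk k B) (wk k f)"
proof -
  show r: "ren r (image A B f) = image (ren r A) (ren r B) (ren r f)" for r
    by (simp add: image_def)
  show "wk k (image A B f) = image (wk k A) (wk k B) (wk k f)"
    unfolding wk_eq_ren_shift by (rule r)
qed

text \<open>Each \<open>f i\<close> has \<open>i\<close> as a preimage by reflexivity, and
  membership in the image is the truncated fibre up to conversion; so one clause is an introduction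
  and the other the identity.\<close>

lemma enumerates_image:
  assumes X: "\<Theta> \<bar> \<Gamma> \<turnstile> X : Univ u" and R: "\<Theta> \<bar> \<Gamma> \<turnstile> R : X \<rightharpoonup> X \<rightharpoonup> Omega w"
    and I: "\<Theta> \<bar> \<Gamma> \<turnstile> I : Univ v" and f: "\<Theta> \<bar> \<Gamma> \<turnstile> f : I \<rightharpoonup> X"
  shows "enumerates \<Theta> \<Gamma> u v w (max v u) X R I f (image I X f)"
proof -
  let ?S = "image I X f"
  note S = typing_image[OF I X f]
  have tI: "is_type \<Theta> \<Gamma> I" and tX: "is_type \<Theta> \<Gamma> X" using I X by (auto intro: is_typeI)
  have f1: "\<Theta> \<bar> I # \<Gamma> \<turnstile> wk 1 f : wk 1 I \<rightharpoonup> wk 1 X" and v: "\<Theta> \<bar> I # \<Gamma> \<turnstile> Var 0 : wk 1 I"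
    and X1: "\<Theta> \<bar> I # \<Gamma> \<turnstile> wk 1 X : Univ u" and I1: "\<Theta> \<bar> I # \<Gamma> \<turnstile> wk 1 I : Univ v"
    using typing_weaken[OF f tI] typing_var[OF tI] typing_weaken[OF X tI] typing_weaken[OF I tI] by simp_all
  let ?x = "App (wk 1 f) (Var 0)"
  have x: "\<Theta> \<bar> I # \<Gamma> \<turnstile> ?x : wk 1 X" using f1 v by (rule typing_app_arr)
  have M: "is_type \<Theta> (I # \<Gamma>) (mem ?x (wk 1 ?S))"
    by (rule is_typeI, rule typing_mem[OF _ x]) (use typing_weaken[OF S tI] in simp)
  have "inhabited \<Theta> (I # \<Gamma>) (fiber (wk 1 I) (wk 1 X) (wk 1 f) ?x)"
    by (intro inhabited_fiber[OF I1 X1 f1 x v] inhabited_eq_conv[OF X1 x x] conv_refl)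
  from inhabited_trunc[OF typing_fiber[OF I1 X1 f1 x] this]
  have "inhabited \<Theta> (I # \<Gamma>) (mem ?x (wk 1 ?S))"
    using inhabited_conv conv_sym[OF conv_mem_image] M by simp
  then have a: "inhabited \<Theta> \<Gamma> (Pi I (mem ?x (wk 1 ?S)))" by (rule inhabited_pi[OF tI M])
  let ?M = "mem (Var 0) (wk 1 ?S)" and ?F = "Trunc (fiber (wk 1 I) (wk 1 X) (wk 1 f) (Var 0))"
  have M: "is_type \<Theta> (X # \<Gamma>) ?M"
    by (rule is_typeI, rule typing_mem) (use typing_weaken[OF S tX] typing_var[OF tX] in simp_all)
  have F: "is_type \<Theta> (X # \<Gamma>) ?F"
    using typing.trunc[OF typing_surjection_family[OF I X f]] by (rule is_typeI)
  have "wk (Suc 0) ?M \<approx> wk (Suc 0) ?F" by (simp add: conv_mem_image)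
  then have "inhabited \<Theta> (?M # X # \<Gamma>) (wk (Suc 0) ?F)"
    by (rule inhabited_conv[OF inhabitedI[OF typing_var[OF M]] _ is_type_weaken[OF F M]])
  then have "inhabited \<Theta> \<Gamma> (Pi X (?M \<rightharpoonup> ?F))"
    by (intro inhabited_pi inhabited_arr is_type_arr tX M F)
  with a show ?thesis unfolding enumerates_def using X R I f S by blast
qed

lemma total_space_simps [simp]:
  "ren r (total_space X S) = total_space (ren r X) (ren r S)"
  "sub s (total_space X S) = total_space (sub s X) (sub s S)"
  by (simp_all add: total_space_def)

lemma covered_simps [simp]:
  "ren r (is_covered n X S) = is_covered n (ren r X) (ren r S)"
  "sub s (is_covered n X S) = is_covered n (sub s X) (sub s S)"
  by (simp_all add: is_covered_eq covering_def)

lemma typing_total_space: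
  assumes X: "\<Theta> \<bar> \<Gamma> \<turnstile> X : Univ u" and S: "\<Theta> \<bar> \<Gamma> \<turnstile> S : X \<rightharpoonup> Omega t"
  shows "\<Theta> \<bar> \<Gamma> \<turnstile> total_space X S : Univ (max u t)"
proof -
  have tX: "is_type \<Theta> \<Gamma> X" using X by (rule is_typeI)
  have "\<Theta> \<bar> X # \<Gamma> \<turnstile> mem (Var 0) (wk 1 S) : Univ t"
    by (rule typing_mem) (use typing_weaken[OF S tX] typing_var[OF tX] in simp_all)
  with X show ?thesis unfolding total_space_def by (rule typing.sg)
qed


section \<open>The four completeness conditions\<close>

text \<open>These are the assumptions that have to survive extensions of the context. Resizing is
  kept for all \<open>t\<close> because the conditions on subsets are derived at every
  level.\<close>

definition resized_order :: "tm set \<Rightarrow> tm list \<Rightarrow> nat \<Rightarrow> nat \<Rightarrow> tm \<Rightarrow> tm \<Rightarrow> bool" where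
  "resized_order \<Theta> \<Gamma> u w X R \<longleftrightarrow> (\<Theta> \<bar> \<Gamma> \<turnstile> X : Univ u) \<and> (\<Theta> \<bar> \<Gamma> \<turnstile> R : X \<rightharpoonup> X \<rightharpoonup> Omega w) \<and>
    (\<forall>t. inhabited \<Theta> \<Gamma> (is_small 0 (Omega t)))"

lemma resized_order_weaken:
  assumes "resized_order \<Theta> \<Gamma> u w X R" and A: "is_type \<Theta> \<Gamma> A"
  shows "resized_order \<Theta> (A # \<Gamma>) u w (wk 1 X) (wk 1 R)"
proof -
  \<comment> \<open>The resizing statement is a closed type, so weakening leaves it
    unchanged.\<close>
  have "wk (Suc 0) (is_small 0 (Omega t)) = is_small 0 (Omega t)" for t
    unfolding wk_eq_ren_shift by (simp del: ren_shift)
  then have "inhabited \<Theta> (A # \<Gamma>) (is_small 0 (Omega t))" for t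
    using inhabited_weaken[OF _ A, of "is_small 0 (Omega t)"] assms(1) by (simp add: resized_order_def)
  then show ?thesis
    using assms(1) unfolding resized_order_def by (auto dest!: typing_weaken[OF _ A])
qed

lemma sups_simps:
  "ren r (sups_of_subsets t X R) = sups_of_subsets t (ren r X) (ren r R)"
  "ren r (sups_of_covered_subsets t u X R) = sups_of_covered_subsets t u (ren r X) (ren r R)"
  "ren r (sups_of_small_subsets t u X R) = sups_of_small_subsets t u (ren r X) (ren r R)"
  "ren r (sups_of_families u X R) = sups_of_families u (ren r X) (ren r R)"
  by (simp_all add: sups_of_subsets_def sups_of_covered_subsets_def sups_of_small_subsets_def
      sups_of_families_def subset_type_def)

lemma wk_sups_simps [simp]:
  "wk k (sups_of_subsets t X R) = sups_of_subsets t (wk k X) (wk k R)"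
  "wk k (sups_of_covered_subsets t u X R) = sups_of_covered_subsets t u (wk k X) (wk k R)"
  "wk k (sups_of_small_subsets t u X R) = sups_of_small_subsets t u (wk k X) (wk k R)"
  "wk k (sups_of_families u X R) = sups_of_families u (wk k X) (wk k R)"
  by (simp_all add: wk_eq_ren_shift sups_simps del: ren_shift)

lemma is_type_sups:
  assumes X: "\<Theta> \<bar> \<Gamma> \<turnstile> X : Univ u" and R: "\<Theta> \<bar> \<Gamma> \<turnstile> R : X \<rightharpoonup> X \<rightharpoonup> Omega w"
  shows "is_type \<Theta> \<Gamma> (subset_type t X)"
    and "is_type \<Theta> (subset_type t X # \<Gamma>) (subset_has_sup (wk 1 X) (wk 1 R) (Var 0))"
    and "is_type \<Theta> (subset_type t X # \<Gamma>) (is_covered k (wk 1 X) (Var 0))"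
    and "is_type \<Theta> (subset_type t X # \<Gamma>) (is_small k (total_space (wk 1 X) (Var 0)))"
    and "is_type \<Theta> (Univ k # \<Gamma>) (Var 0 \<rightharpoonup> wk 1 X)"
    and "is_type \<Theta> ((Var 0 \<rightharpoonup> wk 1 X) # Univ k # \<Gamma>)
      (family_has_sup (wk 2 X) (wk 2 R) (Var 1) (Var 0))"
proof -
  show P: "is_type \<Theta> \<Gamma> (subset_type t X)"
    using typing_arr[OF X typing_Omega[OF X]] by (auto simp: subset_type_def intro: is_typeI)
  have X1: "\<Theta> \<bar> subset_type t X # \<Gamma> \<turnstile> wk 1 X : Univ u"
    and R1: "\<Theta> \<bar> subset_type t X # \<Gamma> \<turnstile> wk 1 R : wk 1 X \<rightharpoonup> wk 1 X \<rightharpoonup> Omega w"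
    and S: "\<Theta> \<bar> subset_type t X # \<Gamma> \<turnstile> Var 0 : wk 1 X \<rightharpoonup> Omega t"
    using typing_weaken[OF X P] typing_weaken[OF R P] typing_var[OF P] by (simp_all add: subset_type_def)
  show "is_type \<Theta> (subset_type t X # \<Gamma>) (subset_has_sup (wk 1 X) (wk 1 R) (Var 0))"
    by (rule inhabited_subset_has_sup_iff(1)[OF X1 R1 S])
  show "is_type \<Theta> (subset_type t X # \<Gamma>) (is_covered k (wk 1 X) (Var 0))"
    by (rule is_type_is_covered[OF typing_total_space[OF X1 S]])
  show "is_type \<Theta> (subset_type t X # \<Gamma>) (is_small k (total_space (wk 1 X) (Var 0)))"
    by (rule is_type_is_small[OF typing_total_space[OF X1 S]])
  have U: "is_type \<Theta> \<Gamma> (Univ k)" using typing_univ[OF X] by (rule is_typeI)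
  have I: "\<Theta> \<bar> Univ k # \<Gamma> \<turnstile> Var 0 : Univ k" using typing_var[OF U] by simp
  have XU: "\<Theta> \<bar> Univ k # \<Gamma> \<turnstile> wk 1 X : Univ u" using typing_weaken[OF X U] by simp
  show F: "is_type \<Theta> (Univ k # \<Gamma>) (Var 0 \<rightharpoonup> wk 1 X)" using typing_arr[OF I XU] by (rule is_typeI)
  show "is_type \<Theta> ((Var 0 \<rightharpoonup> wk 1 X) # Univ k # \<Gamma>) (family_has_sup (wk 2 X) (wk 2 R) (Var 1) (Var 0))"
    by (rule inhabited_family_has_sup_iff(1))
      (use typing_weaken2[OF X U F] typing_weaken2[OF R U F] typing_var1[OF U F] typing_var[OF F] in simp_all)
qed

lemma is_type_conditions:
  assumes "\<Theta> \<bar> \<Gamma> \<turnstile> X : Univ u" "\<Theta> \<bar> \<Gamma> \<turnstile> R : X \<rightharpoonup> X \<rightharpoonup> Omega w"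
  shows "is_type \<Theta> \<Gamma> (sups_of_subsets t X R)"
    and "is_type \<Theta> \<Gamma> (sups_of_covered_subsets t k X R)"
    and "is_type \<Theta> \<Gamma> (sups_of_small_subsets t k X R)"
    and "is_type \<Theta> \<Gamma> (sups_of_families k X R)"
  unfolding sups_of_subsets_def sups_of_covered_subsets_def sups_of_small_subsets_def sups_of_families_def
  using is_typeI[OF typing_univ[OF assms(1)]]
  by (intro is_type_pi is_type_arr is_type_sups[OF assms])+

section \<open>Implications between the conditions\<close>

lemma inhabited_sups_of_subsets_weaker:
  assumes X: "\<Theta> \<bar> \<Gamma> \<turnstile> X : Univ u" and R: "\<Theta> \<bar> \<Gamma> \<turnstile> R : X \<rightharpoonup> X \<rightharpoonup> Omega w"
    and s: "inhabited \<Theta> \<Gamma> (sups_of_subsets t X R)"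
  shows "inhabited \<Theta> \<Gamma> (sups_of_covered_subsets t k X R)"
    and "inhabited \<Theta> \<Gamma> (sups_of_small_subsets t k X R)"
proof -
  note T = is_type_sups[OF X R]
  have v: "\<Theta> \<bar> subset_type t X # \<Gamma> \<turnstile> Var 0 : wk (Suc 0) (subset_type t X)" using typing_var[OF T(1)] .
  have "inhabited \<Theta> (subset_type t X # \<Gamma>) (subset_has_sup (wk 1 X) (wk 1 R) (Var 0))"
    using inhabited_spec[OF inhabited_weaken[OF s T(1), unfolded sups_of_subsets_def, simplified, unfolded sups_of_subsets_def]]
      v by (simp add: subset_type_def)
  \<comment> \<open>Weakening by the proof of coveredness or smallness amounts to a function that
    ignores it.\<close>
  note w = inhabited_weaken[OF this]
  show "inhabited \<Theta> \<Gamma> (sups_of_covered_subsets t k X R)"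
    unfolding sups_of_covered_subsets_def by (intro inhabited_pi inhabited_arr is_type_arr T w)
  show "inhabited \<Theta> \<Gamma> (sups_of_small_subsets t k X R)"
    unfolding sups_of_small_subsets_def by (intro inhabited_pi inhabited_arr is_type_arr T w)
qed

lemma inhabited_subset_has_sup:
  assumes o: "resized_order \<Theta> \<Gamma> u w X R" and S: "\<Theta> \<bar> \<Gamma> \<turnstile> S : X \<rightharpoonup> Omega t"
    and F: "inhabited \<Theta> \<Gamma> (sups_of_families u X R)"
  shows "inhabited \<Theta> \<Gamma> (subset_has_sup X R S)"
proof -
  have X: "\<Theta> \<bar> \<Gamma> \<turnstile> X : Univ u" and R: "\<Theta> \<bar> \<Gamma> \<turnstile> R : X \<rightharpoonup> X \<rightharpoonup> Omega w"
    and small: "inhabited \<Theta> \<Gamma> (is_small 0 (Omega t))"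
    using o by (auto simp: resized_order_def)
  obtain Y f g where r: "resizing \<Theta> \<Gamma> t Y f g"
    using is_small_section[OF typing_Omega[OF X] small] by (auto simp: resizing_def)
  let ?I = "resized_total X S Y g t"
  have "inhabited \<Theta> \<Gamma> (Pi (?I \<rightharpoonup> X) (family_has_sup (wk 1 X) (wk 1 R) (wk 1 ?I) (Var 0)))"
    using inhabited_spec[OF F[unfolded sups_of_families_def] typing_resized_total(2)[OF X S r]]
    by simp
  from inhabited_spec[OF this typing_fst_fun[OF X S r]]
  have "inhabited \<Theta> \<Gamma> (family_has_sup X R ?I (Lam (Fst (Var 0))))" by (simp del: wk_resized_total)
  then show ?thesis using inhabited_has_sup_iff[OF enumerates_resized_total[OF X R S r]] by blast
qed

text \<open>The subset is a variable of the extended context; resizing and completeness for families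
  are weakened to that context, where \<open>inhabited_subset_has_sup\<close> applies.\<close>

lemma inhabited_sups_of_subsets:
  assumes o: "resized_order \<Theta> \<Gamma> u w X R" and F: "inhabited \<Theta> \<Gamma> (sups_of_families u X R)"
  shows "inhabited \<Theta> \<Gamma> (sups_of_subsets t X R)"
proof -
  have X: "\<Theta> \<bar> \<Gamma> \<turnstile> X : Univ u" and R: "\<Theta> \<bar> \<Gamma> \<turnstile> R : X \<rightharpoonup> X \<rightharpoonup> Omega w"
    using o by (auto simp: resized_order_def)
  note T = is_type_sups[OF X R]
  have "inhabited \<Theta> (subset_type t X # \<Gamma>) (subset_has_sup (wk 1 X) (wk 1 R) (Var 0))"
    by (rule inhabited_subset_has_sup[OF resized_order_weaken[OF o T(1)]])
      (use typing_var[OF T(1)] inhabited_weaken[OF F T(1)] in \<open>simp_all add: subset_type_def\<close>)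
  then show ?thesis unfolding sups_of_subsets_def by (intro inhabited_pi T)
qed

text \<open>The premise is taken at level \<open>u\<close> because the image of a family in
  \<open>Univ u\<close> is valued in \<open>Omega u\<close>. Its total space then lies in
  \<open>Univ u\<close>, which makes it both small and covered at that level.\<close>

lemma inhabited_sups_of_families:
  assumes X: "\<Theta> \<bar> \<Gamma> \<turnstile> X : Univ u" and R: "\<Theta> \<bar> \<Gamma> \<turnstile> R : X \<rightharpoonup> X \<rightharpoonup> Omega w"
    and s: "inhabited \<Theta> \<Gamma> (sups_of_covered_subsets u u X R) \<or> inhabited \<Theta> \<Gamma> (sups_of_small_subsets u u X R)"
  shows "inhabited \<Theta> \<Gamma> (sups_of_families u X R)"
proof -
  \<comment> \<open>Formulated for every context, since it is applied where \<open>I\<close> and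
    \<open>f\<close> are the variables introduced by the two quantifiers.\<close>
  have *: "inhabited \<Theta> \<Delta> (family_has_sup X R I f)"
    if X: "\<Theta> \<bar> \<Delta> \<turnstile> X : Univ u" and R: "\<Theta> \<bar> \<Delta> \<turnstile> R : X \<rightharpoonup> X \<rightharpoonup> Omega w"
      and I: "\<Theta> \<bar> \<Delta> \<turnstile> I : Univ u" and f: "\<Theta> \<bar> \<Delta> \<turnstile> f : I \<rightharpoonup> X"
      and s: "inhabited \<Theta> \<Delta> (sups_of_covered_subsets u u X R) \<or> inhabited \<Theta> \<Delta> (sups_of_small_subsets u u X R)"
    for \<Delta> X R I f
  proof -
    let ?S = "image I X f"
    have S: "\<Theta> \<bar> \<Delta> \<turnstile> ?S : X \<rightharpoonup> Omega u" using typing_image[OF I X f] by simp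
    have T: "\<Theta> \<bar> \<Delta> \<turnstile> total_space X ?S : Univ u" using typing_total_space[OF X S] by simp
    from s have "inhabited \<Theta> \<Delta> (subset_has_sup X R ?S)"
    proof
      assume "inhabited \<Theta> \<Delta> (sups_of_covered_subsets u u X R)"
      from inhabited_spec[OF this[unfolded sups_of_covered_subsets_def subset_type_def] S]
      have "inhabited \<Theta> \<Delta> (is_covered u X ?S \<rightharpoonup> subset_has_sup X R ?S)" by simp
      then show ?thesis using inhabited_is_covered[OF T] by (rule inhabited_app)
    next
      assume "inhabited \<Theta> \<Delta> (sups_of_small_subsets u u X R)"
      from inhabited_spec[OF this[unfolded sups_of_small_subsets_def subset_type_def] S]
      have "inhabited \<Theta> \<Delta> (is_small u (total_space X ?S) \<rightharpoonup> subset_has_sup X R ?S)" by simp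
      then show ?thesis using inhabited_is_small[OF T] by (rule inhabited_app)
    qed
    then show ?thesis using inhabited_has_sup_iff[OF enumerates_image[OF X R I f]] by blast
  qed
  have U: "is_type \<Theta> \<Gamma> (Univ u)" using typing_univ[OF X] by (rule is_typeI)
  note T = is_type_sups(5,6)[OF X R, where k = u]
  have "inhabited \<Theta> ((Var 0 \<rightharpoonup> wk 1 X) # Univ u # \<Gamma>) (family_has_sup (wk 2 X) (wk 2 R) (Var 1) (Var 0))"
    by (rule *)
      (use typing_weaken2[OF X U T(1)] typing_weaken2[OF R U T(1)] typing_var1[OF U T(1)]
        typing_var[OF T(1)] s inhabited_weaken2[OF _ U T(1)] in \<open>simp_all, force\<close>)
  then show ?thesis unfolding sups_of_families_def by (intro inhabited_pi is_type_pi U T)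
qed

text \<open>The passage \<open>PQ\<close> is used in the context extended by \<open>P X R\<close>
  itself, which is why it is assumed for all contexts. Commutation with weakening turns the new
  variable into a proof of \<open>P\<close> for the weakened carrier and order.\<close>

lemma inhabited_arr_of_conditions:
  assumes o: "resized_order \<Theta> \<Gamma> u w X R"
    and P: "\<And>X R. wk 1 (P X R) = P (wk 1 X) (wk 1 R)" "is_type \<Theta> \<Gamma> (P X R)"
    and Q: "\<And>X R. wk 1 (Q X R) = Q (wk 1 X) (wk 1 R)" "is_type \<Theta> \<Gamma> (Q X R)"
    and PQ: "\<And>\<Delta> X R. resized_order \<Theta> \<Delta> u w X R \<Longrightarrow> inhabited \<Theta> \<Delta> (P X R) \<Longrightarrow> inhabited \<Theta> \<Delta> (Q X R)"
  shows "inhabited \<Theta> \<Gamma> (P X R \<rightharpoonup> Q X R)"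
proof -
  have "inhabited \<Theta> (P X R # \<Gamma>) (P (wk 1 X) (wk 1 R))"
    using inhabitedI[OF typing_var[OF P(2)]] P(1) by simp
  then have "inhabited \<Theta> (P X R # \<Gamma>) (wk (Suc 0) (Q X R))"
    using PQ resized_order_weaken[OF o P(2)] Q(1) by simp
  then show ?thesis by (rule inhabited_arr[OF P(2) Q(2)])
qed

theorem theorem6p9:
  fixes \<Theta> :: "tm set" and \<Gamma> :: "tm list" and X R p :: tm and u w :: nat
  assumes resizing: "\<forall>t. inhabited \<Theta> \<Gamma> (is_small 0 (Omega t))"
    and carrier: "\<Theta> \<bar> \<Gamma> \<turnstile> X : Univ u"
    and order: "\<Theta> \<bar> \<Gamma> \<turnstile> R : X \<rightharpoonup> X \<rightharpoonup> Omega w"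
    and poset: "\<Theta> \<bar> \<Gamma> \<turnstile> p : is_poset X R"
  shows "all_equivalent \<Theta> \<Gamma>
    {range (\<lambda>t. sups_of_subsets t X R),
     range (\<lambda>t. sups_of_covered_subsets t u X R),
     range (\<lambda>t. sups_of_small_subsets t u X R),
     {sups_of_families u X R}}"
    (is "all_equivalent \<Theta> \<Gamma> ?C")
proof -
  have o: "resized_order \<Theta> \<Gamma> u w X R"
    using resizing carrier order by (simp add: resized_order_def)
  define cond where "cond P \<longleftrightarrow> (\<forall>X R. wk 1 (P X R) = P (wk 1 X) (wk 1 R)) \<and> is_type \<Theta> \<Gamma> (P X R)" for P
  have cond: "cond (sups_of_subsets t)" "cond (sups_of_covered_subsets t u)"
    "cond (sups_of_small_subsets t u)" "cond (sups_of_families u)" for t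
    using is_type_conditions[OF carrier order] by (simp_all add: cond_def)
  \<comment> \<open>All conditions are compared with the one on families: \<open>suff\<close> holds
    of those that imply it and \<open>nec\<close> of those that follow from it, in every
    context.\<close>
  define suff where "suff P \<longleftrightarrow> cond P \<and> (\<forall>\<Delta> X R. resized_order \<Theta> \<Delta> u w X R \<longrightarrow>
    inhabited \<Theta> \<Delta> (P X R) \<longrightarrow> inhabited \<Theta> \<Delta> (sups_of_families u X R))" for P
  define nec where "nec P \<longleftrightarrow> cond P \<and> (\<forall>\<Delta> X R. resized_order \<Theta> \<Delta> u w X R \<longrightarrow>
    inhabited \<Theta> \<Delta> (sups_of_families u X R) \<longrightarrow> inhabited \<Theta> \<Delta> (P X R))" for P
  \<comment> \<open>The level is \<open>u\<close>, that of images of families. The condition on all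
    subsets is reduced to the one on small subsets.\<close>
  have suff: "suff (sups_of_subsets u)" "suff (sups_of_covered_subsets u u)"
    "suff (sups_of_small_subsets u u)" "suff (sups_of_families u)"
    using cond inhabited_sups_of_families inhabited_sups_of_subsets_weaker(2)
    by (auto simp: suff_def resized_order_def)
  \<comment> \<open>The level \<open>t\<close> is arbitrary: families give suprema of all subsets by
    resizing, and covered and small subsets are special cases.\<close>
  have nec: "nec (sups_of_subsets t)" "nec (sups_of_covered_subsets t u)"
    "nec (sups_of_small_subsets t u)" "nec (sups_of_families u)" for t
    using cond inhabited_sups_of_subsets inhabited_sups_of_subsets_weaker[where t = t]
    by (auto simp: nec_def resized_order_def)
  have "entails \<Theta> \<Gamma> \<Phi> B" if \<Phi>: "\<Phi> \<in> ?C" and \<Psi>: "\<Psi> \<in> ?C" "B \<in> \<Psi>" for \<Phi> \<Psi> B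
  proof -
    \<comment> \<open>Every set of instances contains the one at level \<open>u\<close>. It implies
      the condition on families, so a one-element list of premises witnesses
      \<open>entails\<close>.\<close>
    have "sups_of_subsets u X R \<in> \<Phi> \<or> sups_of_covered_subsets u u X R \<in> \<Phi> \<or>
        sups_of_small_subsets u u X R \<in> \<Phi> \<or> sups_of_families u X R \<in> \<Phi>"
      using \<Phi> by auto
    then obtain P where P: "suff P" "P X R \<in> \<Phi>"
      by (elim disjE) (rule suff[THEN that], assumption)+
    obtain Q where Q: "B = Q X R" "nec Q" using \<Psi> nec by auto
    have "inhabited \<Theta> \<Gamma> (P X R \<rightharpoonup> Q X R)"
      by (rule inhabited_arr_of_conditions[OF o])
        (use P(1) Q(2) in \<open>auto simp: suff_def nec_def cond_def\<close>)
    then show ?thesis using P(2) Q(1) unfolding entails_def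
      by (intro exI[of _ "[P X R]"]) simp
  qed
  then show ?thesis unfolding all_equivalent_def by blast
qed

end
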